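(* Assume that $\mathrm{Mv}:\mathcal M(\Gamma)\to\mathcal M(\Xi\times\Sigma)$ is injective. Let $f=(f_t)_{t\in\mathcal T}\in H^{|\mathcal T|}$, $\alpha\in[0,\infty)$, and let $\hat\theta\in\Theta$ be arbitrary but fixed. Then the minimization problems $$(\mathrm P_\alpha(f))\quad\min_{\gamma\in\mathcal M_+(\Theta\times\Gamma),\ u\in\mathcal M_+(\Omega)^\Sigma}\|\gamma\|_{\mathcal M}+\frac1{2\alpha}\sum_{t\in\mathcal T}\|\mathrm{Ob}_tu_t-f_t\|_H^2\ \text{ s.t. }\overline{\mathrm{Mv}}_t\gamma=\mathrm{Rd}\,u_t\ \forall t\in\Sigma$$ and $$(\Pi\text{-}\mathrm P_\alpha(f))\quad\min_{\gamma\in\mathcal M_+(\Gamma)^\Theta,\ u\in\mathcal M_+(\Omega)^\Sigma}\|\gamma_{\hat\theta}\|_{\mathcal M}+\frac1{2\alpha}\sum_{t\in\mathcal T}\|\mathrm{Ob}_tu_t-f_t\|_H^2\ \text{ s.t. }\mathrm{Mv}_t\gamma_\theta=\mathrm{Rd}_\theta u_t\ \forall t\in\Sigma,\theta\in\Theta$$ are equivalent in the following sense. (1) If $(u,\gamma)$ solves $\mathrm P_\alpha(f)$, then $(u,(\gamma_\theta)_{\theta\in\Theta})$ solves $\Pi\text{-}\mathrm P_\alpha(f)$, where $\gamma=\mathcal H_\Theta\otimes_\theta\gamma_\theta$ is the unique decomposition of $\gamma$ for which $\theta\mapsto\int_{\Xi\times\Sigma}\varphi\,\mathrm d\,\mathrm{Mv}\gamma_\theta$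 is continuous for every $\varphi\in C(\Xi\times\Sigma)$. (2) If $(u,(\gamma_\theta)_{\theta\in\Theta})$ solves $\Pi\text{-}\mathrm P_\alpha(f)$, then $(u,\gamma)$ solves $\mathrm P_\alpha(f)$ with $\gamma:=\mathcal H_\Theta\otimes_\theta\gamma_\theta\in\mathcal M_+(\Theta\times\Gamma)$.
   Context: $\mathcal M(X)$ and $\mathcal M_+(X)$ denote the finite signed and the finite nonnegative Radon measures on $X$, $\|\cdot\|_{\mathcal M}$ the total variation norm, $g_\#\nu$ the pushforward. $d\in\mathbb N$; $\Omega\subset\mathbb R^d$, $\Sigma\subset\mathbb R$ and $\Theta\subset S^{d-1}$ are compact; $\emptyset\ne\mathcal T\subset\Sigma$ is finite; $\mathcal H_\Sigma$, $\mathcal H_\Theta$ are Borel probability measures on $\Sigma$, $\Theta$ with $\operatorname{supp}\mathcal H_\Theta=\Theta$. $\Lambda=\{(x,v)\in\mathbb R^d\times\mathbb R^d: x+tv\in\Omega\ \forall t\in\Sigma\}$, $\Gamma=\{(\theta\cdot x,\theta\cdot v):(x,v)\in\Lambda,\theta\in\Theta\}\subset\mathbb R^2$, $\Xi=\{\theta\cdot x:x\in\Omega,\theta\in\Theta\}\subset\mathbb R$; all are compact. Product notation: $(\nu_z\otimes_z\omega)(A\times B)=\int_B\nu_z(A)\,\mathrm d\omega(z)$, and analogously $(\omega\otimes_z\nu_z)(B\times A)=\int_B\nu_z(A)\,\mathrm d\omega(z)$, for families of measures depending measurably on $z$. Operators: $\mathrm{Rd}_\theta\nu=[x\mapsto\theta\cdot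 x]_\#\nu$, $\mathrm{Rd}\,\nu=\mathcal H_\Theta\otimes_\theta\mathrm{Rd}_\theta\nu\in\mathcal M(\Theta\times\Xi)$ for $\nu\in\mathcal M(\Omega)$; $\mathrm{Mv}_t\nu=[(x,v)\mapsto x+tv]_\#\nu$ and $\mathrm{Mv}\,\nu=\mathrm{Mv}_t\nu\otimes_t\mathcal H_\Sigma$ for $\nu\in\mathcal M(\Gamma)$; $\overline{\mathrm{Mv}}_t\gamma=[(\theta,x,v)\mapsto(\theta,x+tv)]_\#\gamma$ for $\gamma\in\mathcal M(\Theta\times\Gamma)$. $H$ is a Hilbert space and, for $t\in\mathcal T$, $\mathrm{Ob}_t:\mathcal M(\Omega)\to H$ is the dual of a bounded linear operator $\mathrm{Ob}_t^*:H\to C(\Omega)$. For $\alpha=0$ the data terms are interpreted as the constraints $\mathrm{Ob}_tu_t=f_t$ for all $t\in\mathcal T$. $\mathcal M_+(X)^I$ denotes families $(\nu_i)_{i\in I}$ in $\mathcal M_+(X)$. Under the injectivity assumption, the decomposition in (1) exists and is unique for every $\gamma$ that is admissible (with some $u$) in $\mathrm P_\alpha(f)$. *)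

theory Defs
  imports "HOL-Probability.Probability"
begin

section \<open>Finite signed Radon measures\<close>

text \<open>A finite signed measure on \<open>X\<close> is a real set function. It is set to 0 outside the
  Borel subsets of \<open>X\<close>, so that equality of set functions is equality of measures.\<close>

abbreviation borel_on :: "'a::topological_space set \<Rightarrow> 'a set set" where
  "borel_on X \<equiv> sets (restrict_space borel X)"

definition total_variation ::
    "'a::topological_space set \<Rightarrow> ('a set \<Rightarrow> real) \<Rightarrow> 'a set \<Rightarrow> real" where
  "total_variation X \<mu> A =
     (SUP P \<in> {P. finite P \<and> disjoint P \<and> P \<subseteq> borel_on X \<and> \<Union>P \<subseteq> A}. \<Sum>B\<in>P. \<bar>\<mu> B\<bar>)"

definition tv_norm :: "'a::topological_space set \<Rightarrow> ('a set \<Rightarrow> real) \<Rightarrow> real" where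
  "tv_norm X \<mu> = total_variation X \<mu> X"

text \<open>Inner regularity of the variation on all Borel sets implies outer regularity by
  complementation, because \<open>X\<close> is compact in all uses.\<close>

definition radon :: "'a::topological_space set \<Rightarrow> ('a set \<Rightarrow> real) set" where
  "radon X = {\<mu>.
     (\<forall>A. A \<notin> borel_on X \<longrightarrow> \<mu> A = 0) \<and>
     (\<forall>A::nat \<Rightarrow> 'a set. range A \<subseteq> borel_on X \<longrightarrow> disjoint_family A \<longrightarrow>
        (\<lambda>i. \<mu> (A i)) sums \<mu> (\<Union>i. A i)) \<and>
     (\<forall>A\<in>borel_on X. \<forall>e>0. \<exists>K\<subseteq>A. compact K \<and> total_variation X \<mu> (A - K) < e)}"

definition radon_plus :: "'a::topological_space set \<Rightarrow> ('a set \<Rightarrow> real) set" where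
  "radon_plus X = {\<mu> \<in> radon X. \<forall>A. 0 \<le> \<mu> A}"

text \<open>Integration against a signed measure through its Jordan decomposition, whose positive
  part is \<open>A \<mapsto> sup {\<mu> B | B \<subseteq> A}\<close>.\<close>

definition jordan_pos :: "'a::topological_space set \<Rightarrow> ('a set \<Rightarrow> real) \<Rightarrow> 'a measure" where
  "jordan_pos X \<mu> =
     measure_of X (borel_on X) (\<lambda>A. ennreal (SUP B \<in> {B \<in> borel_on X. B \<subseteq> A}. \<mu> B))"

definition signed_integral ::
    "'a::topological_space set \<Rightarrow> ('a set \<Rightarrow> real) \<Rightarrow> ('a \<Rightarrow> real) \<Rightarrow> real" where
  "signed_integral X \<mu> \<phi> =
     (\<integral>x. \<phi> x \<partial>jordan_pos X \<mu>) - (\<integral>x. \<phi> x \<partial>jordan_pos X (\<lambda>A. - \<mu> A))"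

definition pushforward ::
    "'a::topological_space set \<Rightarrow> 'b::topological_space set \<Rightarrow> ('a \<Rightarrow> 'b) \<Rightarrow>
     ('a set \<Rightarrow> real) \<Rightarrow> 'b set \<Rightarrow> real" where
  "pushforward X Y g \<nu> B = (if B \<in> borel_on Y then \<nu> (g -` B \<inter> X) else 0)"

definition measure_support :: "'a::topological_space measure \<Rightarrow> 'a set" where
  "measure_support M =
     {x \<in> space M. \<forall>U. open U \<longrightarrow> x \<in> U \<longrightarrow> 0 < emeasure M (U \<inter> space M)}"


section \<open>Products of a measure with a family of measures\<close>

definition measurable_family ::
    "'z measure \<Rightarrow> 'a::topological_space set \<Rightarrow> ('z \<Rightarrow> 'a set \<Rightarrow> real) \<Rightarrow> bool" where
  "measurable_family \<omega> X \<nu> \<longleftrightarrow>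
     (\<forall>z\<in>space \<omega>. \<nu> z \<in> radon X) \<and> (\<forall>A\<in>borel_on X. (\<lambda>z. \<nu> z A) \<in> borel_measurable \<omega>)"

text \<open>Both products are given on all Borel sets \<open>C\<close> by integrating over the sections of \<open>C\<close>; the
  formulas on rectangles are \<open>base_prod_times\<close> and \<open>prod_base_times\<close> below.\<close>

definition base_prod ::
    "'z::topological_space measure \<Rightarrow> 'a::topological_space set \<Rightarrow> ('z \<Rightarrow> 'a set \<Rightarrow> real) \<Rightarrow>
     ('z \<times> 'a) set \<Rightarrow> real" where
  "base_prod \<omega> X \<nu> C =
     (if C \<in> borel_on (space \<omega> \<times> X) then \<integral>z. \<nu> z {x. (z, x) \<in> C} \<partial>\<omega> else 0)"

definition prod_base ::
    "'a::topological_space set \<Rightarrow> ('z \<Rightarrow> 'a set \<Rightarrow> real) \<Rightarrow> 'z::topological_space measure \<Rightarrow>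
     ('a \<times> 'z) set \<Rightarrow> real" where
  "prod_base X \<nu> \<omega> C =
     (if C \<in> borel_on (X \<times> space \<omega>) then \<integral>z. \<nu> z {x. (x, z) \<in> C} \<partial>\<omega> else 0)"

lemma radon_empty: "\<mu> \<in> radon X \<Longrightarrow> \<mu> {} = 0"
proof -
  assume "\<mu> \<in> radon X"
  then have "(\<lambda>i::nat. \<mu> {}) sums \<mu> {}"
    by (auto simp: radon_def disjoint_family_on_def dest!: spec[of _ "\<lambda>_::nat. {}"])
  then show ?thesis
    using summable_const_iff sums_summable by blast
qed

lemma borel_on_Times:
  fixes A :: "'a::second_countable_topology set" and B :: "'b::second_countable_topology set"
  assumes "A \<in> borel_on X" "B \<in> borel_on Y"
  shows "A \<times> B \<in> borel_on (X \<times> Y)"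
proof -
  obtain A' B' where "A' \<in> sets borel" "A = X \<inter> A'" "B' \<in> sets borel" "B = Y \<inter> B'"
    using assms by (auto simp: sets_restrict_space)
  moreover have "A' \<times> B' \<in> sets borel" if "A' \<in> sets borel" "B' \<in> sets borel"
    using that by (metis borel_prod pair_measureI)
  ultimately show ?thesis
    by (auto simp: sets_restrict_space image_iff intro!: bexI[of _ "A' \<times> B'"])
qed

lemma base_prod_times:
  fixes \<omega> :: "'z::second_countable_topology measure" and X :: "'a::second_countable_topology set"
  assumes "sets \<omega> = borel_on (space \<omega>)" "\<And>z. z \<in> space \<omega> \<Longrightarrow> \<nu> z \<in> radon X"
    and "A \<in> borel_on X" "B \<in> sets \<omega>"
  shows "base_prod \<omega> X \<nu> (B \<times> A) = (LINT z:B|\<omega>. \<nu> z A)"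
proof -
  have "B \<times> A \<in> borel_on (space \<omega> \<times> X)"
    using assms by (intro borel_on_Times) auto
  moreover have "\<nu> z {x. (z, x) \<in> B \<times> A} = indicator B z *\<^sub>R \<nu> z A" if "z \<in> space \<omega>" for z
    using radon_empty[OF assms(2)[OF that]] by (auto simp: indicator_def)
  ultimately show ?thesis
    by (auto simp: base_prod_def set_lebesgue_integral_def intro!: Bochner_Integration.integral_cong)
qed

lemma prod_base_times:
  fixes \<omega> :: "'z::second_countable_topology measure" and X :: "'a::second_countable_topology set"
  assumes "sets \<omega> = borel_on (space \<omega>)" "\<And>z. z \<in> space \<omega> \<Longrightarrow> \<nu> z \<in> radon X"
    and "A \<in> borel_on X" "B \<in> sets \<omega>"
  shows "prod_base X \<nu> \<omega> (A \<times> B) = (LINT z:B|\<omega>. \<nu> z A)"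
proof -
  have "A \<times> B \<in> borel_on (X \<times> space \<omega>)"
    using assms by (intro borel_on_Times) auto
  moreover have "\<nu> z {x. (x, z) \<in> A \<times> B} = indicator B z *\<^sub>R \<nu> z A" if "z \<in> space \<omega>" for z
    using radon_empty[OF assms(2)[OF that]] by (auto simp: indicator_def)
  ultimately show ?thesis
    by (auto simp: prod_base_def set_lebesgue_integral_def intro!: Bochner_Integration.integral_cong)
qed


section \<open>Geometry and operators\<close>

text \<open>Throughout, \<open>S\<close> is the set of times, and \<open>\<Gamma>\<close>, \<open>\<Xi>\<close> stand for \<open>Gamma_set \<Omega> S \<Theta>\<close> and
  \<open>Xi_set \<Omega> \<Theta>\<close>.\<close>

definition Lambda_set :: "(real^'n) set \<Rightarrow> real set \<Rightarrow> ((real^'n) \<times> (real^'n)) set" where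
  "Lambda_set \<Omega> S = {(x, v). \<forall>t\<in>S. x + t *\<^sub>R v \<in> \<Omega>}"

definition Gamma_set ::
    "(real^'n) set \<Rightarrow> real set \<Rightarrow> (real^'n) set \<Rightarrow> (real \<times> real) set" where
  "Gamma_set \<Omega> S \<Theta> = {(\<theta> \<bullet> x, \<theta> \<bullet> v) | x v \<theta>. (x, v) \<in> Lambda_set \<Omega> S \<and> \<theta> \<in> \<Theta>}"

definition Xi_set :: "(real^'n) set \<Rightarrow> (real^'n) set \<Rightarrow> real set" where
  "Xi_set \<Omega> \<Theta> = {\<theta> \<bullet> x | x \<theta>. x \<in> \<Omega> \<and> \<theta> \<in> \<Theta>}"

definition Rd_at ::
    "(real^'n) set \<Rightarrow> real set \<Rightarrow> (real^'n) \<Rightarrow> ((real^'n) set \<Rightarrow> real) \<Rightarrow> real set \<Rightarrow> real" where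
  "Rd_at \<Omega> \<Xi> \<theta> \<nu> = pushforward \<Omega> \<Xi> (\<lambda>x. \<theta> \<bullet> x) \<nu>"

definition Rd ::
    "(real^'n) measure \<Rightarrow> (real^'n) set \<Rightarrow> real set \<Rightarrow> ((real^'n) set \<Rightarrow> real) \<Rightarrow>
     ((real^'n) \<times> real) set \<Rightarrow> real" where
  "Rd H\<^sub>\<Theta> \<Omega> \<Xi> \<nu> = base_prod H\<^sub>\<Theta> \<Xi> (\<lambda>\<theta>. Rd_at \<Omega> \<Xi> \<theta> \<nu>)"

definition Mv_at ::
    "(real \<times> real) set \<Rightarrow> real set \<Rightarrow> real \<Rightarrow> ((real \<times> real) set \<Rightarrow> real) \<Rightarrow>
     real set \<Rightarrow> real" where
  "Mv_at \<Gamma> \<Xi> t \<nu> = pushforward \<Gamma> \<Xi> (\<lambda>(x, v). x + t * v) \<nu>"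

definition Mv ::
    "real measure \<Rightarrow> (real \<times> real) set \<Rightarrow> real set \<Rightarrow> ((real \<times> real) set \<Rightarrow> real) \<Rightarrow>
     (real \<times> real) set \<Rightarrow> real" where
  "Mv H\<^sub>S \<Gamma> \<Xi> \<nu> = prod_base \<Xi> (\<lambda>t. Mv_at \<Gamma> \<Xi> t \<nu>) H\<^sub>S"

definition Mv_bar_at ::
    "(real^'n) set \<Rightarrow> (real \<times> real) set \<Rightarrow> real set \<Rightarrow> real \<Rightarrow>
     (((real^'n) \<times> real \<times> real) set \<Rightarrow> real) \<Rightarrow> ((real^'n) \<times> real) set \<Rightarrow> real" where
  "Mv_bar_at \<Theta> \<Gamma> \<Xi> t \<gamma> = pushforward (\<Theta> \<times> \<Gamma>) (\<Theta> \<times> \<Xi>) (\<lambda>(\<theta>, x, v). (\<theta>, x + t * v)) \<gamma>"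

text \<open>Bounded linear operators into \<open>C(X)\<close> with the supremum norm, \<open>X\<close> compact; only the values
  on \<open>X\<close> matter.\<close>

definition bounded_linear_to_C ::
    "'a::topological_space set \<Rightarrow> ('h::real_normed_vector \<Rightarrow> 'a \<Rightarrow> real) \<Rightarrow> bool" where
  "bounded_linear_to_C X B \<longleftrightarrow>
     (\<forall>h. continuous_on X (B h)) \<and>
     (\<forall>h k. \<forall>x\<in>X. B (h + k) x = B h x + B k x) \<and>
     (\<forall>c h. \<forall>x\<in>X. B (c *\<^sub>R h) x = c * B h x) \<and>
     (\<exists>K. \<forall>h. \<forall>x\<in>X. \<bar>B h x\<bar> \<le> K * norm h)"

text \<open>\<open>A\<close> is the dual of \<open>B\<close>, with the dual of \<open>C(X)\<close> identified with the signed Radon measures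
  and the dual of the Hilbert space with itself.\<close>

definition is_dual_of ::
    "'a::topological_space set \<Rightarrow> (('a set \<Rightarrow> real) \<Rightarrow> 'h::real_inner) \<Rightarrow>
     ('h \<Rightarrow> 'a \<Rightarrow> real) \<Rightarrow> bool" where
  "is_dual_of X A B \<longleftrightarrow> (\<forall>\<nu>\<in>radon X. \<forall>h. A \<nu> \<bullet> h = signed_integral X \<nu> (B h))"


section \<open>The two minimization problems\<close>

definition data_constraint ::
    "real set \<Rightarrow> (real \<Rightarrow> ('a set \<Rightarrow> real) \<Rightarrow> 'h) \<Rightarrow> real \<Rightarrow> (real \<Rightarrow> 'h) \<Rightarrow>
     (real \<Rightarrow> 'a set \<Rightarrow> real) \<Rightarrow> bool" where
  "data_constraint T Ob \<alpha> f u \<longleftrightarrow> (\<alpha> = 0 \<longrightarrow> (\<forall>t\<in>T. Ob t (u t) = f t))"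

definition data_term ::
    "real set \<Rightarrow> (real \<Rightarrow> ('a set \<Rightarrow> real) \<Rightarrow> 'h::real_normed_vector) \<Rightarrow> real \<Rightarrow>
     (real \<Rightarrow> 'h) \<Rightarrow> (real \<Rightarrow> 'a set \<Rightarrow> real) \<Rightarrow> real" where
  "data_term T Ob \<alpha> f u =
     (if \<alpha> = 0 then 0 else 1 / (2 * \<alpha>) * (\<Sum>t\<in>T. (norm (Ob t (u t) - f t))\<^sup>2))"

definition solves_P ::
    "(real^'n) set \<Rightarrow> real set \<Rightarrow> (real^'n) set \<Rightarrow> (real \<times> real) set \<Rightarrow> real set \<Rightarrow>
     (real^'n) measure \<Rightarrow> real set \<Rightarrow>
     (real \<Rightarrow> ((real^'n) set \<Rightarrow> real) \<Rightarrow> 'h::real_normed_vector) \<Rightarrow> real \<Rightarrow> (real \<Rightarrow> 'h) \<Rightarrow>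
     (real \<Rightarrow> (real^'n) set \<Rightarrow> real) \<Rightarrow> (((real^'n) \<times> real \<times> real) set \<Rightarrow> real) \<Rightarrow> bool" where
  "solves_P \<Omega> S \<Theta> \<Gamma> \<Xi> H\<^sub>\<Theta> T Ob \<alpha> f u \<gamma> \<longleftrightarrow>
     is_arg_min
       (\<lambda>(u, \<gamma>). tv_norm (\<Theta> \<times> \<Gamma>) \<gamma> + data_term T Ob \<alpha> f u)
       (\<lambda>(u, \<gamma>). u \<in> S \<rightarrow>\<^sub>E radon_plus \<Omega> \<and> \<gamma> \<in> radon_plus (\<Theta> \<times> \<Gamma>) \<and>
          (\<forall>t\<in>S. Mv_bar_at \<Theta> \<Gamma> \<Xi> t \<gamma> = Rd H\<^sub>\<Theta> \<Omega> \<Xi> (u t)) \<and>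
          data_constraint T Ob \<alpha> f u)
       (u, \<gamma>)"

definition solves_Pi_P ::
    "(real^'n) set \<Rightarrow> real set \<Rightarrow> (real^'n) set \<Rightarrow> (real \<times> real) set \<Rightarrow> real set \<Rightarrow>
     (real^'n) \<Rightarrow> real set \<Rightarrow>
     (real \<Rightarrow> ((real^'n) set \<Rightarrow> real) \<Rightarrow> 'h::real_normed_vector) \<Rightarrow> real \<Rightarrow> (real \<Rightarrow> 'h) \<Rightarrow>
     (real \<Rightarrow> (real^'n) set \<Rightarrow> real) \<Rightarrow> ((real^'n) \<Rightarrow> (real \<times> real) set \<Rightarrow> real) \<Rightarrow> bool" where
  "solves_Pi_P \<Omega> S \<Theta> \<Gamma> \<Xi> \<theta>\<^sub>0 T Ob \<alpha> f u g \<longleftrightarrow>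
     is_arg_min
       (\<lambda>(u, g). tv_norm \<Gamma> (g \<theta>\<^sub>0) + data_term T Ob \<alpha> f u)
       (\<lambda>(u, g). u \<in> S \<rightarrow>\<^sub>E radon_plus \<Omega> \<and> g \<in> \<Theta> \<rightarrow>\<^sub>E radon_plus \<Gamma> \<and>
          (\<forall>t\<in>S. \<forall>\<theta>\<in>\<Theta>. Mv_at \<Gamma> \<Xi> t (g \<theta>) = Rd_at \<Omega> \<Xi> \<theta> (u t)) \<and>
          data_constraint T Ob \<alpha> f u)
       (u, g)"

definition continuous_decomposition ::
    "real set \<Rightarrow> (real^'n) set \<Rightarrow> (real \<times> real) set \<Rightarrow> real set \<Rightarrow>
     real measure \<Rightarrow> (real^'n) measure \<Rightarrow>
     (((real^'n) \<times> real \<times> real) set \<Rightarrow> real) \<Rightarrow> ((real^'n) \<Rightarrow> (real \<times> real) set \<Rightarrow> real) \<Rightarrow> bool" where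
  "continuous_decomposition S \<Theta> \<Gamma> \<Xi> H\<^sub>S H\<^sub>\<Theta> \<gamma> g \<longleftrightarrow>
     g \<in> \<Theta> \<rightarrow>\<^sub>E radon_plus \<Gamma> \<and> measurable_family H\<^sub>\<Theta> \<Gamma> g \<and> \<gamma> = base_prod H\<^sub>\<Theta> \<Gamma> g \<and>
     (\<forall>\<phi>. continuous_on (\<Xi> \<times> S) \<phi> \<longrightarrow>
        continuous_on \<Theta> (\<lambda>\<theta>. signed_integral (\<Xi> \<times> S) (Mv H\<^sub>S \<Gamma> \<Xi> (g \<theta>)) \<phi>))"

end

theory Submission
  imports Defs
begin

text \<open>
  Both feasible sets turn out to have the same \<open>u\<close>-components, and on each of them the objective
  equals \<open>u t \<Omega>\<close> plus the data term, for an arbitrary time \<open>t\<close>, because all operators preserve mass.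
  So only the constraints have to be compared.

  Given a solution \<open>(u, \<gamma>)\<close> of the constraints of the first problem, normalise
  \<open>\<gamma> (B \<times> \<cdot>)\<close> for balls \<open>B\<close> shrinking to a direction \<open>\<theta>\<close>. The image of this measure under each move
  operator is the average over \<open>B\<close> of the projections of \<open>u t\<close>, so every weak limit solves the
  constraints of the second problem in the direction \<open>\<theta>\<close>, for all \<open>t\<close> simultaneously. This avoids
  disintegration and exceptional null sets. By injectivity the limit \<open>\<gamma>\<^sub>\<theta>\<close> is unique, hence weakly
  continuous in \<open>\<theta>\<close>, and injectivity applied to \<open>\<gamma> (B \<times> \<cdot>)\<close> for all Borel sets \<open>B\<close> shows that a
  feasible \<open>\<gamma>\<close> is determined by \<open>u\<close>, so it is the product of \<open>H\<^sub>\<Theta>\<close> with the family \<open>\<gamma>\<^sub>\<theta>\<close>.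

  Weak compactness on a compact subset of the plane is pulled back to Helly's theorem on the line
  through a space-filling curve with a Borel section.
\<close>

section \<open>Nonnegative Radon measures as Borel measures\<close>

text \<open>The constraint of the first problem is an equality of measures on \<Theta> \<times>
  \<Xi>. Disintegrating it gives, for each time t, the constraint of the second problem only for
  almost every direction, with a null set depending on t, while the second problem asks for every
  direction and every t in a possibly uncountable \<open>S\<close>. Averages over sets of directions
  of positive measure satisfy the averaged constraint exactly, and the full support of
  \<open>H\<^sub>\<Theta>\<close> makes every ball around a point of \<Theta> such a set. The
  averages converge because \<theta> \<bullet> x is jointly continuous, so that the projections of
  \<open>u t\<close> depend weakly continuously on \<theta>. Full support enters once more in the
  uniqueness of the decomposition: continuous functions of \<theta> that agree almost everywhere
  agree on all of \<Theta>. The compactness of \<Gamma>, needed for the weak limits, is itself drawn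
  from injectivity.\<close>

definition finite_borel :: "'a::topological_space measure \<Rightarrow> bool" where
  "finite_borel M \<longleftrightarrow> finite_measure M \<and> sets M = sets borel"

text \<open>Nonnegative Radon measures on \<open>X\<close> correspond to finite Borel measures on the whole space that
  are carried by \<open>X\<close>, through the mutually inverse maps \<open>borel_ext X\<close> and \<open>trace_on X\<close>. On the Borel
  side no measurability relative to \<open>X\<close> is needed.\<close>

definition borel_ext :: "'a::topological_space set \<Rightarrow> ('a set \<Rightarrow> real) \<Rightarrow> 'a measure" where
  "borel_ext X \<mu> = measure_of UNIV (sets borel) (\<lambda>A. ennreal (\<mu> (A \<inter> X)))"

definition trace_on :: "'a::topological_space set \<Rightarrow> 'a measure \<Rightarrow> 'a set \<Rightarrow> real" where
  "trace_on X M A = (if A \<in> borel_on X then measure M A else 0)"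

lemma finite_borelD:
  assumes "finite_borel M"
  shows "finite_measure M" "sets M = sets borel" "space M = UNIV"
  using assms sets_eq_imp_space_eq[of M borel] by (auto simp: finite_borel_def)

lemma finite_borel_distr:
  assumes "finite_borel M" "g \<in> borel_measurable borel"
  shows "finite_borel (distr M borel g)"
proof -
  have "g \<in> borel_measurable M"
    using assms measurable_cong_sets[OF finite_borelD(2)] by blast
  then show ?thesis
    using assms by (auto simp: finite_borel_def intro: finite_measure.finite_measure_distr)
qed

lemma finite_borel_eqI:
  assumes "finite_borel M" "finite_borel N"
    and "\<And>A. A \<in> sets borel \<Longrightarrow> measure M A = measure N A"
  shows "M = N"
  using assms by (intro measure_eqI)
    (auto simp: finite_borel_def finite_measure.emeasure_eq_measure)

lemma borel_on_iff: "X \<in> sets borel \<Longrightarrow> A \<in> borel_on X \<longleftrightarrow> A \<in> sets borel \<and> A \<subseteq> X"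
  by (auto simp: sets_restrict_space_iff)

lemma borel_on_Int: "A \<in> sets borel \<Longrightarrow> A \<inter> X \<in> borel_on X"
  by (auto simp: sets_restrict_space)

lemma radon_plusD:
  assumes "\<mu> \<in> radon_plus X"
  shows "0 \<le> \<mu> A" "A \<notin> borel_on X \<Longrightarrow> \<mu> A = 0" "\<mu> \<in> radon X" "\<mu> {} = 0"
    "range B \<subseteq> borel_on X \<Longrightarrow> disjoint_family B \<Longrightarrow> (\<lambda>i::nat. \<mu> (B i)) sums \<mu> (\<Union>i. B i)"
  using assms radon_empty[of \<mu> X] by (auto simp: radon_plus_def radon_def)

lemma emeasure_borel_ext:
  assumes "\<mu> \<in> radon_plus X" "A \<in> sets borel"
  shows "emeasure (borel_ext X \<mu>) A = ennreal (\<mu> (A \<inter> X))"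
proof (rule emeasure_measure_of[OF borel_ext_def])
  have sets: "sets (borel_ext X \<mu>) = sets borel"
    using sets.sigma_sets_eq[of borel] by (simp add: borel_ext_def)
  show "countably_additive (sets (borel_ext X \<mu>)) (\<lambda>A. ennreal (\<mu> (A \<inter> X)))"
  proof (rule countably_additiveI)
    fix B :: "nat \<Rightarrow> 'a set"
    assume B: "range B \<subseteq> sets (borel_ext X \<mu>)" "disjoint_family B"
    have "(\<lambda>i. \<mu> (B i \<inter> X)) sums \<mu> (\<Union>i. B i \<inter> X)"
      using B by (intro radon_plusD(5)[OF assms(1)])
        (auto simp: sets disjoint_family_on_def intro!: borel_on_Int)
    then have "(\<lambda>i. ennreal (\<mu> (B i \<inter> X))) sums ennreal (\<mu> (\<Union>i. B i \<inter> X))"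
      using radon_plusD(1)[OF assms(1)] by simp
    then show "(\<Sum>i. ennreal (\<mu> (B i \<inter> X))) = ennreal (\<mu> ((\<Union>i. B i) \<inter> X))"
      by (simp add: sums_iff)
  qed
qed (use assms radon_plusD[OF assms(1)] in \<open>auto simp: positive_def borel_ext_def\<close>)

lemma
  assumes "\<mu> \<in> radon_plus X"
  shows finite_borel_borel_ext: "finite_borel (borel_ext X \<mu>)"
    and measure_borel_ext: "A \<in> sets borel \<Longrightarrow> measure (borel_ext X \<mu>) A = \<mu> (A \<inter> X)"
proof -
  have *: "sets (borel_ext X \<mu>) = sets borel"
    using sets.sigma_sets_eq[of borel] by (simp add: borel_ext_def)
  then have "space (borel_ext X \<mu>) = UNIV"
    using sets_eq_imp_space_eq[of _ borel] by auto
  then show "finite_borel (borel_ext X \<mu>)"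
    using emeasure_borel_ext[OF assms, of UNIV] *
    by (auto simp: finite_borel_def intro!: finite_measureI)
  show "measure (borel_ext X \<mu>) A = \<mu> (A \<inter> X)" if "A \<in> sets borel"
    using that emeasure_borel_ext[OF assms, of A] radon_plusD(1)[OF assms] by (simp add: measure_def)
qed

lemma trace_on_borel_ext:
  assumes "\<mu> \<in> radon_plus X" "X \<in> sets borel"
  shows "trace_on X (borel_ext X \<mu>) = \<mu>"
proof (rule ext)
  fix A show "trace_on X (borel_ext X \<mu>) A = \<mu> A"
    using assms radon_plusD(2)[OF assms(1), of A] measure_borel_ext[OF assms(1), of A]
    by (auto simp: trace_on_def borel_on_iff Int_absorb2)
qed

lemma borel_ext_trace_on:
  assumes "finite_borel M" "X \<in> sets borel" "measure M (-X) = 0" "trace_on X M \<in> radon_plus X"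
  shows "borel_ext X (trace_on X M) = M"
proof (rule finite_borel_eqI)
  show "finite_borel (borel_ext X (trace_on X M))"
    by (rule finite_borel_borel_ext[OF assms(4)])
  fix A :: "'a set" assume A: "A \<in> sets borel"
  interpret finite_measure M using finite_borelD[OF assms(1)] by auto
  have "measure M A = measure M (A \<inter> X) + measure M (A - X)"
    using A assms finite_borelD(2)[OF assms(1)] finite_measure_Union[of "A \<inter> X" "A - X"]
    by (auto simp: Un_Diff_Int Int_Un_distrib Un_commute)
  moreover have "measure M (A - X) \<le> measure M (-X)"
    using A assms finite_borelD(2)[OF assms(1)] by (intro finite_measure_mono) auto
  ultimately show "measure (borel_ext X (trace_on X M)) A = measure M A"
    using A assms measure_borel_ext[OF assms(4) A] measure_nonneg[of M "A - X"]
    by (auto simp: trace_on_def borel_on_Int)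
qed fact

text \<open>By additivity and monotonicity no finite disjoint family in \<open>A\<close> gives more
  than \<open>measure M A\<close>, and the family \<open>{A}\<close> attains this, so the supremum
  is a maximum.\<close>

lemma total_variation_eq:
  fixes \<mu> :: "'a::topological_space set \<Rightarrow> real"
  assumes M: "finite_borel M" and "\<And>B. B \<in> borel_on X \<Longrightarrow> B \<subseteq> A \<Longrightarrow> \<mu> B = measure M B"
    and "X \<in> sets borel" "A \<in> borel_on X"
  shows "total_variation X \<mu> A = measure M A"
proof -
  interpret finite_measure M using finite_borelD[OF M] by auto
  have sets: "B \<in> sets M" if "B \<in> borel_on X" for B
    using that assms finite_borelD[OF M] by (auto simp: borel_on_iff)
  have le: "(\<Sum>B\<in>P. \<bar>\<mu> B\<bar>) \<le> measure M A"
    if P: "finite P" "disjoint P" "P \<subseteq> borel_on X" "\<Union>P \<subseteq> A" for P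
  proof -
    have "(\<Sum>B\<in>P. \<bar>\<mu> B\<bar>) = (\<Sum>B\<in>P. measure M B)"
    proof (intro sum.cong refl)
      fix B assume "B \<in> P"
      then have "\<mu> B = measure M B" using P by (intro assms(2)) auto
      then show "\<bar>\<mu> B\<bar> = measure M B" by simp
    qed
    also have "\<dots> = measure M (\<Union>P)"
    proof (subst finite_measure_finite_Union[of P id, simplified])
      show "disjoint_family_on id P" "P \<subseteq> sets M"
        using P sets by (auto simp: disjoint_family_on_def disjoint_def)
    qed (use P in auto)
    also have "\<dots> \<le> measure M A"
      using P assms(4) sets by (intro finite_measure_mono) auto
    finally show ?thesis .
  qed
  show ?thesis
    unfolding total_variation_def
  proof (rule cSup_eq_maximum)
    show "measure M A \<in> (\<lambda>P. \<Sum>B\<in>P. \<bar>\<mu> B\<bar>) ` {P. finite P \<and> disjoint P \<and> P \<subseteq> borel_on X \<and> \<Union> P \<subseteq> A}"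
      using assms(2)[OF assms(4)] assms(4) by (intro image_eqI[of _ _ "{A}"]) auto
  qed (use le in auto)
qed

text \<open>Countable additivity is inherited, and the regularity clause is automatic, since finite
  Borel measures on a Polish space are inner regular with respect to compact sets. Hence any measure
  built on the Borel side yields a member of \<open>radon_plus X\<close> without further
  work.\<close>

lemma trace_on_radon_plus:
  fixes X :: "'a::polish_space set"
  assumes M: "finite_borel M" and X: "X \<in> sets borel"
  shows "trace_on X M \<in> radon_plus X"
proof -
  interpret finite_measure M using finite_borelD[OF M] by auto
  have sets: "B \<in> sets M" if "B \<in> borel_on X" for B
    using that X finite_borelD[OF M] by (auto simp: borel_on_iff)
  have "(\<lambda>i. trace_on X M (A i)) sums trace_on X M (\<Union>i. A i)"
    if A: "range A \<subseteq> borel_on X" "disjoint_family A" for A :: "nat \<Rightarrow> 'a set"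
  proof -
    have "range A \<subseteq> sets M" "(\<Union>i. A i) \<in> borel_on X" "\<And>i. A i \<in> borel_on X"
      using A sets by auto
    then show ?thesis
      using finite_measure_UNION[of A] A by (simp add: trace_on_def)
  qed
  moreover have "\<exists>K\<subseteq>A. compact K \<and> total_variation X (trace_on X M) (A - K) < e"
    if A: "A \<in> borel_on X" and e: "e > 0" for A e
  proof -
    have AM: "A \<in> sets M" "A \<in> sets borel" using A sets finite_borelD[OF M] by auto
    have "\<exists>K\<in>{K. K \<subseteq> A \<and> compact K}. emeasure M A < emeasure M K + ennreal e"
    \<comment> \<open>\<open>ennreal_between\<close> needs a positive value; for a null set
      \<open>A\<close> the empty compact set serves.\<close>
    proof (cases "emeasure M A = 0")
      case False
      then have "emeasure M A - ennreal e < emeasure M A"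
        using e by (intro ennreal_between) (auto simp: emeasure_eq_measure zero_less_measure_iff)
      also have "emeasure M A = (SUP K \<in> {K. K \<subseteq> A \<and> compact K}. emeasure M K)"
        using AM finite_borelD[OF M] by (intro inner_regular) (auto simp: emeasure_eq_measure)
      finally obtain K where K: "K \<subseteq> A" "compact K" "emeasure M A - ennreal e < emeasure M K"
        by (auto simp: less_SUP_iff)
      have "ennreal (measure M A - e) < ennreal (measure M K)"
        using K(3) e by (simp add: emeasure_eq_measure ennreal_minus)
      then have "measure M A < measure M K + e"
      \<comment> \<open>\<open>ennreal\<close> cuts negative numbers off at 0, so the inequality
        transfers to the reals only after the case \<open>measure M A < e\<close> is split
        off.\<close>
      proof (cases "0 \<le> measure M A - e")
        case False
        then show ?thesis using measure_nonneg[of M K] by linarith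
      qed (auto simp: ennreal_less_iff)
      then have "emeasure M A < emeasure M K + ennreal e"
        using e by (simp add: emeasure_eq_measure ennreal_plus[symmetric] ennreal_less_iff
            del: ennreal_plus)
      with K show ?thesis by auto
    qed (use e in \<open>auto intro!: bexI[of _ "{}"]\<close>)
    then obtain K where K: "K \<subseteq> A" "compact K" "emeasure M A < emeasure M K + ennreal e"
      by auto
    have KM: "K \<in> sets borel" using compact_imp_closed[OF K(2)] by auto
    have "total_variation X (trace_on X M) (A - K) = measure M (A - K)"
      using A KM K X by (intro total_variation_eq[OF M]) (auto simp: trace_on_def borel_on_iff)
    also have "\<dots> = measure M A - measure M K"
      using AM KM K finite_borelD[OF M] by (intro finite_measure_Diff) auto
    also have "\<dots> < e"
      using K(3) e by (simp add: emeasure_eq_measure ennreal_plus[symmetric] ennreal_less_iff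
            del: ennreal_plus)
    finally show ?thesis using K by auto
  qed
  moreover have "A \<notin> borel_on X \<Longrightarrow> trace_on X M A = 0" "0 \<le> trace_on X M A" for A
    by (auto simp: trace_on_def)
  ultimately show ?thesis
    unfolding radon_plus_def radon_def by blast
qed

lemma tv_norm_radon_plus:
  fixes X :: "'a::topological_space set"
  assumes "\<mu> \<in> radon_plus X" "X \<in> sets borel"
  shows "tv_norm X \<mu> = \<mu> X"
proof -
  have "total_variation X \<mu> X = measure (borel_ext X \<mu>) X"
    using assms measure_borel_ext[OF assms(1)]
    by (intro total_variation_eq finite_borel_borel_ext) (auto simp: borel_on_iff Int_absorb2)
  then show ?thesis
    using assms measure_borel_ext[OF assms(1), of X] by (simp add: tv_norm_def)
qed

lemma pushforward_eq_trace_on: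
  assumes "\<mu> \<in> radon_plus X" "X \<in> sets borel" "Y \<in> sets borel"
    and g: "g \<in> borel_measurable borel"
  shows "pushforward X Y g \<mu> = trace_on Y (distr (borel_ext X \<mu>) borel g)"
proof (rule ext)
  fix A
  note fb = finite_borelD[OF finite_borel_borel_ext[OF assms(1)]]
  have "g \<in> borel_measurable (borel_ext X \<mu>)"
    using g measurable_cong_sets[OF fb(2)] by blast
  then show "pushforward X Y g \<mu> A = trace_on Y (distr (borel_ext X \<mu>) borel g) A"
    using assms measurable_sets[OF g, of A]
    by (auto simp: pushforward_def trace_on_def measure_distr borel_on_iff measure_borel_ext fb)
qed

lemma measure_borel_ext_Compl:
  assumes "\<mu> \<in> radon_plus X" "X \<in> sets borel"
  shows "measure (borel_ext X \<mu>) (-X) = 0"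
  using assms measure_borel_ext[OF assms(1), of "-X"] radon_plusD[OF assms(1)] by simp

text \<open>Since \<open>g\<close> maps \<open>X\<close> into \<open>Y\<close>, the image measure
  does not charge the complement of \<open>Y\<close>, so cutting it to \<open>Y\<close> and
  extending it back loses nothing. Equalities of pushforwards may therefore be checked as equalities
  of \<open>distr\<close> on the whole space.\<close>

lemma
  fixes X :: "'a::topological_space set" and Y :: "'b::polish_space set"
  assumes \<mu>: "\<mu> \<in> radon_plus X" and X: "X \<in> sets borel" and Y: "Y \<in> sets borel"
    and g: "g \<in> borel_measurable borel" and gXY: "g ` X \<subseteq> Y"
  shows pushforward_radon_plus: "pushforward X Y g \<mu> \<in> radon_plus Y"
    and borel_ext_pushforward:
      "borel_ext Y (pushforward X Y g \<mu>) = distr (borel_ext X \<mu>) borel g"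
proof -
  note fb = finite_borel_borel_ext[OF \<mu>] finite_borelD[OF finite_borel_borel_ext[OF \<mu>]]
  note fb' = finite_borel_distr[OF fb(1) g]
  note eq = pushforward_eq_trace_on[OF \<mu> X Y g]
  show rp: "pushforward X Y g \<mu> \<in> radon_plus Y"
    unfolding eq by (rule trace_on_radon_plus[OF fb' Y])
  have gM: "g \<in> borel_measurable (borel_ext X \<mu>)"
    using g measurable_cong_sets[OF fb(3)] by blast
  interpret finite_measure "borel_ext X \<mu>" by fact
  have "measure (borel_ext X \<mu>) (g -` (-Y)) \<le> measure (borel_ext X \<mu>) (-X)"
    using gXY measurable_sets[OF g, of "-Y"] X Y by (intro finite_measure_mono) (auto simp: fb)
  then have "measure (distr (borel_ext X \<mu>) borel g) (-Y) = 0"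
    using gM Y measure_borel_ext_Compl[OF \<mu> X] measure_nonneg[of "borel_ext X \<mu>" "g -` (-Y)"]
    by (simp add: measure_distr fb)
  then show "borel_ext Y (pushforward X Y g \<mu>) = distr (borel_ext X \<mu>) borel g"
    using rp unfolding eq by (intro borel_ext_trace_on fb' Y)
qed

text \<open>For a nonnegative measure the supremum in \<open>jordan_pos\<close> is attained at
  \<open>A\<close> itself, and for its negative at the empty set, so the negative part vanishes. The
  Borel function \<open>\<psi>\<close> stands in for \<open>\<phi>\<close>, whose values off
  \<open>X\<close> are arbitrary.\<close>

lemma signed_integral_radon_plus:
  fixes X :: "'a::polish_space set"
  assumes \<mu>: "\<mu> \<in> radon_plus X" and X: "X \<in> sets borel"
    and \<psi>: "\<psi> \<in> borel_measurable borel" "\<And>x. x \<in> X \<Longrightarrow> \<psi> x = \<phi> x"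
  shows "signed_integral X \<mu> \<phi> = (\<integral>x. \<psi> x \<partial>borel_ext X \<mu>)"
proof -
  let ?M = "borel_ext X \<mu>"
  let ?R = "restrict_space ?M X"
  note fb = finite_borel_borel_ext[OF \<mu>] finite_borelD[OF finite_borel_borel_ext[OF \<mu>]]
  interpret finite_measure ?M by fact
  have in_M: "B \<in> sets ?M" "measure ?M B = \<mu> B" if "B \<in> borel_on X" for B
    using that X measure_borel_ext[OF \<mu>, of B] fb by (auto simp: borel_on_iff Int_absorb2)
  have setsR: "sets ?R = borel_on X" by (rule sets_restrict_space_cong[OF fb(3)])
  have spR: "space ?R = X" by (simp add: space_restrict_space fb)
  have mono: "\<mu> B \<le> \<mu> A" if "A \<in> borel_on X" "B \<in> borel_on X" "B \<subseteq> A" for A B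
    using finite_measure_mono[OF that(3) in_M(1)[OF that(1)]] in_M(2)[OF that(1)] in_M(2)[OF that(2)]
    by simp
  have pos: "(SUP B \<in> {B \<in> borel_on X. B \<subseteq> A}. \<mu> B) = \<mu> A" if "A \<in> borel_on X" for A
  proof (rule cSup_eq_maximum)
    show "y \<le> \<mu> A" if "y \<in> \<mu> ` {B \<in> borel_on X. B \<subseteq> A}" for y
      using that mono[OF \<open>A \<in> _\<close>] by blast
  qed (use that in auto)
  have neg: "(SUP B \<in> {B \<in> borel_on X. B \<subseteq> A}. - \<mu> B) = 0" for A
  proof (rule cSup_eq_maximum)
    show "0 \<in> (\<lambda>B. - \<mu> B) ` {B \<in> borel_on X. B \<subseteq> A}"
      using radon_plusD[OF \<mu>] by (intro image_eqI[of _ _ "{}"]) auto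
  qed (use radon_plusD[OF \<mu>] in auto)
  have sub: "borel_on X \<subseteq> Pow X" by (auto simp: sets_restrict_space)
  have "jordan_pos X \<mu> = measure_of (space ?R) (sets ?R) (emeasure ?R)"
    unfolding jordan_pos_def spR setsR
  proof (rule measure_of_eq[OF sub])
    fix A assume "A \<in> sigma_sets X (borel_on X)"
    then have A: "A \<in> borel_on X"
      using sets.sigma_sets_eq[of "restrict_space borel X"] by (simp add: space_restrict_space)
    have "emeasure ?R A = ennreal (\<mu> A)"
      using A X in_M fb by (subst emeasure_restrict_space)
        (auto simp: emeasure_eq_measure borel_on_iff)
    then show "ennreal (SUP B \<in> {B \<in> borel_on X. B \<subseteq> A}. \<mu> B) = emeasure ?R A"
      using pos[OF A] by simp
  qed
  then have p: "jordan_pos X \<mu> = ?R" by (simp add: measure_of_of_measure)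
  have "emeasure (jordan_pos X (\<lambda>A. - \<mu> A)) A = 0" for A
    by (simp add: jordan_pos_def neg emeasure_measure_of_conv)
  then have "(\<integral>x. \<phi> x \<partial>jordan_pos X (\<lambda>A. - \<mu> A)) = 0"
    by (intro integral_eq_zero_AE AE_I[of _ _ "space _"]) auto
  moreover have "(\<integral>x. \<phi> x \<partial>?R) = (\<integral>x. \<psi> x \<partial>?R)"
    using \<psi> by (intro Bochner_Integration.integral_cong) (auto simp: spR)
  moreover have "\<dots> = (\<integral>x. indicator X x *\<^sub>R \<psi> x \<partial>?M)"
    using X fb by (intro integral_restrict_space) auto
  moreover have "\<dots> = (\<integral>x. \<psi> x \<partial>?M)"
  proof (rule integral_cong_AE)
    have "AE x in ?M. x \<notin> -X"
      using X fb measure_borel_ext_Compl[OF \<mu> X]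
      by (intro AE_not_in null_setsI) (auto simp: emeasure_eq_measure)
    then show "AE x in ?M. indicator X x *\<^sub>R \<psi> x = \<psi> x" by eventually_elim auto
    show "\<psi> \<in> borel_measurable ?M" "(\<lambda>x. indicator X x *\<^sub>R \<psi> x) \<in> borel_measurable ?M"
      using X \<psi>(1) fb by (auto simp: measurable_cong_sets[OF fb(3) refl])
  qed
  ultimately show ?thesis
    by (simp add: signed_integral_def p)
qed

section \<open>A space-filling curve with a Borel section\<close>

text \<open>The digit of weight \<open>1 / 2 ^ Suc k\<close>. Taken from a floor, it is a Borel
  function of \<open>x\<close>; this makes the section of the curve Borel.\<close>

definition bindigit :: "nat \<Rightarrow> real \<Rightarrow> real" where
  "bindigit k x = of_int (\<lfloor>2 ^ Suc k * x\<rfloor> mod 2)"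

lemma bindigit_cases: "bindigit k x = 0 \<or> bindigit k x = 1"
  unfolding bindigit_def by (metis mod_2_eq_odd of_int_0 of_int_1 of_bool_eq_1_iff of_bool_eq_0_iff)

lemma borel_measurable_bindigit [measurable]: "bindigit k \<in> borel_measurable borel"
  unfolding bindigit_def by measurable

lemma bindigit_sums:
  assumes "0 \<le> x" "x < 1"
  shows "(\<lambda>k. bindigit k x / 2 ^ Suc k) sums x"
proof -
  \<comment> \<open>The partial sums are the dyadic truncations of \<open>x\<close>; for
    \<open>n = 0\<close> this is \<open>\<lfloor>x\<rfloor> = 0\<close>, which needs
    \<open>x < 1\<close>.\<close>
  have eq: "(\<Sum>k<n. bindigit k x / 2 ^ Suc k) = of_int \<lfloor>2 ^ n * x\<rfloor> / 2 ^ n" for n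
  proof (induction n)
    case 0
    have "\<lfloor>x\<rfloor> = 0" using assms by (simp add: floor_eq_iff)
    then show ?case by simp
  next
    case (Suc n)
    have "\<lfloor>2 ^ Suc n * x / of_int 2\<rfloor> = \<lfloor>2 ^ Suc n * x\<rfloor> div 2"
      by (rule floor_divide_real_eq_div) simp
    then have "\<lfloor>2 ^ Suc n * x\<rfloor> = 2 * \<lfloor>2 ^ n * x\<rfloor> + \<lfloor>2 ^ Suc n * x\<rfloor> mod 2"
      by simp
    then have "real_of_int \<lfloor>2 ^ Suc n * x\<rfloor> = 2 * real_of_int \<lfloor>2 ^ n * x\<rfloor> + bindigit n x"
      unfolding bindigit_def by linarith
    with Suc show ?case by (simp add: field_simps)
  qed
  have "(\<lambda>n. of_int \<lfloor>2 ^ n * x\<rfloor> / 2 ^ n) \<longlonglongrightarrow> x"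
  proof (rule real_tendsto_sandwich)
    show "(\<lambda>n. x - (1/2) ^ n) \<longlonglongrightarrow> x"
      by (rule tendsto_eq_intros LIMSEQ_power_zero refl | simp)+
    have "(2 ^ n * x - 1) / 2 ^ n \<le> real_of_int \<lfloor>2 ^ n * x\<rfloor> / 2 ^ n" for n
      by (intro divide_right_mono) (linarith, simp)
    then have "x - (1/2) ^ n \<le> of_int \<lfloor>2 ^ n * x\<rfloor> / 2 ^ n" for n
      by (simp add: diff_divide_distrib power_one_over)
    then show "\<forall>\<^sub>F n in sequentially. x - (1/2) ^ n \<le> of_int \<lfloor>2 ^ n * x\<rfloor> / 2 ^ n"
      by simp
    have "of_int \<lfloor>2 ^ n * x\<rfloor> / 2 ^ n \<le> x" for n
      by (simp add: field_simps)
    then show "\<forall>\<^sub>F n in sequentially. of_int \<lfloor>2 ^ n * x\<rfloor> / 2 ^ n \<le> x"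
      by simp
  qed simp
  then show ?thesis
    unfolding sums_def eq .
qed

text \<open>Schoenberg's construction: \<open>wave\<close> has period 2 and is constant on \<open>[0, 1/3]\<close> and on \<open>[2/3, 1]\<close>, so
  \<open>wave (3 ^ k * t)\<close> reads off the \<open>k\<close>-th ternary digit of a point \<open>t\<close> of the Cantor set.\<close>

definition wave :: "real \<Rightarrow> real" where
  "wave t = max 0 (min 1 (1/2 - cos (pi * t)))"

lemma wave_bounds: "0 \<le> wave t" "wave t \<le> 1" "\<bar>wave t\<bar> \<le> 1"
  by (auto simp: wave_def)

lemma wave_add_even: "wave (t + 2 * of_int m) = wave t"
proof -
  have "cos (pi * (t + 2 * of_int m)) = cos (pi * t)"
    using cos.plus_of_int[of "pi * t" m] by (simp add: algebra_simps)
  then show ?thesis by (simp add: wave_def)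
qed

text \<open>\<open>cos\<close> falls through 1/2 at pi/3 and through -1/2 at 2 pi/3, so on
  \<open>[0, 1]\<close> the term \<open>1/2 - cos (pi * t)\<close> is at most 0 up to 1/3 and at
  least 1 from 2/3 on. This is the origin of the clipped cosine in \<open>wave\<close>.\<close>

lemma wave_eq_0: "0 \<le> t \<Longrightarrow> t \<le> 1/3 \<Longrightarrow> wave t = 0"
  using cos_monotone_0_pi_le[of "pi * t" "pi/3"] cos_60 by (auto simp: wave_def)

lemma wave_eq_1: "2/3 \<le> t \<Longrightarrow> t \<le> 1 \<Longrightarrow> wave t = 1"
  using cos_monotone_0_pi_le[of "pi * (2/3)" "pi * t"] cos_120 by (auto simp: wave_def mult.commute)

text \<open>The Cantor set point with ternary digits \<open>2 * a j\<close>; the digits 0 and 2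
  leave the middle third free, where \<open>wave\<close> climbs from 0 to 1.\<close>

definition cantor_val :: "(nat \<Rightarrow> real) \<Rightarrow> real" where
  "cantor_val a = (\<Sum>j. 2 * a j / 3 ^ Suc j)"

lemma
  assumes "\<And>j. a j = 0 \<or> a j = 1"
  shows summable_cantor_val: "summable (\<lambda>j. 2 * a j / 3 ^ Suc j)"
    and cantor_val_bounds: "0 \<le> cantor_val a" "cantor_val a \<le> 1"
proof -
  have s: "(\<lambda>j. 2 / 3 ^ Suc j :: real) sums 1"
    using sums_mult[OF geometric_sums[of "1/3::real"], of "2/3"]
    by (simp add: power_divide field_simps)
  have le: "2 * a j / 3 ^ Suc j \<le> 2 / 3 ^ Suc j" "0 \<le> 2 * a j / 3 ^ Suc j" for j
    using assms[of j] by (auto simp: divide_simps)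
  show sa: "summable (\<lambda>j. 2 * a j / 3 ^ Suc j)"
    using le by (intro summable_comparison_test'[OF sums_summable[OF s]])
      (metis abs_of_nonneg real_norm_def)
  show "0 \<le> cantor_val a"
    unfolding cantor_val_def using le sa by (intro suminf_nonneg)
  have "cantor_val a \<le> (\<Sum>j. 2 / 3 ^ Suc j)"
    unfolding cantor_val_def using le sa sums_summable[OF s] by (intro suminf_le)
  then show "cantor_val a \<le> 1"
    using sums_unique[OF s] by simp
qed

lemma cantor_val_Suc:
  assumes "\<And>j. a j = 0 \<or> a j = 1"
  shows "cantor_val a = 2 * a 0 / 3 + cantor_val (\<lambda>j. a (Suc j)) / 3"
proof -
  have "(\<Sum>j. 2 * a (Suc j) / 3 ^ Suc (Suc j)) = (\<Sum>j. 2 * a (Suc j) / 3 ^ Suc j / 3)"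
    by (intro suminf_cong) simp
  also have "\<dots> = cantor_val (\<lambda>j. a (Suc j)) / 3"
    unfolding cantor_val_def
    by (rule suminf_divide[OF summable_cantor_val]) (rule assms)
  finally show ?thesis
    using suminf_split_head[OF summable_cantor_val, of a, OF assms]
    unfolding cantor_val_def[of a] by simp
qed

text \<open>Multiplying by \<open>3 ^ k\<close> moves the digits before index \<open>k\<close> into
  an even integer, removed by the period 2. What remains has leading digit \<open>2 * a k\<close>
  and so lies in the first or the last third of \<open>[0, 1]\<close>, where \<open>wave\<close> is
  constant.\<close>

lemma wave_cantor_val:
  assumes a: "\<And>j. a j = 0 \<or> a j = 1"
  shows "wave (3 ^ k * cantor_val a) = a k"
  using a
proof (induction k arbitrary: a)
  case 0
  note split = cantor_val_Suc[of a, OF 0]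
  have b: "0 \<le> cantor_val (\<lambda>j. a (Suc j))" "cantor_val (\<lambda>j. a (Suc j)) \<le> 1"
    using cantor_val_bounds[of "\<lambda>j. a (Suc j)"] 0 by auto
  consider "a 0 = 0" | "a 0 = 1"
    using 0 by blast
  then show ?case
  proof cases
    case 1
    then have "wave (cantor_val a) = 0" using b by (intro wave_eq_0) (simp_all add: split)
    then show ?thesis using 1 by simp
  next
    case 2
    then have "wave (cantor_val a) = 1" using b by (intro wave_eq_1) (simp_all add: split)
    then show ?thesis using 2 by simp
  qed
next
  case (Suc k)
  note split = cantor_val_Suc[of a, OF Suc.prems]
  have "3 ^ Suc k * cantor_val a = 3 ^ k * cantor_val (\<lambda>j. a (Suc j)) + 2 * of_int (if a 0 = 1 then 3 ^ k else 0)"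
    using Suc.prems[of 0] by (auto simp: split field_simps)
  then have "wave (3 ^ Suc k * cantor_val a) = wave (3 ^ k * cantor_val (\<lambda>j. a (Suc j)))"
    by (simp only: wave_add_even)
  also have "\<dots> = a (Suc k)"
    by (rule Suc.IH) (rule Suc.prems)
  finally show ?case .
qed

text \<open>Schoenberg's curve. Its section interleaves the binary digits of the two coordinates
  into one Cantor point. The half-open square is where \<open>bindigit_sums\<close> applies; the
  bound on \<open>q z\<close>, valid for every \<open>z\<close>, later gives tightness.\<close>

lemma space_filling_curve:
  obtains p :: "real \<Rightarrow> real \<times> real" and q :: "real \<times> real \<Rightarrow> real"
  where "continuous_on UNIV p" "q \<in> borel_measurable borel"
    "\<And>z. z \<in> {0..<1} \<times> {0..<1} \<Longrightarrow> p (q z) = z" "\<And>z. q z \<in> {0..1}"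
proof
  \<comment> \<open>\<open>c i\<close> reads the digits with index \<open>2 * k + i\<close>,
    matching the even and odd places that \<open>a\<close> fills from the first and the second
    coordinate.\<close>
  define c where "c i t = (\<Sum>k. wave (3 ^ (2 * k + i) * t) / 2 ^ Suc k)" for i :: nat and t
  define a where "a z j = (if even j then bindigit (j div 2) (fst z) else bindigit (j div 2) (snd z))"
    for z :: "real \<times> real" and j
  have a01: "a z j = 0 \<or> a z j = 1" for z j
    using bindigit_cases by (auto simp: a_def)
  show "continuous_on UNIV (\<lambda>t. (c 0 t, c 1 t))"
  proof -
    have "continuous_on UNIV (c i)" for i
    proof (rule uniform_limit_theorem)
      have s: "summable (\<lambda>k. 1 / 2 ^ Suc k :: real)"
        using power_half_series sums_summable by (simp add: power_divide)
      show "uniform_limit UNIV (\<lambda>n t. \<Sum>k<n. wave (3 ^ (2 * k + i) * t) / 2 ^ Suc k) (c i) sequentially"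
        unfolding c_def by (rule Weierstrass_m_test[OF _ s]) (auto simp: wave_bounds divide_simps)
      show "\<forall>\<^sub>F n in sequentially. continuous_on UNIV (\<lambda>t. \<Sum>k<n. wave (3 ^ (2 * k + i) * t) / 2 ^ Suc k)"
        unfolding wave_def by (intro always_eventually allI continuous_intros) auto
    qed simp
    then show ?thesis by (intro continuous_on_Pair)
  qed
  show "(\<lambda>z. cantor_val (a z)) \<in> borel_measurable borel"
  proof -
    have "fst \<in> borel_measurable borel" "snd \<in> borel_measurable borel"
      by (intro borel_measurable_continuous_onI continuous_intros)+
    then have "(\<lambda>z. a z j) \<in> borel_measurable borel" for j
      unfolding a_def by (cases "even j") (auto intro: measurable_compose)
    then show ?thesis
      unfolding cantor_val_def by measurable
  qed
  show "cantor_val (a z) \<in> {0..1}" for z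
    using cantor_val_bounds[of "a z"] a01 by auto
  show "(c 0 (cantor_val (a z)), c 1 (cantor_val (a z))) = z" if "z \<in> {0..<1} \<times> {0..<1}" for z
  proof -
    have "c 0 (cantor_val (a z)) = (\<Sum>k. bindigit k (fst z) / 2 ^ Suc k)"
      unfolding c_def by (subst wave_cantor_val[OF a01]) (simp add: a_def)
    moreover have "c 1 (cantor_val (a z)) = (\<Sum>k. bindigit k (snd z) / 2 ^ Suc k)"
      unfolding c_def by (subst wave_cantor_val[OF a01]) (simp add: a_def)
    ultimately show ?thesis
      using bindigit_sums[of "fst z"] bindigit_sums[of "snd z"] that
      by (auto simp: sums_iff prod_eq_iff mem_Times_iff)
  qed
qed

section \<open>Weak convergence of finite Borel measures\<close>

definition bounded_continuous :: "('a::topological_space \<Rightarrow> real) \<Rightarrow> bool" where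
  "bounded_continuous \<phi> \<longleftrightarrow> continuous_on UNIV \<phi> \<and> (\<exists>B. \<forall>x. \<bar>\<phi> x\<bar> \<le> B)"

definition weakly_converges :: "(nat \<Rightarrow> 'a::topological_space measure) \<Rightarrow> 'a measure \<Rightarrow> bool" where
  "weakly_converges \<nu> N \<longleftrightarrow>
     (\<forall>\<phi>. bounded_continuous \<phi> \<longrightarrow> (\<lambda>n. \<integral>x. \<phi> x \<partial>\<nu> n) \<longlonglongrightarrow> (\<integral>x. \<phi> x \<partial>N))"

lemma bounded_continuousI:
  "continuous_on UNIV \<phi> \<Longrightarrow> (\<And>x. \<bar>\<phi> x\<bar> \<le> B) \<Longrightarrow> bounded_continuous \<phi>"
  by (auto simp: bounded_continuous_def)

lemma bounded_continuous_const: "bounded_continuous (\<lambda>_. c)"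
  by (rule bounded_continuousI[of _ "\<bar>c\<bar>"]) auto

lemma bounded_continuous_measurable:
  "bounded_continuous \<phi> \<Longrightarrow> \<phi> \<in> borel_measurable borel"
  by (auto simp: bounded_continuous_def intro: borel_measurable_continuous_onI)

lemma bounded_continuous_compose:
  "bounded_continuous \<phi> \<Longrightarrow> continuous_on UNIV f \<Longrightarrow> bounded_continuous (\<lambda>x. \<phi> (f x))"
  unfolding bounded_continuous_def by (auto intro: continuous_on_compose2)

lemma finite_borel_measurable:
  "finite_borel M \<Longrightarrow> f \<in> borel_measurable M \<longleftrightarrow> f \<in> borel_measurable borel"
  using measurable_cong_sets[OF finite_borelD(2)] by blast

lemma finite_borel_integrable:
  fixes f :: "'a::topological_space \<Rightarrow> real"
  assumes "finite_borel M" "f \<in> borel_measurable borel" "\<And>x. \<bar>f x\<bar> \<le> B"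
  shows "integrable M f"
  using assms finite_borel_measurable[OF assms(1)]
  by (intro finite_measure.integrable_const_bound[of M _ B]) (auto simp: finite_borelD)

lemma bounded_continuous_integrable:
  "finite_borel M \<Longrightarrow> bounded_continuous \<phi> \<Longrightarrow> integrable M \<phi>"
  using finite_borel_integrable bounded_continuous_measurable by (metis bounded_continuous_def)

lemma integral_distr_borel:
  fixes \<phi> :: "'b::topological_space \<Rightarrow> real"
  assumes "finite_borel M" "g \<in> borel_measurable borel" "\<phi> \<in> borel_measurable borel"
  shows "(\<integral>x. \<phi> x \<partial>distr M borel g) = (\<integral>x. \<phi> (g x) \<partial>M)"
  using assms by (intro integral_distr) (auto simp: finite_borel_measurable)

lemma closed_borel_eqI:
  fixes M N :: "'a::topological_space measure"
  assumes "finite_borel M" "finite_borel N" "\<And>F. closed F \<Longrightarrow> measure M F = measure N F"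
  shows "M = N"
proof (rule measure_eqI_generator_eq[of "Collect closed" UNIV _ _ "\<lambda>_. UNIV"])
  interpret M: finite_measure M using finite_borelD[OF assms(1)] by auto
  interpret N: finite_measure N using finite_borelD[OF assms(2)] by auto
  show "Int_stable (Collect (closed :: 'a set \<Rightarrow> bool))" by (auto simp: Int_stable_def)
  have "sets borel = sigma_sets UNIV (Collect (closed :: 'a set \<Rightarrow> bool))"
    unfolding borel_eq_closed by (rule sets_measure_of) simp
  then show "sets M = sigma_sets UNIV (Collect closed)" "sets N = sigma_sets UNIV (Collect closed)"
    using assms by (auto simp: finite_borelD)
  show "emeasure M X = emeasure N X" if "X \<in> Collect closed" for X
    using assms(3)[of X] that by (simp add: M.emeasure_eq_measure N.emeasure_eq_measure)
  show "emeasure M UNIV \<noteq> \<infinity>" by simp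
qed auto

text \<open>Continuous functions decreasing pointwise to the indicator of a closed set
  \<open>F\<close>. For empty \<open>F\<close> the convention \<open>infdist x {} = 0\<close> makes
  them constantly 1, hence the assumption \<open>F \<noteq> {}\<close> and the separate treatment of
  the empty set below.\<close>

definition closed_approx :: "'a::metric_space set \<Rightarrow> nat \<Rightarrow> 'a \<Rightarrow> real" where
  "closed_approx F n x = max 0 (1 - real n * infdist x F)"

lemma closed_approx_bounds: "0 \<le> closed_approx F n x" "closed_approx F n x \<le> 1"
  by (auto simp: closed_approx_def infdist_nonneg)

lemma bounded_continuous_closed_approx: "bounded_continuous (closed_approx F n)"
  by (rule bounded_continuousI[of _ 1])
    (auto simp: closed_approx_bounds abs_of_nonneg closed_approx_def[abs_def] infdist_nonneg
      intro!: continuous_intros)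

lemma closed_approx_tendsto:
  assumes "closed F" "F \<noteq> {}"
  shows "(\<lambda>n. closed_approx F n x) \<longlonglongrightarrow> indicator F x"
proof (cases "x \<in> F")
  case True
  then show ?thesis by (simp add: closed_approx_def)
next
  case False
  then have d: "infdist x F > 0" using assms by (intro infdist_pos_not_in_closed)
  obtain m :: nat where m: "1 < real m * infdist x F"
    using reals_Archimedean3[OF d] by auto
  have "eventually (\<lambda>n. closed_approx F n x = 0) sequentially"
    using eventually_ge_at_top[of m]
  proof eventually_elim
    case (elim n)
    then have "real m * infdist x F \<le> real n * infdist x F"
      using d by (intro mult_right_mono) auto
    with m show ?case by (simp add: closed_approx_def)
  qed
  then show ?thesis using False by (auto intro: tendsto_eventually)
qed

lemma closed_approx_integral_tendsto:
  fixes M :: "'a::metric_space measure"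
  assumes M: "finite_borel M" and F: "closed F" "F \<noteq> {}"
  shows "(\<lambda>n. \<integral>x. closed_approx F n x \<partial>M) \<longlonglongrightarrow> measure M F"
proof -
  interpret M: finite_measure M using finite_borelD[OF M] by auto
  have "(\<lambda>n. \<integral>x. closed_approx F n x \<partial>M) \<longlonglongrightarrow> (\<integral>x. indicator F x \<partial>M)"
    using F M bounded_continuous_measurable[OF bounded_continuous_closed_approx]
    by (intro integral_dominated_convergence[where w = "\<lambda>_. 1"])
      (auto simp: closed_approx_tendsto closed_approx_bounds finite_borel_measurable finite_borelD)
  then show ?thesis using F M by (simp add: finite_borelD)
qed

lemma bounded_continuous_eqI:
  fixes M N :: "'a::metric_space measure"
  assumes M: "finite_borel M" and N: "finite_borel N"
    and eq: "\<And>\<phi>. bounded_continuous \<phi> \<Longrightarrow> (\<integral>x. \<phi> x \<partial>M) = (\<integral>x. \<phi> x \<partial>N)"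
  shows "M = N"
proof (rule closed_borel_eqI[OF M N])
  fix F :: "'a set" assume F: "closed F"
  show "measure M F = measure N F"
  proof (cases "F = {}")
    case False
    then show ?thesis
      using closed_approx_integral_tendsto[OF M F] closed_approx_integral_tendsto[OF N F]
        eq[OF bounded_continuous_closed_approx[of F]] LIMSEQ_unique by auto
  qed simp
qed

lemma finite_borel_density:
  assumes "finite_borel M"
  shows "finite_borel (density M (\<lambda>_. ennreal c))"
proof -
  interpret finite_measure M using finite_borelD[OF assms] by auto
  show ?thesis
    using finite_borelD[OF assms]
    by (auto simp: finite_borel_def emeasure_density_const ennreal_mult_eq_top_iff
        intro!: finite_measureI)
qed

lemma integral_density_const:
  fixes \<phi> :: "'a::topological_space \<Rightarrow> real"
  assumes "finite_borel M" "\<phi> \<in> borel_measurable borel" "0 \<le> c"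
  shows "(\<integral>x. \<phi> x \<partial>density M (\<lambda>_. ennreal c)) = c * (\<integral>x. \<phi> x \<partial>M)"
  using assms by (subst integral_density) (auto simp: finite_borel_measurable)

text \<open>No mass can escape from a closed set: the total masses converge by testing with the
  constant 1, each \<open>closed_approx K m\<close> integrates to at least the full mass along the
  sequence and hence in the limit, and letting \<open>m\<close> tend to infinity leaves
  \<open>measure N K\<close>.\<close>

lemma weak_limit_concentrated:
  fixes K :: "'a::metric_space set"
  assumes \<nu>: "\<And>n. finite_borel (\<nu> n)" and N: "finite_borel N" and w: "weakly_converges \<nu> N"
    and K: "closed K" and conc: "\<And>n. measure (\<nu> n) (-K) = 0"
  shows "measure N (-K) = 0"
proof -
  interpret N: finite_measure N using finite_borelD[OF N] by auto
  have eqK: "measure M (-K) = measure M UNIV - measure M K" if "finite_borel M" for M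
    using that K finite_measure.finite_measure_compl[of M K] finite_borelD[OF that]
    by (simp add: Compl_eq_Diff_UNIV)
  have mass: "(\<lambda>n. measure (\<nu> n) UNIV) \<longlonglongrightarrow> measure N UNIV"
    using w bounded_continuous_const[of 1] finite_borelD(3)[OF N] finite_borelD(3)[OF \<nu>]
    by (force simp: weakly_converges_def)
  show ?thesis
  proof (cases "K = {}")
    case True
    then show ?thesis using mass conc by (simp add: LIMSEQ_const_iff)
  next
    case False
    have le: "measure (\<nu> n) UNIV \<le> (\<integral>x. closed_approx K m x \<partial>\<nu> n)" for n m
    proof -
      interpret \<nu>: finite_measure "\<nu> n" using finite_borelD[OF \<nu>] by auto
      have "measure (\<nu> n) UNIV = (\<integral>x. indicator K x \<partial>\<nu> n)"
        using eqK[OF \<nu>] conc K by (simp add: finite_borelD[OF \<nu>])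
      also have "\<dots> \<le> (\<integral>x. closed_approx K m x \<partial>\<nu> n)"
      proof (rule integral_mono)
        show "integrable (\<nu> n) (indicator K :: 'a \<Rightarrow> real)"
          using K by (intro finite_borel_integrable[OF \<nu>, of _ 1]) auto
        show "integrable (\<nu> n) (closed_approx K m)"
          by (rule bounded_continuous_integrable[OF \<nu> bounded_continuous_closed_approx])
      qed (auto simp: indicator_def closed_approx_bounds closed_approx_def)
      finally show ?thesis .
    qed
    have "measure N UNIV \<le> (\<integral>x. closed_approx K m x \<partial>N)" for m
      using w bounded_continuous_closed_approx[of K m] le
      by (intro LIMSEQ_le[OF mass, of "\<lambda>n. \<integral>x. closed_approx K m x \<partial>\<nu> n"])
        (auto simp: weakly_converges_def)
    then have "measure N UNIV \<le> measure N K"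
      by (intro LIMSEQ_le_const[OF closed_approx_integral_tendsto[OF N K False]]) auto
    then show ?thesis using eqK[OF N] measure_nonneg[of N "-K"] by linarith
  qed
qed

text \<open>Helly's theorem is applied to the normalised images under the section \<open>q\<close>.
  A discontinuity of \<open>q\<close> is harmless: on the line only functions
  \<open>\<phi> (p t)\<close> are tested, with \<open>p\<close> continuous, and on \<open>K\<close>,
  which carries all the measures, \<open>p (q z) = z\<close>. Pushing the limit forward by
  \<open>p\<close> and restoring the factor \<open>c\<close> gives the limit in the plane.\<close>

lemma weak_compactness:
  fixes \<nu> :: "nat \<Rightarrow> (real \<times> real) measure"
  assumes \<nu>: "\<And>n. finite_borel (\<nu> n)" and K: "compact K"
    and conc: "\<And>n. measure (\<nu> n) (-K) = 0" and mass: "\<And>n. measure (\<nu> n) UNIV = c"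
  obtains r N where "strict_mono r" "finite_borel N" "measure N (-K) = 0"
    "weakly_converges (\<lambda>n. \<nu> (r n)) N"
proof -
  obtain p0 :: "real \<Rightarrow> real \<times> real" and q0 :: "real \<times> real \<Rightarrow> real"
    where p0: "continuous_on UNIV p0" and q0: "q0 \<in> borel_measurable borel"
    and pq0: "\<And>z. z \<in> {0..<1} \<times> {0..<1} \<Longrightarrow> p0 (q0 z) = z" and q01: "\<And>z. q0 z \<in> {0..1}"
    by (rule space_filling_curve) blast
  obtain R where R: "R > 0" "\<And>z. z \<in> K \<Longrightarrow> norm z < R"
    using compact_imp_bounded[OF K] by (auto simp: bounded_pos_less)
  \<comment> \<open>\<open>s\<close> maps the open square of half-width \<open>R\<close> into the
    half-open unit square, and \<open>p\<close> undoes this scaling; the strict bound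
    \<open>norm z < R\<close> keeps the image off the upper edges.\<close>
  define s where "s z = (1 / (2 * R)) *\<^sub>R (z + (R, R))" for z :: "real \<times> real"
  define p where "p t = (2 * R) *\<^sub>R p0 t - (R, R)" for t
  define q where "q z = q0 (s z)" for z
  have s: "continuous_on UNIV s" unfolding s_def by (intro continuous_intros)
  have q: "q \<in> borel_measurable borel"
    unfolding q_def using measurable_compose[OF borel_measurable_continuous_onI[OF s] q0] .
  have p: "continuous_on UNIV p" unfolding p_def by (intro continuous_intros p0)
  have pq: "p (q z) = z" if "z \<in> K" for z
  proof -
    have "\<bar>fst z\<bar> < R" "\<bar>snd z\<bar> < R"
      using R(2)[OF that] norm_fst_le[of "fst z" "snd z"] norm_snd_le[of "snd z" "fst z"] by auto
    then have "s z \<in> {0..<1} \<times> {0..<1}"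
      using R(1) by (cases z) (auto simp: s_def field_simps abs_less_iff)
    then show ?thesis
      using R(1) unfolding p_def q_def by (subst pq0) (auto simp: s_def prod_eq_iff)
  qed
  have c0: "0 \<le> c" using mass[of 0] measure_nonneg by metis
  show ?thesis
  \<comment> \<open>Zero mass cannot be normalised, but then all the measures vanish and the
    sequence is constant.\<close>
  proof (cases "c = 0")
    case True
    have "measure (\<nu> n) A = 0" if "A \<in> sets borel" for A n
      using finite_measure.bounded_measure[OF finite_borelD(1)[OF \<nu>], of n A] mass[of n] True
        measure_nonneg[of "\<nu> n" A] finite_borelD[OF \<nu>] by simp
    then have eq: "\<nu> n = \<nu> 0" for n by (intro finite_borel_eqI \<nu>) simp
    have "weakly_converges (\<lambda>n. \<nu> (id n)) (\<nu> 0)"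
      unfolding weakly_converges_def by (intro allI impI tendsto_eventually always_eventually)
        (rule arg_cong[OF eq])
    then show ?thesis
      by (rule that[OF strict_mono_id \<nu> conc])
  next
    case False
    then have c: "c > 0" using c0 by simp
    define \<mu> where "\<mu> n = distr (density (\<nu> n) (\<lambda>_. ennreal (1/c))) borel q" for n
    have fbd: "finite_borel (density (\<nu> n) (\<lambda>_. ennreal (1/c)))" for n
      by (rule finite_borel_density[OF \<nu>])
    have em: "emeasure (\<nu> n) UNIV = ennreal c" for n
      using finite_measure.emeasure_eq_measure[OF finite_borelD(1)[OF \<nu>], of n UNIV] mass by simp
    have em\<mu>: "emeasure (\<mu> n) A = 1" if "A \<in> sets borel" "range q \<subseteq> A" for n A
    proof -
      have "q -` A = UNIV" using that by auto
      then show ?thesis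
        using q that em[of n] c finite_borelD(2,3)[OF \<nu>]
        by (simp add: \<mu>_def emeasure_distr finite_borel_measurable[OF \<nu>] emeasure_density_const
            ennreal_mult[symmetric])
    qed
    have rd: "real_distribution (\<mu> n)" for n
      using em\<mu>[of UNIV n] by (auto simp: real_distribution_def real_distribution_axioms_def \<mu>_def
          intro!: prob_spaceI)
    \<comment> \<open>\<open>tight\<close> asks for intervals \<open>{a<..b}\<close>; the left end
      -1 keeps the value 0 inside.\<close>
    have "-1 < q z \<and> q z \<le> 1" for z
      using q01[of "s z"] by (simp add: q_def)
    then have "range q \<subseteq> {-1<..1}" by auto
    then have "measure (\<mu> n) {-1<..1} = 1" for n
      using em\<mu>[of "{-1<..1}" n] by (simp add: measure_def)
    then have "tight \<mu>"
      unfolding tight_def using rd by (intro conjI allI impI exI[of _ "-1"] exI[of _ 1]) auto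
    from tight_imp_convergent_subsubsequence[OF this, of id]
    obtain r M where r: "strict_mono r" and M: "real_distribution M" "weak_conv_m (\<mu> \<circ> r) M"
      by (auto simp: strict_mono_def)
    define N where "N = density (distr M borel p) (\<lambda>_. ennreal c)"
    interpret M: real_distribution M by fact
    have fbM: "finite_borel M" by (simp add: finite_borel_def M.finite_measure_axioms)
    have pm: "p \<in> borel_measurable borel" by (rule borel_measurable_continuous_onI[OF p])
    note fbp = finite_borel_distr[OF fbM pm]
    have N: "finite_borel N" unfolding N_def by (rule finite_borel_density[OF fbp])
    have w: "weakly_converges (\<lambda>n. \<nu> (r n)) N"
      unfolding weakly_converges_def
    proof (intro allI impI)
      fix \<phi> :: "real \<times> real \<Rightarrow> real" assume \<phi>: "bounded_continuous \<phi>"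
      note \<phi>m = bounded_continuous_measurable[OF \<phi>]
      have \<phi>p: "bounded_continuous (\<lambda>t. \<phi> (p t))"
        by (rule bounded_continuous_compose[OF \<phi> p])
      then obtain B where B: "\<And>t. \<bar>\<phi> (p t)\<bar> \<le> B" by (auto simp: bounded_continuous_def)
      have "(\<lambda>n. integral\<^sup>L ((\<mu> \<circ> r) n) (\<lambda>t. \<phi> (p t))) \<longlonglongrightarrow> integral\<^sup>L M (\<lambda>t. \<phi> (p t))"
        using \<phi>p B rd M
        by (intro weak_conv_imp_integral_bdd_continuous_conv[of _ _ _ B])
          (auto simp: bounded_continuous_def continuous_on_eq_continuous_at o_def)
      then have "(\<lambda>n. c * integral\<^sup>L ((\<mu> \<circ> r) n) (\<lambda>t. \<phi> (p t))) \<longlonglongrightarrow> c * integral\<^sup>L M (\<lambda>t. \<phi> (p t))"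
        by (rule tendsto_mult_left)
      moreover have "c * integral\<^sup>L M (\<lambda>t. \<phi> (p t)) = (\<integral>x. \<phi> x \<partial>N)"
        unfolding N_def
        by (simp add: integral_density_const[OF fbp \<phi>m c0] integral_distr_borel[OF fbM pm \<phi>m])
      moreover have "c * integral\<^sup>L (\<mu> n) (\<lambda>t. \<phi> (p t)) = (\<integral>x. \<phi> x \<partial>\<nu> n)" for n
      proof -
        interpret \<nu>: finite_measure "\<nu> n" using finite_borelD[OF \<nu>] by auto
        have \<phi>pm: "(\<lambda>t. \<phi> (p t)) \<in> borel_measurable borel"
          by (rule bounded_continuous_measurable[OF \<phi>p])
        have \<phi>pqm: "(\<lambda>z. \<phi> (p (q z))) \<in> borel_measurable borel"
          using measurable_compose[OF q \<phi>pm] .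
        have "c * integral\<^sup>L (\<mu> n) (\<lambda>t. \<phi> (p t)) = (\<integral>x. \<phi> (p (q x)) \<partial>\<nu> n)"
          using c unfolding \<mu>_def
          by (simp add: integral_distr_borel[OF fbd q \<phi>pm] integral_density_const[OF \<nu> \<phi>pqm])
        also have "\<dots> = (\<integral>x. \<phi> x \<partial>\<nu> n)"
        proof (rule integral_cong_AE)
          have "AE x in \<nu> n. x \<notin> -K"
            using compact_imp_closed[OF K] conc[of n] finite_borelD[OF \<nu>, of n]
            by (intro AE_not_in null_setsI) (auto simp: \<nu>.emeasure_eq_measure)
          then show "AE x in \<nu> n. \<phi> (p (q x)) = \<phi> x"
            by eventually_elim (simp add: pq)
        qed (use \<phi>pqm \<phi>m in \<open>auto simp: finite_borel_measurable[OF \<nu>]\<close>)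
        finally show ?thesis .
      qed
      ultimately show "(\<lambda>n. \<integral>x. \<phi> x \<partial>\<nu> (r n)) \<longlonglongrightarrow> (\<integral>x. \<phi> x \<partial>N)" by simp
    qed
    have "measure N (-K) = 0"
      by (rule weak_limit_concentrated[OF \<nu> N w compact_imp_closed[OF K] conc])
    then show ?thesis by (rule that[OF r N _ w])
  qed
qed

section \<open>Products and families of measures\<close>

lemma finite_borel_pair:
  fixes M :: "'a::second_countable_topology measure" and N :: "'b::second_countable_topology measure"
  assumes "finite_borel M" "finite_borel N"
  shows "finite_borel (M \<Otimes>\<^sub>M N)"
proof -
  have "sets (M \<Otimes>\<^sub>M N) = sets borel"
    using sets_pair_measure_cong[of M borel N borel] assms borel_prod by (metis finite_borelD(2))
  then show ?thesis
    unfolding finite_borel_def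
    using finite_borelD(1)[OF assms(1)] finite_borelD(1)[OF assms(2)]
    by (auto intro: finite_measure_pair_measure)
qed

lemma integral_pair_bounded_continuous:
  fixes M :: "'a::second_countable_topology measure" and N :: "'b::second_countable_topology measure"
  assumes M: "finite_borel M" and N: "finite_borel N" and F: "bounded_continuous F"
  shows "(\<integral>z. F z \<partial>(M \<Otimes>\<^sub>M N)) = (\<integral>a. \<integral>b. F (a, b) \<partial>N \<partial>M)"
proof -
  interpret M: finite_measure M using finite_borelD[OF M] by auto
  interpret N: finite_measure N using finite_borelD[OF N] by auto
  interpret pair_sigma_finite M N ..
  show ?thesis
    using integral_fst'[OF bounded_continuous_integrable[OF finite_borel_pair[OF M N] F]] by simp
qed

lemma bounded_continuous_integral:
  fixes F :: "'a::{first_countable_topology, t2_space} \<times> 'b::t2_space \<Rightarrow> real"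
  assumes N: "finite_borel N" and F: "bounded_continuous F"
  shows "bounded_continuous (\<lambda>a. \<integral>b. F (a, b) \<partial>N)"
proof -
  obtain B where B: "\<And>z. \<bar>F z\<bar> \<le> B" using F by (auto simp: bounded_continuous_def)
  interpret N: finite_measure N using finite_borelD[OF N] by auto
  have sec: "bounded_continuous (\<lambda>b. F (a, b))" for a
    by (rule bounded_continuous_compose[OF F]) (intro continuous_intros)
  show ?thesis
  proof (rule bounded_continuousI)
    show "\<bar>\<integral>b. F (a, b) \<partial>N\<bar> \<le> B * measure N (space N)" for a
    proof -
      have "\<bar>\<integral>b. F (a, b) \<partial>N\<bar> \<le> (\<integral>b. \<bar>F (a, b)\<bar> \<partial>N)"
        by (rule integral_abs_bound)
      also have "\<dots> \<le> (\<integral>b. B \<partial>N)"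
        using B bounded_continuous_integrable[OF N sec] by (intro integral_mono integrable_abs) auto
      finally show ?thesis by (simp add: mult.commute)
    qed
    have "(\<lambda>n. \<integral>b. F (x n, b) \<partial>N) \<longlonglongrightarrow> (\<integral>b. F (a, b) \<partial>N)" if "x \<longlonglongrightarrow> a" for x a
    proof (rule integral_dominated_convergence[where w = "\<lambda>_. B"])
      have "(\<lambda>n. F (x n, b)) \<longlonglongrightarrow> F (a, b)" for b
        using F tendsto_Pair[OF that tendsto_const[of b]]
        by (auto simp: bounded_continuous_def continuous_on_eq_continuous_at
            intro: isCont_tendsto_compose[of "(a, b)" F])
      then show "AE b in N. (\<lambda>n. F (x n, b)) \<longlonglongrightarrow> F (a, b)" by simp
    qed (use B bounded_continuous_measurable[OF sec] in \<open>auto simp: finite_borel_measurable[OF N]\<close>)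
    then show "continuous_on UNIV (\<lambda>a. \<integral>b. F (a, b) \<partial>N)"
      by (auto simp: continuous_on_sequentially o_def)
  qed
qed

text \<open>Integrals of \<open>closed_approx\<close> give measurability for closed sets. These
  generate the Borel sets and are stable under intersection, so Dynkin's argument reaches every
  Borel set. It serves to turn weak continuity in the direction into a measurable family.\<close>

lemma measurable_weakly_continuous_family:
  fixes M :: "'z \<Rightarrow> 'a::metric_space measure"
  assumes M: "\<And>z. z \<in> space H \<Longrightarrow> finite_borel (M z)"
    and meas: "\<And>\<phi>. bounded_continuous \<phi> \<Longrightarrow> (\<lambda>z. \<integral>x. \<phi> x \<partial>M z) \<in> borel_measurable H"
    and A: "A \<in> sets borel"
  shows "(\<lambda>z. measure (M z) A) \<in> borel_measurable H"
proof -
  have borel: "sets borel = sigma_sets UNIV (Collect (closed :: 'a set \<Rightarrow> bool))"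
    unfolding borel_eq_closed by (rule sets_measure_of) simp
  have int: "Int_stable (Collect (closed :: 'a set \<Rightarrow> bool))" by (auto simp: Int_stable_def)
  have sub: "Collect closed \<subseteq> Pow (UNIV :: 'a set)" by simp
  show ?thesis
    using int sub A[unfolded borel]
  proof (induction rule: sigma_sets_induct_disjoint)
    case (basic F)
    show ?case
    proof (cases "F = {}")
      case False
      show ?thesis
      proof (rule borel_measurable_LIMSEQ_metric)
        show "(\<lambda>z. \<integral>x. closed_approx F n x \<partial>M z) \<in> borel_measurable H" for n
          by (rule meas[OF bounded_continuous_closed_approx])
        show "(\<lambda>n. \<integral>x. closed_approx F n x \<partial>M z) \<longlonglongrightarrow> measure (M z) F" if "z \<in> space H" for z
          using False basic by (intro closed_approx_integral_tendsto[OF M[OF that]]) auto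
      qed
    qed simp
  next
    case empty
    show ?case by simp
  next
    case (compl A)
    have "(\<lambda>z. (\<integral>x. 1 \<partial>M z) - measure (M z) A) \<in> borel_measurable H"
      using compl meas[OF bounded_continuous_const, of 1] by measurable
    moreover have "measure (M z) (UNIV - A) = (\<integral>x. 1 \<partial>M z) - measure (M z) A" if "z \<in> space H" for z
      using compl finite_measure.finite_measure_compl[of "M z" A] finite_borelD[OF M[OF that]]
      by (simp add: borel)
    ultimately show ?case by (simp cong: measurable_cong)
  next
    case (union A)
    have "(\<lambda>z. \<Sum>i. measure (M z) (A i)) \<in> borel_measurable H"
      using union by measurable
    moreover have "measure (M z) (\<Union>i. A i) = (\<Sum>i. measure (M z) (A i))" if "z \<in> space H" for z
      using union finite_measure.finite_measure_UNION[of "M z" A] finite_borelD[OF M[OF that]]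
      by (simp add: borel sums_iff)
    ultimately show ?case by (simp cong: measurable_cong)
  qed
qed

lemma sets_borel_prod:
  "sets (borel :: ('a::second_countable_topology \<times> 'b::second_countable_topology) measure) =
     sigma_sets UNIV {A \<times> B | A B. A \<in> sets borel \<and> B \<in> sets borel}"
  unfolding borel_prod[symmetric] sets_pair_measure by simp

lemma measurable_family_section:
  fixes K :: "'z::second_countable_topology \<Rightarrow> 'a::second_countable_topology measure"
  assumes K: "\<And>z. z \<in> space H \<Longrightarrow> finite_borel (K z)" and H: "sets H = borel_on (space H)"
    and meas: "\<And>A. A \<in> sets borel \<Longrightarrow> (\<lambda>z. measure (K z) A) \<in> borel_measurable H"
    and C: "C \<in> sets borel"
  shows "(\<lambda>z. measure (K z) (Pair z -` C)) \<in> borel_measurable H"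
proof -
  let ?E = "{A \<times> B | A B. A \<in> sets borel \<and> B \<in> sets borel} :: ('z \<times> 'a) set set"
  note borel = sets_borel_prod[where ?'a = 'z and ?'b = 'a]
  have int: "Int_stable ?E"
    by (auto simp: Int_stable_def Times_Int_Times) blast
  have sec: "Pair z -` C \<in> sets (borel :: 'a measure)" if "C \<in> sigma_sets UNIV ?E" for z C
    using that borel borel_prod by (metis sets_Pair1)
  have sub: "?E \<subseteq> Pow UNIV" by simp
  show ?thesis
    using int sub C[unfolded borel]
  proof (induction rule: sigma_sets_induct_disjoint)
    case (basic C)
    then obtain A B where C: "C = A \<times> B" and AB: "A \<in> sets borel" "B \<in> sets borel" by auto
    \<comment> \<open>\<open>H\<close> has only the trace of the Borel sets on its space, so
      \<open>A\<close> is cut down before being used as a set of \<open>H\<close>.\<close>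
    have "A \<inter> space H \<in> sets H" unfolding H by (rule borel_on_Int[OF AB(1)])
    then have "(\<lambda>z. indicator (A \<inter> space H) z * measure (K z) B) \<in> borel_measurable H"
      using meas[OF AB(2)] by measurable
    moreover have "measure (K z) (Pair z -` C) = indicator (A \<inter> space H) z * measure (K z) B"
      if "z \<in> space H" for z
      using that by (simp add: C indicator_def vimage_def)
    ultimately show ?case by (simp cong: measurable_cong)
  next
    case empty
    show ?case by simp
  next
    case (compl C)
    have "(\<lambda>z. measure (K z) UNIV - measure (K z) (Pair z -` C)) \<in> borel_measurable H"
      using compl meas[of UNIV] by measurable
    moreover have "measure (K z) (Pair z -` (UNIV - C)) = measure (K z) UNIV - measure (K z) (Pair z -` C)"
      if "z \<in> space H" for z
      using sec[OF compl(1)] finite_measure.finite_measure_compl[of "K z" "Pair z -` C"]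
        finite_borelD[OF K[OF that]] by (simp add: vimage_Diff)
    ultimately show ?case by (simp cong: measurable_cong)
  next
    case (union C)
    have "(\<lambda>z. \<Sum>i. measure (K z) (Pair z -` C i)) \<in> borel_measurable H"
      using union by measurable
    moreover have "measure (K z) (Pair z -` (\<Union>i. C i)) = (\<Sum>i. measure (K z) (Pair z -` C i))"
      if "z \<in> space H" for z
    proof -
      have "disjoint_family (\<lambda>i. Pair z -` C i)" "range (\<lambda>i. Pair z -` C i) \<subseteq> sets borel"
        using union(1,2) sec by (auto simp: disjoint_family_on_def)
      then show ?thesis
        using finite_measure.finite_measure_UNION[of "K z" "\<lambda>i. Pair z -` C i"]
          finite_borelD[OF K[OF that]] by (simp add: vimage_UN sums_iff)
    qed
    ultimately show ?case by (simp cong: measurable_cong)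
  qed
qed

text \<open>\<open>base_prod\<close> is a Bochner integral, which is 0 for functions that are not
  integrable. The bound \<open>c\<close> makes all sections integrable, so it agrees with the
  nonnegative integral, for which countable additivity is monotone convergence.\<close>

lemma base_prod_radon_plus:
  fixes H :: "'z::euclidean_space measure" and X :: "'a::euclidean_space set"
  assumes H: "finite_measure H" "sets H = borel_on (space H)" "space H \<in> sets borel"
    and X: "X \<in> sets borel" and g: "\<And>z. z \<in> space H \<Longrightarrow> g z \<in> radon_plus X"
    and meas: "measurable_family H X g" and bound: "\<And>z. z \<in> space H \<Longrightarrow> g z X \<le> c"
  shows "base_prod H X g \<in> radon_plus (space H \<times> X)"
proof -
  define K where "K z = borel_ext X (g z)" for z
  have K: "finite_borel (K z)" if "z \<in> space H" for z
    unfolding K_def by (rule finite_borel_borel_ext[OF g[OF that]])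
  have mK: "measure (K z) A = g z (A \<inter> X)" if "z \<in> space H" "A \<in> sets borel" for z A
    unfolding K_def by (rule measure_borel_ext[OF g[OF that(1)] that(2)])
  interpret H: finite_measure H by fact
  have measK: "(\<lambda>z. measure (K z) A) \<in> borel_measurable H" if "A \<in> sets borel" for A
  proof -
    have "(\<lambda>z. g z (A \<inter> X)) \<in> borel_measurable H"
      using meas borel_on_Int[OF that] by (auto simp: measurable_family_def)
    then show ?thesis using mK[OF _ that] by (simp cong: measurable_cong)
  qed
  note measC = measurable_family_section[OF K H(2) measK]
  have sec: "Pair z -` C \<in> sets (borel :: 'a measure)" if "C \<in> sets borel" for z :: 'z and C
    using that borel_prod by (metis sets_Pair1)
  have le: "measure (K z) (Pair z -` C) \<le> c" if "z \<in> space H" "C \<in> sets borel" for z C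
  proof -
    interpret finite_measure "K z" using finite_borelD[OF K[OF that(1)]] by auto
    have "measure (K z) (Pair z -` C) \<le> measure (K z) UNIV"
      using bounded_measure finite_borelD[OF K[OF that(1)]] by simp
    then show ?thesis using mK[OF that(1), of UNIV] bound[OF that(1)] by simp
  qed
  have int: "integrable H (\<lambda>z. measure (K z) (Pair z -` C))" if "C \<in> sets borel" for C
    using measC[OF _ _ that] le[OF _ that] by (intro H.integrable_const_bound[of _ c]) auto
  define G where "G = measure_of UNIV (sets borel)
    (\<lambda>C. \<integral>\<^sup>+z. ennreal (measure (K z) (Pair z -` C)) \<partial>H)"
  have sG: "sets G = sets borel"
    using sets.sigma_sets_eq[of "borel :: ('z \<times> 'a) measure"] by (simp add: G_def)
  have emG: "emeasure G C = (\<integral>\<^sup>+z. ennreal (measure (K z) (Pair z -` C)) \<partial>H)"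
    if "C \<in> sets borel" for C
  proof (rule emeasure_measure_of[OF G_def])
    show "countably_additive (sets G) (\<lambda>C. \<integral>\<^sup>+z. ennreal (measure (K z) (Pair z -` C)) \<partial>H)"
    proof (rule countably_additiveI)
      fix C :: "nat \<Rightarrow> ('z \<times> 'a) set"
      assume C: "range C \<subseteq> sets G" "disjoint_family C"
      have "(\<Sum>i. ennreal (measure (K z) (Pair z -` C i))) = ennreal (measure (K z) (Pair z -` (\<Union>i. C i)))"
        if "z \<in> space H" for z
      proof -
        have "disjoint_family (\<lambda>i. Pair z -` C i)" "range (\<lambda>i. Pair z -` C i) \<subseteq> sets borel"
          using C sec by (auto simp: disjoint_family_on_def sG)
        then have "(\<lambda>i. measure (K z) (Pair z -` C i)) sums measure (K z) (Pair z -` (\<Union>i. C i))"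
          using finite_measure.finite_measure_UNION[of "K z" "\<lambda>i. Pair z -` C i"]
            finite_borelD[OF K[OF that]] by (simp add: vimage_UN)
        then show ?thesis by (simp add: sums_iff suminf_ennreal2)
      qed
      moreover have "C i \<in> sets borel" for i using C sG by auto
      ultimately show "(\<Sum>i. \<integral>\<^sup>+z. ennreal (measure (K z) (Pair z -` C i)) \<partial>H) =
          (\<integral>\<^sup>+z. ennreal (measure (K z) (Pair z -` (\<Union>i. C i))) \<partial>H)"
        using measC by (subst nn_integral_suminf[symmetric]) (auto intro!: nn_integral_cong
            simp del: suminf_ennreal_eq suminf_ennreal2)
    qed
  qed (use that sG in \<open>auto simp: positive_def\<close>)
  have emG': "emeasure G C = ennreal (\<integral>z. measure (K z) (Pair z -` C) \<partial>H)" if "C \<in> sets borel" for C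
    unfolding emG[OF that] using int[OF that] by (intro nn_integral_eq_integral) auto
  have spG: "space G = UNIV" using sets_eq_imp_space_eq[OF sG] by simp
  have G: "finite_borel G"
    using emG'[of UNIV] sG spG by (auto simp: finite_borel_def intro!: finite_measureI)
  have HX: "space H \<times> X \<in> sets borel"
    using H(3) X borel_prod by (metis pair_measureI)
  have "base_prod H X g = trace_on (space H \<times> X) G"
  proof (rule ext)
    fix C
    show "base_prod H X g C = trace_on (space H \<times> X) G C"
    proof (cases "C \<in> borel_on (space H \<times> X)")
      case True
      then have C: "C \<in> sets borel" "C \<subseteq> space H \<times> X" using HX by (auto simp: borel_on_iff)
      have "measure G C = (\<integral>z. measure (K z) (Pair z -` C) \<partial>H)"
        using emG'[OF C(1)] by (simp add: measure_def integral_nonneg)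
      also have "\<dots> = (\<integral>z. g z {x. (z, x) \<in> C} \<partial>H)"
      proof (rule Bochner_Integration.integral_cong)
        fix z assume z: "z \<in> space H"
        have "Pair z -` C \<inter> X = {x. (z, x) \<in> C}" using C by auto
        then show "measure (K z) (Pair z -` C) = g z {x. (z, x) \<in> C}"
          using mK[OF z sec[OF C(1)]] by simp
      qed simp
      finally show ?thesis using True by (simp add: base_prod_def trace_on_def)
    qed (simp add: base_prod_def trace_on_def)
  qed
  then show ?thesis using trace_on_radon_plus[OF G HX] by simp
qed

text \<open>The null set in the assumption depends on \<open>A\<close>. The induction that builds
  \<open>f\<close> from indicators combines at most countably many null sets at each step, so a
  single one remains for each \<open>f\<close>.\<close>

lemma AE_eq_nn_integral:
  fixes M N :: "'z \<Rightarrow> 'a::topological_space measure"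
  assumes M: "\<And>z. z \<in> space H \<Longrightarrow> finite_borel (M z)" and N: "\<And>z. z \<in> space H \<Longrightarrow> finite_borel (N z)"
    and eq: "\<And>A. A \<in> sets borel \<Longrightarrow> AE z in H. measure (M z) A = measure (N z) A"
    and f: "f \<in> borel_measurable borel"
  shows "AE z in H. (\<integral>\<^sup>+x. f x \<partial>M z) = (\<integral>\<^sup>+x. f x \<partial>N z)"
  using f
proof (induct rule: borel_measurable_induct)
  case (cong f g)
  have "f = g" by (rule ext) (simp add: cong(3))
  with cong(4) show ?case by (simp only:)
next
  case (set A)
  show ?case
    using eq[OF set] AE_space
  proof eventually_elim
    case (elim z)
    then show ?case
      using set M[of z] N[of z]
      by (simp add: finite_borelD finite_measure.emeasure_eq_measure)
  qed
next
  case (mult u c)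
  show ?case
    using mult(4) AE_space
  proof eventually_elim
    case (elim z)
    then show ?case
      using mult(2) finite_borel_measurable[OF M, of z u] finite_borel_measurable[OF N, of z u]
      by (simp add: nn_integral_cmult)
  qed
next
  case (add u v)
  show ?case
    using add(3) add(7) AE_space
  proof eventually_elim
    case (elim z)
    then show ?case
      using add(1,4) finite_borel_measurable[OF M, of z u] finite_borel_measurable[OF N, of z u]
        finite_borel_measurable[OF M, of z v] finite_borel_measurable[OF N, of z v]
      by (simp add: nn_integral_add)
  qed
next
  case (seq U)
  have "AE z in H. \<forall>i. (\<integral>\<^sup>+x. U i x \<partial>M z) = (\<integral>\<^sup>+x. U i x \<partial>N z)"
    using seq(3) by (simp add: AE_all_countable)
  then show ?case
    using AE_space
  proof eventually_elim
    case (elim z)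
    have "U i \<in> borel_measurable (M z)" "U i \<in> borel_measurable (N z)" for i
      using seq(1) elim finite_borel_measurable[OF M] finite_borel_measurable[OF N] by blast+
    then show ?case
      using seq(4) elim(1) by (simp add: nn_integral_monotone_convergence_SUP image_comp)
  qed
qed

lemma AE_eq_integral:
  fixes \<phi> :: "'a::topological_space \<Rightarrow> real"
  assumes M: "\<And>z. z \<in> space H \<Longrightarrow> finite_borel (M z)" and N: "\<And>z. z \<in> space H \<Longrightarrow> finite_borel (N z)"
    and eq: "\<And>A. A \<in> sets borel \<Longrightarrow> AE z in H. measure (M z) A = measure (N z) A"
    and \<phi>: "bounded_continuous \<phi>"
  shows "AE z in H. (\<integral>x. \<phi> x \<partial>M z) = (\<integral>x. \<phi> x \<partial>N z)"
proof -
  note m = bounded_continuous_measurable[OF \<phi>]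
  have "AE z in H. (\<integral>\<^sup>+x. ennreal (\<phi> x) \<partial>M z) = (\<integral>\<^sup>+x. ennreal (\<phi> x) \<partial>N z)"
    "AE z in H. (\<integral>\<^sup>+x. ennreal (- \<phi> x) \<partial>M z) = (\<integral>\<^sup>+x. ennreal (- \<phi> x) \<partial>N z)"
    using m by (intro AE_eq_nn_integral[OF M N eq]; simp)+
  then show ?thesis
    using AE_space
    by eventually_elim
      (simp add: real_lebesgue_integral_def bounded_continuous_integrable[OF M \<phi>]
        bounded_continuous_integrable[OF N \<phi>])
qed

section \<open>Measures with prescribed moved projections\<close>

definition mv :: "real \<Rightarrow> real \<times> real \<Rightarrow> real" where
  "mv t = (\<lambda>(x, v). x + t * v)"

lemma continuous_mv: "continuous_on UNIV (mv t)"
  unfolding mv_def case_prod_beta by (intro continuous_intros)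

lemma measurable_mv [measurable]: "mv t \<in> borel_measurable borel"
  by (rule borel_measurable_continuous_onI[OF continuous_mv])

text \<open>\<open>X\<close> is arbitrary because this is applied to \<Gamma> before that set is
  known to be Borel. Regularity is direct: \<open>A \<inter> {p}\<close> is compact, and every set
  in the rest of \<open>A\<close> has value 0.\<close>

lemma dirac_radon:
  fixes X :: "'a::t1_space set"
  assumes "p \<in> X"
  shows "(\<lambda>A. if A \<in> borel_on X then indicator A p else 0) \<in> radon X" (is "?\<delta> \<in> _")
proof -
  let ?R = "restrict_space borel X"
  have \<delta>: "?\<delta> A = measure (return ?R p) A" for A
    by (cases "A \<in> borel_on X") (auto simp: measure_return measure_notin_sets)
  interpret prob_space "return ?R p"
    using assms by (intro prob_space_return) (simp add: space_restrict_space)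
  have c: "(\<lambda>i. ?\<delta> (A i)) sums ?\<delta> (\<Union>i. A i)"
    if "range A \<subseteq> borel_on X" "disjoint_family A" for A :: "nat \<Rightarrow> 'a set"
    unfolding \<delta> using that by (intro finite_measure_UNION) auto
  have t: "\<exists>K\<subseteq>A. compact K \<and> total_variation X ?\<delta> (A - K) < e" if "e > 0" for A e
  proof (intro exI conjI)
    have "(SUP P \<in> {P. finite P \<and> disjoint P \<and> P \<subseteq> borel_on X \<and> \<Union>P \<subseteq> A - A \<inter> {p}}. \<Sum>B\<in>P. \<bar>?\<delta> B\<bar>)
        = (SUP P \<in> {P. finite P \<and> disjoint P \<and> P \<subseteq> borel_on X \<and> \<Union>P \<subseteq> A - A \<inter> {p}}. 0)"
      by (intro SUP_cong sum.neutral refl) (auto simp: indicator_def)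
    also have "\<dots> = (0 :: real)"
      by (rule cSUP_const) (auto intro: exI[of _ "{}"])
    finally show "total_variation X ?\<delta> (A - A \<inter> {p}) < e"
      using that by (simp add: total_variation_def)
  qed (auto intro: finite_imp_compact)
  show ?thesis
    unfolding radon_def
  proof (intro CollectI conjI allI impI ballI)
    show "?\<delta> A = 0" if "A \<notin> borel_on X" for A using that by simp
  qed (erule c, assumption, erule t)
qed

lemma weakly_concentrating:
  fixes k :: "'a::metric_space \<Rightarrow> real"
  assumes H: "\<And>n. finite_borel (H n)" "\<And>n. prob_space (H n)"
    and conc: "\<And>n. AE x in H n. dist a x < 1 / Suc n" and k: "bounded_continuous k"
  shows "(\<lambda>n. \<integral>x. k x \<partial>H n) \<longlonglongrightarrow> k a"
proof (rule LIMSEQ_I)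
  fix e :: real assume e: "0 < e"
  have "isCont k a" using k by (auto simp: bounded_continuous_def continuous_on_eq_continuous_at)
  then obtain d where d: "d > 0" "\<And>x. dist x a < d \<Longrightarrow> dist (k x) (k a) < e / 2"
    using e unfolding continuous_at_eps_delta by (meson half_gt_zero)
  obtain N :: nat where N: "1 / Suc N < d" using d(1) nat_approx_posE by blast
  show "\<exists>no. \<forall>n\<ge>no. norm ((\<integral>x. k x \<partial>H n) - k a) < e"
  proof (intro exI allI impI)
    fix n assume n: "n \<ge> N"
    interpret prob_space "H n" by (rule H)
    have int: "integrable (H n) k" by (rule bounded_continuous_integrable[OF H(1) k])
    have le: "1 / real (Suc n) \<le> 1 / real (Suc N)"
      using n by (intro divide_left_mono) auto
    have "(\<integral>x. k x \<partial>H n) - k a = (\<integral>x. k x - k a \<partial>H n)"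
      using int by (simp add: prob_space)
    also have "\<bar>\<dots>\<bar> \<le> (\<integral>x. \<bar>k x - k a\<bar> \<partial>H n)" by (rule integral_abs_bound)
    also have "\<dots> \<le> (\<integral>x. e / 2 \<partial>H n)"
    proof (rule integral_mono_AE)
      show "AE x in H n. \<bar>k x - k a\<bar> \<le> e / 2"
        using conc[of n]
      proof eventually_elim
        case (elim x)
        then have "dist x a < d" using N le by (simp add: dist_commute)
        from d(2)[OF this] show ?case by (simp add: dist_real_def)
      qed
    qed (use int in auto)
    also have "\<dots> < e" using e by (simp add: prob_space)
    finally show "norm ((\<integral>x. k x \<partial>H n) - k a) < e" by simp
  qed
qed

section \<open>The standing setting, compactness of \<Gamma>, and injectivity for Borel
  measures\<close>

locale dynamic_setting =
  fixes \<Omega> \<Theta> :: "(real^'n) set" and S \<Xi> :: "real set" and \<Gamma> :: "(real \<times> real) set"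
    and H\<^sub>S :: "real measure" and H\<^sub>\<Theta> :: "(real^'n) measure"
  assumes compact_\<Omega>: "compact \<Omega>" and compact_S: "compact S" and compact_\<Theta>: "compact \<Theta>"
    and sphere: "\<Theta> \<subseteq> sphere 0 1" and S_ne: "S \<noteq> {}" and \<Theta>_ne: "\<Theta> \<noteq> {}"
    and sets_HS: "sets H\<^sub>S = borel_on S" and prob_HS: "prob_space H\<^sub>S"
    and sets_HT: "sets H\<^sub>\<Theta> = borel_on \<Theta>" and prob_HT: "prob_space H\<^sub>\<Theta>"
    and support_HT: "measure_support H\<^sub>\<Theta> = \<Theta>"
    and \<Gamma>_def: "\<Gamma> = Gamma_set \<Omega> S \<Theta>" and \<Xi>_def: "\<Xi> = Xi_set \<Omega> \<Theta>"
    and inj_Mv: "inj_on (Mv H\<^sub>S \<Gamma> \<Xi>) (radon \<Gamma>)"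
begin

lemma space_HS: "space H\<^sub>S = S" and space_HT: "space H\<^sub>\<Theta> = \<Theta>"
  using sets_eq_imp_space_eq[of H\<^sub>S "restrict_space borel S"] sets_HS
    sets_eq_imp_space_eq[of H\<^sub>\<Theta> "restrict_space borel \<Theta>"] sets_HT
  by (auto simp: space_restrict_space)

lemma Mv_at_def': "Mv_at \<Gamma> \<Xi> t \<nu> = pushforward \<Gamma> \<Xi> (mv t) \<nu>"
  by (simp add: Mv_at_def mv_def)

lemma mv_in_\<Xi>:
  assumes "z \<in> \<Gamma>" "t \<in> S"
  shows "mv t z \<in> \<Xi>"
proof -
  obtain x v \<theta> where z: "z = (\<theta> \<bullet> x, \<theta> \<bullet> v)" and "(x, v) \<in> Lambda_set \<Omega> S" and \<theta>: "\<theta> \<in> \<Theta>"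
    using assms(1) unfolding \<Gamma>_def Gamma_set_def by blast
  then have "x + t *\<^sub>R v \<in> \<Omega>" using assms(2) by (simp add: Lambda_set_def)
  moreover have "mv t z = \<theta> \<bullet> (x + t *\<^sub>R v)" by (simp add: z mv_def inner_add_right)
  ultimately show ?thesis using \<theta> unfolding \<Xi>_def Xi_set_def by blast
qed

lemma Mv_cong:
  assumes "\<And>t. t \<in> S \<Longrightarrow> Mv_at \<Gamma> \<Xi> t \<mu> = Mv_at \<Gamma> \<Xi> t \<nu>"
  shows "Mv H\<^sub>S \<Gamma> \<Xi> \<mu> = Mv H\<^sub>S \<Gamma> \<Xi> \<nu>"
  unfolding Mv_def prod_base_def
  by (intro ext if_cong refl Bochner_Integration.integral_cong) (simp add: space_HS assms)

lemma compact_\<Xi>: "compact \<Xi>"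
proof -
  have "\<Xi> = (\<lambda>(x, \<theta>). \<theta> \<bullet> x) ` (\<Omega> \<times> \<Theta>)"
    by (force simp: \<Xi>_def Xi_set_def)
  moreover have "continuous_on (\<Omega> \<times> \<Theta>) (\<lambda>(x, \<theta>). \<theta> \<bullet> x)"
    unfolding case_prod_beta by (intro continuous_intros)
  ultimately show ?thesis
    using compact_\<Omega> compact_\<Theta> by (simp add: compact_continuous_image compact_Times)
qed

text \<open>If \<open>S\<close> is a single time, \<open>\<Gamma>\<close> is unbounded, but then two Dirac measures on \<open>\<Gamma>\<close> have the same
  image under the move operator.\<close>

lemma compact_\<Gamma>: "compact \<Gamma>"
proof (cases "\<Omega> = {}")
  case True
  then show ?thesis using S_ne by (auto simp: \<Gamma>_def Gamma_set_def Lambda_set_def)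
next
  case False
  then obtain \<omega> where \<omega>: "\<omega> \<in> \<Omega>" by auto
  obtain \<theta> where \<theta>: "\<theta> \<in> \<Theta>" using \<Theta>_ne by auto
  obtain s where s: "s \<in> S" using S_ne by auto
  have "\<exists>t\<in>S. t \<noteq> s"
  proof (rule ccontr)
    assume "\<not> ?thesis"
    then have S: "S = {s}" using s by blast
    \<comment> \<open>\<open>q\<close> belongs to a particle with velocity \<open>\<theta>\<close>
      that reaches \<open>\<omega>\<close> at time \<open>s\<close>, where \<open>p\<close> rests;
      at this only time the two cannot be told apart, although their velocities along
      \<open>\<theta>\<close> are 1 and 0.\<close>
    define p q where "p = (\<theta> \<bullet> \<omega>, 0 :: real)" and "q = (\<theta> \<bullet> (\<omega> - s *\<^sub>R \<theta>), \<theta> \<bullet> \<theta>)"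
    have \<theta>1: "\<theta> \<bullet> \<theta> = 1" using \<theta> sphere by (auto simp: power2_norm_eq_inner[symmetric])
    have in\<Gamma>: "(\<theta> \<bullet> x, \<theta> \<bullet> v) \<in> \<Gamma>" if "x + s *\<^sub>R v \<in> \<Omega>" for x v
      unfolding \<Gamma>_def Gamma_set_def using \<theta> that by (auto simp: Lambda_set_def S)
    have pq: "p \<in> \<Gamma>" "q \<in> \<Gamma>"
      using in\<Gamma>[of \<omega> 0] in\<Gamma>[of "\<omega> - s *\<^sub>R \<theta>" \<theta>] \<omega> by (simp_all add: p_def q_def)
    define \<delta> where "\<delta> z A = (if A \<in> borel_on \<Gamma> then indicator A z else (0 :: real))"
      for z :: "real \<times> real" and A
    have "mv s p = mv s q" by (simp add: p_def q_def mv_def inner_diff_right \<theta>1)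
    then have "pushforward \<Gamma> \<Xi> (mv s) (\<delta> p) B = pushforward \<Gamma> \<Xi> (mv s) (\<delta> q) B" for B
      using pq by (simp add: pushforward_def \<delta>_def indicator_def)
    then have "Mv H\<^sub>S \<Gamma> \<Xi> (\<delta> p) = Mv H\<^sub>S \<Gamma> \<Xi> (\<delta> q)"
      by (intro Mv_cong) (auto simp: S Mv_at_def')
    moreover have "\<delta> p \<in> radon \<Gamma>" "\<delta> q \<in> radon \<Gamma>"
      unfolding \<delta>_def using pq by (auto intro: dirac_radon)
    ultimately have "\<delta> p = \<delta> q" using inj_Mv by (auto dest: inj_onD)
    then have "\<delta> p {p} = \<delta> q {p}" by simp
    moreover have "{p} \<in> borel_on \<Gamma>" using borel_on_Int[of "{p}" \<Gamma>] pq by simp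
    ultimately have "p = q" by (auto simp: \<delta>_def indicator_def split: if_splits)
    then show False by (simp add: p_def q_def \<theta>1)
  qed
  then obtain t where t: "t \<in> S" "t \<noteq> s" by auto
  let ?\<Lambda> = "Lambda_set \<Omega> S"
  have "closed ?\<Lambda>"
  proof -
    have "?\<Lambda> = (\<Inter>r\<in>S. (\<lambda>z. fst z + r *\<^sub>R snd z) -` \<Omega>)"
      by (auto simp: Lambda_set_def)
    moreover have "closed ((\<lambda>z. fst z + r *\<^sub>R snd z) -` \<Omega>)" for r
      by (intro closed_vimage compact_imp_closed compact_\<Omega> continuous_intros)
    ultimately show ?thesis by auto
  qed
  moreover have "bounded ?\<Lambda>"
  proof (rule bounded_subset)
    \<comment> \<open>Inverts the map taking (x, v) to its positions at the times s and t: two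
      distinct times determine position and velocity linearly.\<close>
    let ?f = "\<lambda>z :: (real^'n) \<times> (real^'n).
      (fst z - (s / (s - t)) *\<^sub>R (fst z - snd z), (1 / (s - t)) *\<^sub>R (fst z - snd z))"
    show "bounded (?f ` (\<Omega> \<times> \<Omega>))"
      by (intro compact_imp_bounded compact_continuous_image continuous_intros compact_Times compact_\<Omega>)
    show "?\<Lambda> \<subseteq> ?f ` (\<Omega> \<times> \<Omega>)"
    proof clarify
      fix x v assume xv: "(x, v) \<in> ?\<Lambda>"
      then have "x + s *\<^sub>R v \<in> \<Omega>" "x + t *\<^sub>R v \<in> \<Omega>" using s t by (auto simp: Lambda_set_def)
      moreover have "?f (x + s *\<^sub>R v, x + t *\<^sub>R v) = (x, v)"
        using t(2) by (simp flip: scaleR_left_diff_distrib)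
      ultimately show "(x, v) \<in> ?f ` (\<Omega> \<times> \<Omega>)" by (metis (no_types, lifting) SigmaI image_eqI)
    qed
  qed
  ultimately have "compact ?\<Lambda>" by (simp add: compact_eq_bounded_closed)
  moreover have "\<Gamma> = (\<lambda>z. (snd z \<bullet> fst (fst z), snd z \<bullet> snd (fst z))) ` (?\<Lambda> \<times> \<Theta>)"
    by (force simp: \<Gamma>_def Gamma_set_def)
  moreover have "continuous_on (?\<Lambda> \<times> \<Theta>) (\<lambda>z. (snd z \<bullet> fst (fst z), snd z \<bullet> snd (fst z)))"
    by (intro continuous_intros)
  ultimately show ?thesis using compact_\<Theta> by (simp add: compact_continuous_image compact_Times)
qed

lemma borel_sets [simp, measurable]:
  "\<Omega> \<in> sets borel" "\<Theta> \<in> sets borel" "S \<in> sets borel" "\<Xi> \<in> sets borel" "\<Gamma> \<in> sets borel"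
  "\<Theta> \<times> \<Gamma> \<in> sets borel" "\<Theta> \<times> \<Xi> \<in> sets borel" "\<Xi> \<times> S \<in> sets borel"
  using compact_\<Omega> compact_\<Theta> compact_S compact_\<Xi> compact_\<Gamma>
  by (auto intro!: borel_closed compact_imp_closed compact_Times)

text \<open>Injectivity in the form used below. \<open>Mv\<close> integrates the images over the
  times in \<open>S\<close>, so it cannot separate measures with the same image at every such
  time.\<close>

lemma mv_injective:
  assumes M: "finite_borel M" "measure M (-\<Gamma>) = 0" and N: "finite_borel N" "measure N (-\<Gamma>) = 0"
    and eq: "\<And>t. t \<in> S \<Longrightarrow> distr M borel (mv t) = distr N borel (mv t)"
  shows "M = N"
proof -
  have rp: "trace_on \<Gamma> M \<in> radon_plus \<Gamma>" "trace_on \<Gamma> N \<in> radon_plus \<Gamma>"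
    by (simp_all add: trace_on_radon_plus M N)
  have ext: "borel_ext \<Gamma> (trace_on \<Gamma> M) = M" "borel_ext \<Gamma> (trace_on \<Gamma> N) = N"
    using rp by (simp_all add: borel_ext_trace_on M N)
  have "Mv H\<^sub>S \<Gamma> \<Xi> (trace_on \<Gamma> M) = Mv H\<^sub>S \<Gamma> \<Xi> (trace_on \<Gamma> N)"
    using rp by (intro Mv_cong) (simp add: Mv_at_def' pushforward_eq_trace_on ext eq)
  then have "trace_on \<Gamma> M = trace_on \<Gamma> N"
    using inj_Mv rp by (auto dest!: inj_onD intro: radon_plusD(3))
  then show ?thesis using ext by metis
qed

text \<open>The constraint of the second problem in one direction, as an equality of Borel measures
  on the whole line; leaving \<Xi> out lets it be tested with bounded continuous functions.\<close>

definition projects :: "(real \<Rightarrow> (real^'n) set \<Rightarrow> real) \<Rightarrow> (real^'n) \<Rightarrow> (real \<times> real) measure \<Rightarrow> bool" where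
  "projects u \<theta> M \<longleftrightarrow> finite_borel M \<and> measure M (-\<Gamma>) = 0 \<and>
     (\<forall>t\<in>S. distr M borel (mv t) = distr (borel_ext \<Omega> (u t)) borel (\<lambda>x. \<theta> \<bullet> x))"

lemma measurable_inner_borel: "(\<lambda>x. \<theta> \<bullet> x) \<in> borel_measurable borel" for \<theta> :: "real^'n"
  by measurable

lemma inner_in_\<Xi>: "\<theta> \<in> \<Theta> \<Longrightarrow> (\<lambda>x. \<theta> \<bullet> x) ` \<Omega> \<subseteq> \<Xi>"
  unfolding \<Xi>_def Xi_set_def by blast

text \<open>Both images are carried by \<Xi>, so comparing their restrictions to \<Xi> amounts to
  comparing the measures on the whole line.\<close>

lemma projects_iff:
  assumes u: "u \<in> S \<rightarrow> radon_plus \<Omega>" and \<theta>: "\<theta> \<in> \<Theta>" and \<nu>: "\<nu> \<in> radon_plus \<Gamma>"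
  shows "(\<forall>t\<in>S. Mv_at \<Gamma> \<Xi> t \<nu> = Rd_at \<Omega> \<Xi> \<theta> (u t)) \<longleftrightarrow> projects u \<theta> (borel_ext \<Gamma> \<nu>)"
proof -
  have "Mv_at \<Gamma> \<Xi> t \<nu> = Rd_at \<Omega> \<Xi> \<theta> (u t) \<longleftrightarrow>
    distr (borel_ext \<Gamma> \<nu>) borel (mv t) = distr (borel_ext \<Omega> (u t)) borel (\<lambda>x. \<theta> \<bullet> x)" if t: "t \<in> S" for t
  proof -
    have ut: "u t \<in> radon_plus \<Omega>" using u t by auto
    have mv\<Gamma>: "mv t ` \<Gamma> \<subseteq> \<Xi>" using mv_in_\<Xi> t by auto
    have 1: "Mv_at \<Gamma> \<Xi> t \<nu> = trace_on \<Xi> (distr (borel_ext \<Gamma> \<nu>) borel (mv t))"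
      "borel_ext \<Xi> (Mv_at \<Gamma> \<Xi> t \<nu>) = distr (borel_ext \<Gamma> \<nu>) borel (mv t)"
      unfolding Mv_at_def'
      by (rule pushforward_eq_trace_on[OF \<nu> _ _ measurable_mv]; simp)
        (rule borel_ext_pushforward[OF \<nu> _ _ measurable_mv mv\<Gamma>]; simp)
    have 2: "Rd_at \<Omega> \<Xi> \<theta> (u t) = trace_on \<Xi> (distr (borel_ext \<Omega> (u t)) borel (\<lambda>x. \<theta> \<bullet> x))"
      "borel_ext \<Xi> (Rd_at \<Omega> \<Xi> \<theta> (u t)) = distr (borel_ext \<Omega> (u t)) borel (\<lambda>x. \<theta> \<bullet> x)"
      unfolding Rd_at_def
      by (rule pushforward_eq_trace_on[OF ut _ _ measurable_inner_borel]; simp)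
        (rule borel_ext_pushforward[OF ut _ _ measurable_inner_borel inner_in_\<Xi>[OF \<theta>]]; simp)
    show ?thesis
      using 1 2 by metis
  qed
  then show ?thesis
    using \<nu> by (simp add: projects_def finite_borel_borel_ext measure_borel_ext_Compl)
qed

section \<open>Single directions for a fixed \<open>u\<close>: uniqueness, weak limits and
  continuity\<close>

context
  fixes u :: "real \<Rightarrow> (real^'n) set \<Rightarrow> real"
  assumes u: "u \<in> S \<rightarrow> radon_plus \<Omega>"
begin

lemma u_radon_plus: "t \<in> S \<Longrightarrow> u t \<in> radon_plus \<Omega>"
  using u by auto

lemma finite_borel_u: "t \<in> S \<Longrightarrow> finite_borel (borel_ext \<Omega> (u t))"
  by (rule finite_borel_borel_ext[OF u_radon_plus])

lemma mass_u: "t \<in> S \<Longrightarrow> measure (borel_ext \<Omega> (u t)) UNIV = u t \<Omega>"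
  by (simp add: measure_borel_ext[OF u_radon_plus])

lemma projects_mass:
  assumes "projects u \<theta> M" "t \<in> S"
  shows "measure M UNIV = u t \<Omega>"
proof -
  have M: "finite_borel M" using assms by (simp add: projects_def)
  have "measure (distr M borel (mv t)) UNIV = measure (distr (borel_ext \<Omega> (u t)) borel (\<lambda>x. \<theta> \<bullet> x)) UNIV"
    using assms by (simp add: projects_def)
  then show ?thesis
    using M finite_borel_u[OF assms(2)] mass_u[OF assms(2)]
    by (simp add: measure_distr finite_borel_measurable finite_borelD)
qed

lemma projects_unique: "projects u \<theta> M \<Longrightarrow> projects u \<theta> N \<Longrightarrow> M = N"
  by (rule mv_injective) (auto simp: projects_def)

lemma projects_integral:
  assumes "projects u \<theta> M" "t \<in> S" "bounded_continuous \<phi>"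
  shows "(\<integral>z. \<phi> (mv t z) \<partial>M) = (\<integral>x. \<phi> (\<theta> \<bullet> x) \<partial>borel_ext \<Omega> (u t))"
proof -
  note \<phi> = bounded_continuous_measurable[OF assms(3)]
  have "(\<integral>z. \<phi> (mv t z) \<partial>M) = (\<integral>y. \<phi> y \<partial>distr M borel (mv t))"
    using assms by (intro integral_distr_borel[symmetric, OF _ measurable_mv \<phi>]) (simp add: projects_def)
  also have "\<dots> = (\<integral>y. \<phi> y \<partial>distr (borel_ext \<Omega> (u t)) borel (\<lambda>x. \<theta> \<bullet> x))"
    using assms by (simp add: projects_def)
  also have "\<dots> = (\<integral>x. \<phi> (\<theta> \<bullet> x) \<partial>borel_ext \<Omega> (u t))"
    by (rule integral_distr_borel[OF finite_borel_u[OF assms(2)] measurable_inner_borel \<phi>])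
  finally show ?thesis .
qed

text \<open>The direction enters only through the jointly continuous map \<theta> \<bullet> x, so
  dominated convergence applies. The weak continuity of solutions in the direction rests on
  this.\<close>

lemma bounded_continuous_Rd:
  assumes "t \<in> S" "bounded_continuous \<phi>"
  shows "bounded_continuous (\<lambda>\<theta>. \<integral>x. \<phi> (\<theta> \<bullet> x) \<partial>borel_ext \<Omega> (u t))"
proof -
  have "bounded_continuous (\<lambda>z :: (real^'n) \<times> (real^'n). \<phi> (fst z \<bullet> snd z))"
    by (rule bounded_continuous_compose[OF assms(2)]) (intro continuous_intros)
  from bounded_continuous_integral[OF finite_borel_u[OF assms(1)] this]
  show ?thesis by simp
qed

text \<open>The subsequence is chosen by compactness before any time is fixed, so one limit meets
  the constraints for all t in \<open>S\<close> at once. The lemma serves both existence in a given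
  direction and continuity in the direction.\<close>

lemma projects_limit:
  assumes \<nu>: "\<And>n. finite_borel (\<nu> n)" "\<And>n. measure (\<nu> n) (-\<Gamma>) = 0" "\<And>n. measure (\<nu> n) UNIV = c"
    and lim: "\<And>t \<phi>. t \<in> S \<Longrightarrow> bounded_continuous \<phi> \<Longrightarrow>
      (\<lambda>n. \<integral>z. \<phi> (mv t z) \<partial>\<nu> n) \<longlonglongrightarrow> (\<integral>x. \<phi> (\<theta> \<bullet> x) \<partial>borel_ext \<Omega> (u t))"
  obtains r M where "strict_mono r" "projects u \<theta> M" "weakly_converges (\<lambda>n. \<nu> (r n)) M"
proof -
  obtain r M where r: "strict_mono r" and M: "finite_borel M" "measure M (-\<Gamma>) = 0"
    and w: "weakly_converges (\<lambda>n. \<nu> (r n)) M"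
    by (rule weak_compactness[OF \<nu>(1) compact_\<Gamma> \<nu>(2,3)])
  have "distr M borel (mv t) = distr (borel_ext \<Omega> (u t)) borel (\<lambda>x. \<theta> \<bullet> x)" if t: "t \<in> S" for t
  proof (rule bounded_continuous_eqI)
    show "finite_borel (distr M borel (mv t))" by (rule finite_borel_distr[OF M(1) measurable_mv])
    show "finite_borel (distr (borel_ext \<Omega> (u t)) borel (\<lambda>x. \<theta> \<bullet> x))"
      by (rule finite_borel_distr[OF finite_borel_u[OF t] measurable_inner_borel])
    fix \<phi> :: "real \<Rightarrow> real" assume \<phi>: "bounded_continuous \<phi>"
    note \<phi>m = bounded_continuous_measurable[OF \<phi>]
    have "(\<lambda>n. \<integral>z. \<phi> (mv t z) \<partial>\<nu> (r n)) \<longlonglongrightarrow> (\<integral>z. \<phi> (mv t z) \<partial>M)"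
      using w bounded_continuous_compose[OF \<phi> continuous_mv] by (simp add: weakly_converges_def)
    moreover have "(\<lambda>n. \<integral>z. \<phi> (mv t z) \<partial>\<nu> (r n)) \<longlonglongrightarrow> (\<integral>x. \<phi> (\<theta> \<bullet> x) \<partial>borel_ext \<Omega> (u t))"
      using LIMSEQ_subseq_LIMSEQ[OF lim[OF t \<phi>] r] by (simp add: o_def)
    ultimately show "(\<integral>x. \<phi> x \<partial>distr M borel (mv t)) =
        (\<integral>x. \<phi> x \<partial>distr (borel_ext \<Omega> (u t)) borel (\<lambda>x. \<theta> \<bullet> x))"
      by (simp add: integral_distr_borel[OF M(1) measurable_mv \<phi>m] LIMSEQ_unique
          integral_distr_borel[OF finite_borel_u[OF t] measurable_inner_borel \<phi>m])
  qed
  with M have "projects u \<theta> M" by (simp add: projects_def)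
  then show ?thesis using r w that by blast
qed

text \<open>Otherwise a subsequence would keep distance \<open>e\<close> from the value at
  \<open>a\<close>; by \<open>projects_limit\<close> a further subsequence converges to a solution
  in direction \<open>a\<close>, which by uniqueness is \<open>M a\<close>.\<close>

lemma projects_weakly_continuous:
  assumes M: "\<And>\<theta>. \<theta> \<in> \<Theta> \<Longrightarrow> projects u \<theta> (M \<theta>)" and \<phi>: "bounded_continuous \<phi>"
  shows "continuous_on \<Theta> (\<lambda>\<theta>. \<integral>z. \<phi> z \<partial>M \<theta>)"
  unfolding continuous_on_sequentially
proof (intro allI ballI impI, elim conjE)
  fix x a assume x: "\<forall>n. x n \<in> \<Theta>" "x \<longlonglongrightarrow> a" and a: "a \<in> \<Theta>"
  let ?I = "\<lambda>\<theta>. \<integral>z. \<phi> z \<partial>M \<theta>"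
  have "(\<lambda>n. ?I (x n)) \<longlonglongrightarrow> ?I a"
  proof (rule ccontr)
    assume "\<not> ?thesis"
    then obtain e where e: "e > 0" "\<not> (\<forall>\<^sub>F n in sequentially. dist (?I (x n)) (?I a) < e)"
      unfolding tendsto_iff by auto
    from not_eventually_sequentiallyD[OF e(2)]
    obtain r :: "nat \<Rightarrow> nat" where r: "strict_mono r" "\<And>n. \<not> dist (?I (x (r n))) (?I a) < e" by blast
    obtain t0 where t0: "t0 \<in> S" using S_ne by auto
    define \<nu> where "\<nu> n = M (x (r n))" for n
    have \<nu>: "projects u (x (r n)) (\<nu> n)" for n using M x by (auto simp: \<nu>_def)
    have xr: "(\<lambda>n. x (r n)) \<longlonglongrightarrow> a" using LIMSEQ_subseq_LIMSEQ[OF x(2) r(1)] by (simp add: o_def)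
    obtain r' N where r': "strict_mono r'" and N: "projects u a N"
      and w: "weakly_converges (\<lambda>n. \<nu> (r' n)) N"
    proof (rule projects_limit)
      show "finite_borel (\<nu> n)" "measure (\<nu> n) (-\<Gamma>) = 0" for n using \<nu> by (auto simp: projects_def)
      show "measure (\<nu> n) UNIV = u t0 \<Omega>" for n by (rule projects_mass[OF \<nu> t0])
      show "(\<lambda>n. \<integral>z. \<psi> (mv t z) \<partial>\<nu> n) \<longlonglongrightarrow> (\<integral>x. \<psi> (a \<bullet> x) \<partial>borel_ext \<Omega> (u t))"
        if t: "t \<in> S" and \<psi>: "bounded_continuous \<psi>" for t \<psi>
      proof -
        have "isCont (\<lambda>\<theta>. \<integral>x. \<psi> (\<theta> \<bullet> x) \<partial>borel_ext \<Omega> (u t)) a"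
          using bounded_continuous_Rd[OF t \<psi>]
          by (auto simp: bounded_continuous_def continuous_on_eq_continuous_at)
        from isCont_tendsto_compose[OF this xr] show ?thesis
          by (simp add: projects_integral[OF \<nu> t \<psi>])
      qed
    qed
    have "N = M a" by (rule projects_unique[OF N M[OF a]])
    then have "(\<lambda>n. \<integral>z. \<phi> z \<partial>\<nu> (r' n)) \<longlonglongrightarrow> ?I a"
      using w \<phi> by (simp add: weakly_converges_def)
    from tendstoD[OF this e(1)] have "\<forall>\<^sub>F n in sequentially. False"
      by eventually_elim (use r(2) in \<open>auto simp: \<nu>_def\<close>)
    then show False by simp
  qed
  then show "(?I \<circ> x) \<longlonglongrightarrow> ?I a" by (simp add: o_def)
qed

lemma projects_measurable:
  assumes M: "\<And>\<theta>. \<theta> \<in> \<Theta> \<Longrightarrow> projects u \<theta> (M \<theta>)" and A: "A \<in> sets borel"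
  shows "(\<lambda>\<theta>. measure (M \<theta>) A) \<in> borel_measurable H\<^sub>\<Theta>"
proof (rule measurable_weakly_continuous_family[OF _ _ A])
  show "finite_borel (M \<theta>)" if "\<theta> \<in> space H\<^sub>\<Theta>" for \<theta>
    using M that by (simp add: space_HT projects_def)
  show "(\<lambda>\<theta>. \<integral>z. \<phi> z \<partial>M \<theta>) \<in> borel_measurable H\<^sub>\<Theta>" if "bounded_continuous \<phi>" for \<phi>
    using borel_measurable_continuous_on_restrict[OF projects_weakly_continuous[OF M that]]
      measurable_cong_sets[OF sets_HT refl] by blast
qed

end

end

section \<open>The feasible sets of the two problems\<close>

context dynamic_setting
begin

text \<open>The conditions on \<open>u\<close> alone, nonnegativity and the data constraint, are
  left outside, since the two problems share them.\<close>

definition feasible_P ::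
    "(real \<Rightarrow> (real^'n) set \<Rightarrow> real) \<Rightarrow> (((real^'n) \<times> real \<times> real) set \<Rightarrow> real) \<Rightarrow> bool" where
  "feasible_P u \<gamma> \<longleftrightarrow> \<gamma> \<in> radon_plus (\<Theta> \<times> \<Gamma>) \<and>
     (\<forall>t\<in>S. Mv_bar_at \<Theta> \<Gamma> \<Xi> t \<gamma> = Rd H\<^sub>\<Theta> \<Omega> \<Xi> (u t))"

definition feasible_Pi ::
    "(real \<Rightarrow> (real^'n) set \<Rightarrow> real) \<Rightarrow> ((real^'n) \<Rightarrow> (real \<times> real) set \<Rightarrow> real) \<Rightarrow> bool" where
  "feasible_Pi u g \<longleftrightarrow> (\<forall>\<theta>\<in>\<Theta>. g \<theta> \<in> radon_plus \<Gamma>) \<and>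
     (\<forall>t\<in>S. \<forall>\<theta>\<in>\<Theta>. Mv_at \<Gamma> \<Xi> t (g \<theta>) = Rd_at \<Omega> \<Xi> \<theta> (u t))"

section \<open>From feasible families to feasible products\<close>

lemma feasible_Pi_projects:
  assumes "u \<in> S \<rightarrow> radon_plus \<Omega>"
  shows "feasible_Pi u g \<longleftrightarrow>
    (\<forall>\<theta>\<in>\<Theta>. g \<theta> \<in> radon_plus \<Gamma> \<and> projects u \<theta> (borel_ext \<Gamma> (g \<theta>)))"
  using projects_iff[OF assms] unfolding feasible_Pi_def by blast

lemma Rd_at_eq:
  assumes ut: "\<nu> \<in> radon_plus \<Omega>" and \<theta>: "\<theta> \<in> \<Theta>" and A: "A \<in> sets borel"
  shows "Rd_at \<Omega> \<Xi> \<theta> \<nu> (A \<inter> \<Xi>) = measure (borel_ext \<Omega> \<nu>) ((\<lambda>x. \<theta> \<bullet> x) -` A)"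
proof -
  have "(\<lambda>x. \<theta> \<bullet> x) -` A \<in> sets borel"
    using measurable_sets[OF measurable_inner_borel A] by simp
  moreover have "(\<lambda>x. \<theta> \<bullet> x) -` (A \<inter> \<Xi>) \<inter> \<Omega> = (\<lambda>x. \<theta> \<bullet> x) -` A \<inter> \<Omega>"
    using inner_in_\<Xi>[OF \<theta>] by blast
  ultimately show ?thesis
    using borel_on_Int[OF A] by (simp add: Rd_at_def pushforward_def measure_borel_ext[OF ut])
qed

lemma feasible_Pi_mass:
  assumes u: "u \<in> S \<rightarrow> radon_plus \<Omega>" and g: "feasible_Pi u g" and t: "t \<in> S" and \<theta>: "\<theta> \<in> \<Theta>"
  shows "g \<theta> \<Gamma> = u t \<Omega>"
proof -
  have "projects u \<theta> (borel_ext \<Gamma> (g \<theta>))" "g \<theta> \<in> radon_plus \<Gamma>"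
    using g \<theta> feasible_Pi_projects[OF u] by auto
  then show ?thesis using projects_mass[OF u _ t] measure_borel_ext[of "g \<theta>" \<Gamma> UNIV] by simp
qed

lemma measurable_family_feasible_Pi:
  assumes u: "u \<in> S \<rightarrow> radon_plus \<Omega>" and g: "feasible_Pi u g"
  shows "measurable_family H\<^sub>\<Theta> \<Gamma> g"
  unfolding measurable_family_def
proof (intro conjI ballI)
  show "g \<theta> \<in> radon \<Gamma>" if "\<theta> \<in> space H\<^sub>\<Theta>" for \<theta>
    using g that radon_plusD(3) by (auto simp: feasible_Pi_def space_HT)
  fix A assume "A \<in> borel_on \<Gamma>"
  then have A: "A \<in> sets borel" "A \<subseteq> \<Gamma>" by (auto simp: borel_on_iff)
  have "(\<lambda>\<theta>. measure (borel_ext \<Gamma> (g \<theta>)) A) \<in> borel_measurable H\<^sub>\<Theta>"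
    using g feasible_Pi_projects[OF u] by (intro projects_measurable[OF u _ A(1)]) auto
  moreover have "measure (borel_ext \<Gamma> (g \<theta>)) A = g \<theta> A" if "\<theta> \<in> space H\<^sub>\<Theta>" for \<theta>
    using that g A measure_borel_ext[of "g \<theta>" \<Gamma> A]
    by (auto simp: feasible_Pi_def space_HT Int_absorb2)
  ultimately show "(\<lambda>\<theta>. g \<theta> A) \<in> borel_measurable H\<^sub>\<Theta>" by (simp cong: measurable_cong)
qed

lemma move_preimage:
  assumes t: "t \<in> S"
  shows "(\<lambda>(\<theta>, x, v). (\<theta>, x + t * v)) ` (\<Theta> \<times> \<Gamma>) \<subseteq> \<Theta> \<times> \<Xi>"
    and "(\<lambda>(\<theta> :: real^'n, x, v). (\<theta>, x + t * v)) \<in> borel_measurable borel"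
proof -
  show "(\<lambda>(\<theta>, x, v). (\<theta>, x + t * v)) ` (\<Theta> \<times> \<Gamma>) \<subseteq> \<Theta> \<times> \<Xi>"
    using mv_in_\<Xi>[OF _ t] by (force simp: mv_def)
  show "(\<lambda>(\<theta> :: real^'n, x, v). (\<theta>, x + t * v)) \<in> borel_measurable borel"
    unfolding case_prod_beta by (intro borel_measurable_continuous_onI continuous_intros)
qed

text \<open>The section over \<theta> of the preimage of \<open>C\<close> is the preimage under
  \<open>mv t\<close> of the section of \<open>C\<close>, so the constraint for each \<theta> makes
  the two integrands equal, for every Borel set \<open>C\<close> and not only on rectangles.\<close>

lemma Mv_bar_at_base_prod:
  assumes g: "feasible_Pi u g" and t: "t \<in> S"
  shows "Mv_bar_at \<Theta> \<Gamma> \<Xi> t (base_prod H\<^sub>\<Theta> \<Gamma> g) = Rd H\<^sub>\<Theta> \<Omega> \<Xi> (u t)"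
proof (rule ext)
  fix C
  let ?h = "\<lambda>(\<theta>, x, v). (\<theta>, x + t * v) :: (real^'n) \<times> real"
  show "Mv_bar_at \<Theta> \<Gamma> \<Xi> t (base_prod H\<^sub>\<Theta> \<Gamma> g) C = Rd H\<^sub>\<Theta> \<Omega> \<Xi> (u t) C"
  proof (cases "C \<in> borel_on (\<Theta> \<times> \<Xi>)")
    case False
    then show ?thesis by (simp add: Mv_bar_at_def pushforward_def Rd_def base_prod_def space_HT)
  next
    case True
    then have C: "C \<in> sets borel" "C \<subseteq> \<Theta> \<times> \<Xi>" by (auto simp: borel_on_iff)
    have hC: "?h -` C \<inter> (\<Theta> \<times> \<Gamma>) \<in> borel_on (\<Theta> \<times> \<Gamma>)"
      using measurable_sets[OF move_preimage(2)[OF t] C(1)] by (intro borel_on_Int) simp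
    have "g \<theta> {z. (\<theta>, z) \<in> ?h -` C \<inter> (\<Theta> \<times> \<Gamma>)} = Rd_at \<Omega> \<Xi> \<theta> (u t) {y. (\<theta>, y) \<in> C}"
      if \<theta>: "\<theta> \<in> \<Theta>" for \<theta>
    proof -
      have "Pair \<theta> -` C \<in> sets borel"
        using C(1) borel_prod by (metis sets_Pair1)
      then have "{y. (\<theta>, y) \<in> C} \<in> borel_on \<Xi>"
        using C(2) by (auto simp: borel_on_iff vimage_def)
      moreover have "{z. (\<theta>, z) \<in> ?h -` C \<inter> (\<Theta> \<times> \<Gamma>)} = mv t -` {y. (\<theta>, y) \<in> C} \<inter> \<Gamma>"
        using \<theta> by (auto simp: mv_def)
      ultimately have "g \<theta> {z. (\<theta>, z) \<in> ?h -` C \<inter> (\<Theta> \<times> \<Gamma>)} = Mv_at \<Gamma> \<Xi> t (g \<theta>) {y. (\<theta>, y) \<in> C}"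
        by (simp add: Mv_at_def' pushforward_def)
      also have "Mv_at \<Gamma> \<Xi> t (g \<theta>) = Rd_at \<Omega> \<Xi> \<theta> (u t)"
        using g t \<theta> by (simp add: feasible_Pi_def)
      finally show ?thesis .
    qed
    then have "(\<integral>\<theta>. g \<theta> {z. (\<theta>, z) \<in> ?h -` C \<inter> (\<Theta> \<times> \<Gamma>)} \<partial>H\<^sub>\<Theta>) =
        (\<integral>\<theta>. Rd_at \<Omega> \<Xi> \<theta> (u t) {y. (\<theta>, y) \<in> C} \<partial>H\<^sub>\<Theta>)"
      by (intro Bochner_Integration.integral_cong refl) (simp only: space_HT)
    then show ?thesis
      using True hC by (simp only: Mv_bar_at_def pushforward_def Rd_def base_prod_def space_HT if_True)
  qed
qed

lemma feasible_P_base_prod: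
  assumes u: "u \<in> S \<rightarrow> radon_plus \<Omega>" and g: "feasible_Pi u g"
  shows "feasible_P u (base_prod H\<^sub>\<Theta> \<Gamma> g)"
proof -
  obtain t where t: "t \<in> S" using S_ne by auto
  interpret prob_space H\<^sub>\<Theta> by (rule prob_HT)
  have "base_prod H\<^sub>\<Theta> \<Gamma> g \<in> radon_plus (space H\<^sub>\<Theta> \<times> \<Gamma>)"
    using g feasible_Pi_mass[OF u g t] measurable_family_feasible_Pi[OF u g]
    by (intro base_prod_radon_plus[where c = "u t \<Omega>"])
      (auto simp: space_HT sets_HT feasible_Pi_def finite_measure_axioms)
  then show ?thesis
    using Mv_bar_at_base_prod[OF g] by (simp add: feasible_P_def space_HT)
qed

text \<open>On rectangles the constraint localises to the directions in \<open>B\<close>; this is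
  the form from which the images of slices are computed.\<close>

lemma feasible_P_rectangle:
  assumes u: "u \<in> S \<rightarrow> radon_plus \<Omega>" and \<gamma>: "feasible_P u \<gamma>" and t: "t \<in> S"
    and B: "B \<in> borel_on \<Theta>" and A: "A \<in> sets borel"
  shows "\<gamma> (B \<times> (mv t -` A \<inter> \<Gamma>)) =
    (LINT \<theta>:B|H\<^sub>\<Theta>. measure (borel_ext \<Omega> (u t)) ((\<lambda>x. \<theta> \<bullet> x) -` A))"
proof -
  have ut: "u t \<in> radon_plus \<Omega>" using u t by auto
  have rad: "Rd_at \<Omega> \<Xi> \<theta> (u t) \<in> radon \<Xi>" if "\<theta> \<in> \<Theta>" for \<theta>
    unfolding Rd_at_def using pushforward_radon_plus[OF ut _ _ measurable_inner_borel inner_in_\<Xi>[OF that]]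
    by (simp add: radon_plusD(3))
  have BA: "B \<times> (A \<inter> \<Xi>) \<in> borel_on (\<Theta> \<times> \<Xi>)"
    by (rule borel_on_Times[OF B borel_on_Int[OF A]])
  \<comment> \<open>Cutting \<open>A\<close> to \<Xi> costs nothing here, because
    \<open>mv t\<close> maps \<Gamma> into \<Xi>.\<close>
  have "(\<lambda>(\<theta>, x, v). (\<theta>, x + t * v)) -` (B \<times> (A \<inter> \<Xi>)) \<inter> \<Theta> \<times> \<Gamma> = B \<times> (mv t -` A \<inter> \<Gamma>)"
    using B mv_in_\<Xi>[OF _ t] by (force simp: borel_on_iff mv_def)
  then have "\<gamma> (B \<times> (mv t -` A \<inter> \<Gamma>)) = Mv_bar_at \<Theta> \<Gamma> \<Xi> t \<gamma> (B \<times> (A \<inter> \<Xi>))"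
    using BA by (simp add: Mv_bar_at_def pushforward_def)
  also have "\<dots> = Rd H\<^sub>\<Theta> \<Omega> \<Xi> (u t) (B \<times> (A \<inter> \<Xi>))"
    using \<gamma> t by (simp add: feasible_P_def)
  also have "\<dots> = (LINT \<theta>:B|H\<^sub>\<Theta>. Rd_at \<Omega> \<Xi> \<theta> (u t) (A \<inter> \<Xi>))"
    unfolding Rd_def using B borel_on_Int[OF A] rad
    by (intro base_prod_times) (auto simp: space_HT sets_HT)
  also have "\<dots> = (LINT \<theta>:B|H\<^sub>\<Theta>. measure (borel_ext \<Omega> (u t)) ((\<lambda>x. \<theta> \<bullet> x) -` A))"
    unfolding set_lebesgue_integral_def
    by (intro Bochner_Integration.integral_cong refl) (simp add: space_HT Rd_at_eq[OF ut _ A])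
  finally show ?thesis .
qed

lemma feasible_P_mass:
  assumes u: "u \<in> S \<rightarrow> radon_plus \<Omega>" and \<gamma>: "feasible_P u \<gamma>" and t: "t \<in> S"
    and B: "B \<in> borel_on \<Theta>"
  shows "\<gamma> (B \<times> \<Gamma>) = measure H\<^sub>\<Theta> B * u t \<Omega>"
proof -
  interpret prob_space H\<^sub>\<Theta> by (rule prob_HT)
  have "B \<in> sets H\<^sub>\<Theta>" using B by (simp add: sets_HT)
  then show ?thesis
    using feasible_P_rectangle[OF u \<gamma> t B, of UNIV] mass_u[OF u t]
    by (simp add: set_integral_const less_top mult.commute measure_def)
qed

section \<open>Slices of a feasible \<gamma> over sets of directions\<close>

definition slice ::
    "(((real^'n) \<times> real \<times> real) set \<Rightarrow> real) \<Rightarrow> (real^'n) set \<Rightarrow> (real \<times> real) measure" where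
  "slice \<gamma> B = borel_ext \<Gamma> (\<lambda>A. if A \<in> borel_on \<Gamma> then \<gamma> (B \<times> A) else 0)"

text \<open>That the slice is a Radon measure is seen by writing it as the second marginal of
  \<gamma> restricted to the strip over \<open>B\<close>.\<close>

lemma slice:
  assumes \<gamma>: "\<gamma> \<in> radon_plus (\<Theta> \<times> \<Gamma>)" and B: "B \<in> borel_on \<Theta>"
  shows "finite_borel (slice \<gamma> B)" "A \<in> sets borel \<Longrightarrow> measure (slice \<gamma> B) A = \<gamma> (B \<times> (A \<inter> \<Gamma>))"
    "measure (slice \<gamma> B) (-\<Gamma>) = 0"
proof -
  let ?G = "borel_ext (\<Theta> \<times> \<Gamma>) \<gamma>"
  let ?\<nu> = "\<lambda>A. if A \<in> borel_on \<Gamma> then \<gamma> (B \<times> A) else 0"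
  let ?N = "density ?G (indicator (B \<times> UNIV))"
  note fb = finite_borel_borel_ext[OF \<gamma>]
  interpret finite_measure ?G using finite_borelD[OF fb] by auto
  have B': "B \<in> sets borel" "B \<subseteq> \<Theta>" using B by (auto simp: borel_on_iff)
  then have BU: "B \<times> (UNIV :: (real \<times> real) set) \<in> sets borel"
    by (metis borel_prod pair_measureI sets.top space_borel)
  have emN: "emeasure ?N C = emeasure ?G ((B \<times> UNIV) \<inter> C)" if "C \<in> sets borel" for C
    using that BU finite_borelD[OF fb]
    by (simp add: emeasure_density indicator_inter_arith[symmetric] nn_integral_indicator
        flip: times_ennreal_def)
  have fN: "finite_borel ?N"
    using emN[of UNIV] finite_borelD[OF fb] by (auto simp: finite_borel_def intro!: finite_measureI)
  have snd: "snd \<in> borel_measurable (borel :: ((real^'n) \<times> real \<times> real) measure)"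
    by (intro borel_measurable_continuous_onI continuous_intros)
  have "trace_on \<Gamma> (distr ?N borel snd) = ?\<nu>"
  proof (rule ext)
    fix A
    show "trace_on \<Gamma> (distr ?N borel snd) A = ?\<nu> A"
    proof (cases "A \<in> borel_on \<Gamma>")
      case True
      then have A: "A \<in> sets borel" "A \<subseteq> \<Gamma>" by (auto simp: borel_on_iff)
      have sA: "snd -` A \<in> sets (borel :: ((real^'n) \<times> real \<times> real) measure)"
        using measurable_sets[OF snd A(1)] by simp
      have BA: "B \<times> A \<in> sets borel" by (metis borel_prod pair_measureI A(1) B'(1))
      have "measure (distr ?N borel snd) A = measure ?N (snd -` A)"
        using snd A finite_borelD[OF fN] by (simp add: measure_distr finite_borel_measurable[OF fN])
      also have "\<dots> = measure ?G ((B \<times> UNIV) \<inter> snd -` A)"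
        using emN[OF sA] by (simp add: measure_def)
      also have "(B \<times> UNIV) \<inter> snd -` A = B \<times> A" by auto
      also have "measure ?G (B \<times> A) = \<gamma> (B \<times> A)"
        using measure_borel_ext[OF \<gamma> BA] A B' by (simp add: Times_Int_Times Int_absorb2)
      finally show ?thesis using True by (simp add: trace_on_def)
    qed (simp add: trace_on_def)
  qed
  then have \<nu>: "?\<nu> \<in> radon_plus \<Gamma>"
    using trace_on_radon_plus[OF finite_borel_distr[OF fN snd], of \<Gamma>] by simp
  show "finite_borel (slice \<gamma> B)" "measure (slice \<gamma> B) (-\<Gamma>) = 0"
    unfolding slice_def using \<nu> by (simp_all add: finite_borel_borel_ext measure_borel_ext_Compl)
  show "measure (slice \<gamma> B) A = \<gamma> (B \<times> (A \<inter> \<Gamma>))" if "A \<in> sets borel"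
    unfolding slice_def using measure_borel_ext[OF \<nu> that] borel_on_Int[OF that] by simp
qed

text \<open>The right side involves only \<open>u\<close>, \<open>B\<close>, \<open>A\<close> and
  the time, not \<gamma>. With injectivity this pins down the slice, and normalised over small
  \<open>B\<close> it yields the constraint in a single direction.\<close>

lemma slice_move:
  assumes u: "u \<in> S \<rightarrow> radon_plus \<Omega>" and \<gamma>: "feasible_P u \<gamma>" and t: "t \<in> S"
    and B: "B \<in> borel_on \<Theta>" and A: "A \<in> sets borel"
  shows "measure (distr (slice \<gamma> B) borel (mv t)) A =
    (LINT \<theta>:B|H\<^sub>\<Theta>. measure (borel_ext \<Omega> (u t)) ((\<lambda>x. \<theta> \<bullet> x) -` A))"
proof -
  have \<gamma>': "\<gamma> \<in> radon_plus (\<Theta> \<times> \<Gamma>)" using \<gamma> by (simp add: feasible_P_def)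
  note fb = slice(1)[OF \<gamma>' B]
  have "mv t -` A \<in> sets borel" using measurable_sets[OF measurable_mv A] by simp
  then show ?thesis
    using feasible_P_rectangle[OF u \<gamma> t B A] A
    by (simp add: measure_distr finite_borel_measurable[OF fb] finite_borelD[OF fb] slice(2)[OF \<gamma>' B])
qed

lemma feasible_P_unique:
  assumes u: "u \<in> S \<rightarrow> radon_plus \<Omega>" and \<gamma>: "feasible_P u \<gamma>" and \<gamma>': "feasible_P u \<gamma>'"
  shows "\<gamma> = \<gamma>'"
proof -
  have rp: "\<gamma> \<in> radon_plus (\<Theta> \<times> \<Gamma>)" "\<gamma>' \<in> radon_plus (\<Theta> \<times> \<Gamma>)"
    using \<gamma> \<gamma>' by (auto simp: feasible_P_def)
  have sl: "slice \<gamma> B = slice \<gamma>' B" if B: "B \<in> borel_on \<Theta>" for B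
  proof (rule mv_injective)
    show "distr (slice \<gamma> B) borel (mv t) = distr (slice \<gamma>' B) borel (mv t)" if "t \<in> S" for t
      using slice_move[OF u \<gamma> that B] slice_move[OF u \<gamma>' that B]
      by (intro finite_borel_eqI finite_borel_distr slice(1) rp B measurable_mv) auto
  qed (use slice[OF rp(1) B] slice[OF rp(2) B] in auto)
  let ?E = "{B \<times> A | B A. B \<in> sets borel \<and> A \<in> sets borel} :: ((real^'n) \<times> real \<times> real) set set"
  let ?M = "borel_ext (\<Theta> \<times> \<Gamma>) \<gamma>" and ?N = "borel_ext (\<Theta> \<times> \<Gamma>) \<gamma>'"
  note fb = finite_borel_borel_ext[OF rp(1)] finite_borel_borel_ext[OF rp(2)]
  have borel: "sets borel = sigma_sets UNIV ?E"
    by (rule sets_borel_prod)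
  have "?M = ?N"
  proof (rule measure_eqI_generator_eq[of ?E UNIV _ _ "\<lambda>_. UNIV"])
    show "Int_stable ?E" by (auto simp: Int_stable_def Times_Int_Times) blast
    show "sets ?M = sigma_sets UNIV ?E" "sets ?N = sigma_sets UNIV ?E"
      using finite_borelD[OF fb(1)] finite_borelD[OF fb(2)] borel by auto
    show "emeasure ?M X = emeasure ?N X" if XE: "X \<in> ?E" for X
    proof -
      obtain B A where X: "X = B \<times> A" and BA: "B \<in> sets borel" "A \<in> sets borel" using XE by blast
      have Xb: "X \<in> sets borel" unfolding X by (metis borel_prod pair_measureI BA)
      have "\<gamma> ((B \<inter> \<Theta>) \<times> (A \<inter> \<Gamma>)) = \<gamma>' ((B \<inter> \<Theta>) \<times> (A \<inter> \<Gamma>))"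
        using sl[OF borel_on_Int[OF BA(1)]] slice(2)[OF rp(1) borel_on_Int[OF BA(1)] BA(2)]
          slice(2)[OF rp(2) borel_on_Int[OF BA(1)] BA(2)] by simp
      then show ?thesis
        using emeasure_borel_ext[OF rp(1) Xb] emeasure_borel_ext[OF rp(2) Xb]
        by (simp add: X Times_Int_Times)
    qed
    have "UNIV \<times> UNIV \<in> ?E"
      by (intro CollectI exI[of _ UNIV] conjI refl) simp_all
    then show "range (\<lambda>_. UNIV) \<subseteq> ?E"
      unfolding UNIV_Times_UNIV by (rule image_subsetI)
    show "emeasure ?M UNIV \<noteq> \<infinity>"
      using finite_measure.emeasure_finite[OF finite_borelD(1)[OF fb(1)]] by simp
  qed auto
  then show ?thesis
    using trace_on_borel_ext[OF rp(1) borel_sets(6)] trace_on_borel_ext[OF rp(2) borel_sets(6)]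
    by metis
qed

lemma borel_measurable_HT: "f \<in> borel_measurable borel \<Longrightarrow> f \<in> borel_measurable H\<^sub>\<Theta>"
  and borel_measurable_HS: "h \<in> borel_measurable borel \<Longrightarrow> h \<in> borel_measurable H\<^sub>S"
  using measurable_restrict_space1 measurable_cong_sets[OF sets_HT refl]
    measurable_cong_sets[OF sets_HS refl] by blast+

text \<open>Normalised slices over shrinking balls have, under each \<open>mv t\<close>, the image
  of a product measure under the inner product, with the conditioned law \<open>H n\<close> of the
  direction as one factor. Integrals against them are thus \<open>H n\<close>-averages of a
  continuous function of the direction and converge to its value at \<theta>, as
  \<open>projects_limit\<close> requires.\<close>

lemma feasible_P_projects:
  assumes u: "u \<in> S \<rightarrow> radon_plus \<Omega>" and \<gamma>: "feasible_P u \<gamma>" and \<theta>: "\<theta> \<in> \<Theta>"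
  shows "\<exists>M. projects u \<theta> M"
proof -
  interpret HT: prob_space H\<^sub>\<Theta> by (rule prob_HT)
  have rp: "\<gamma> \<in> radon_plus (\<Theta> \<times> \<Gamma>)" using \<gamma> by (simp add: feasible_P_def)
  define B where "B n = ball \<theta> (1 / Suc n) \<inter> \<Theta>" for n
  have B: "B n \<in> borel_on \<Theta>" for n unfolding B_def by (rule borel_on_Int) simp
  then have BH: "B n \<in> sets H\<^sub>\<Theta>" for n by (simp add: sets_HT)
  define h where "h n = measure H\<^sub>\<Theta> (B n)" for n
  have emB: "emeasure H\<^sub>\<Theta> (B n) = ennreal (h n)" for n by (simp add: h_def HT.emeasure_eq_measure)
  \<comment> \<open>Full support of \<open>H\<^sub>\<Theta>\<close> is what allows the division by
    \<open>h n\<close>.\<close>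
  have h: "h n > 0" for n
  proof -
    have "0 < emeasure H\<^sub>\<Theta> (ball \<theta> (1 / Suc n) \<inter> space H\<^sub>\<Theta>)"
      using \<theta> support_HT unfolding measure_support_def by fastforce
    then show ?thesis using emB[of n] by (simp add: B_def space_HT)
  qed
  define \<nu> where "\<nu> n = density (slice \<gamma> (B n)) (\<lambda>_. ennreal (1 / h n))" for n
  have fb: "finite_borel (\<nu> n)" for n
    unfolding \<nu>_def by (rule finite_borel_density[OF slice(1)[OF rp B]])
  have m\<nu>: "measure (\<nu> n) A = 1 / h n * measure (slice \<gamma> (B n)) A" if "A \<in> sets borel" for n A
    unfolding \<nu>_def using that h[of n] finite_borelD[OF slice(1)[OF rp B]]
    by (subst measure_density_const) auto
  obtain t0 where t0: "t0 \<in> S" using S_ne by auto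
  \<comment> \<open>Transport along the identity turns a measure on subsets of \<Theta> into one on
    all Borel sets, as \<open>finite_borel\<close> demands.\<close>
  define H where "H n = distr (uniform_measure H\<^sub>\<Theta> (B n)) borel (\<lambda>x. x)" for n
  have idm: "(\<lambda>x. x) \<in> borel_measurable (uniform_measure H\<^sub>\<Theta> (B n))" for n
    using borel_measurable_HT[of "\<lambda>x. x"] by simp
  have probH: "prob_space (H n)" for n
    unfolding H_def using h[of n] emB[of n]
    by (intro prob_space.prob_space_distr prob_space_uniform_measure idm) auto
  have fbH: "finite_borel (H n)" for n
    using probH[of n] by (simp add: finite_borel_def H_def prob_space_def)
  have concH: "AE x in H n. dist \<theta> x < 1 / Suc n" for n
    unfolding H_def using BH[of n] idm[of n]
    by (subst AE_distr_iff) (auto intro!: AE_uniform_measureI simp: B_def)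
  have lim: "(\<lambda>n. \<integral>z. \<phi> (mv t z) \<partial>\<nu> n) \<longlonglongrightarrow> (\<integral>x. \<phi> (\<theta> \<bullet> x) \<partial>borel_ext \<Omega> (u t))"
    if t: "t \<in> S" and \<phi>: "bounded_continuous \<phi>" for t \<phi>
  proof -
    let ?U = "borel_ext \<Omega> (u t)"
    let ?f = "\<lambda>z :: (real^'n) \<times> (real^'n). fst z \<bullet> snd z"
    note fbU = finite_borel_u[OF u t]
    interpret U: finite_measure ?U by (rule finite_borelD(1)[OF fbU])
    note \<phi>m = bounded_continuous_measurable[OF \<phi>]
    have f: "continuous_on UNIV ?f" by (intro continuous_intros)
    then have fm: "?f \<in> borel_measurable borel" by (rule borel_measurable_continuous_onI)
    \<comment> \<open>Equality on Borel sets is what \<open>slice_move\<close> provides; the product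
      form of the right side then carries it over to integrals by Fubini.\<close>
    have eq: "distr (\<nu> n) borel (mv t) = distr (H n \<Otimes>\<^sub>M ?U) borel ?f" for n
    proof (rule finite_borel_eqI)
      note fbHU = finite_borel_pair[OF fbH[of n] fbU]
      show "finite_borel (distr (\<nu> n) borel (mv t))" "finite_borel (distr (H n \<Otimes>\<^sub>M ?U) borel ?f)"
        by (intro finite_borel_distr fb fbHU measurable_mv fm)+
      fix A :: "real set" assume A: "A \<in> sets borel"
      define m where "m \<theta> = measure ?U ((\<lambda>x. \<theta> \<bullet> x) -` A)" for \<theta>
      have m0: "0 \<le> m a" for a by (simp add: m_def)
      have Q: "?f -` A \<in> sets borel" using measurable_sets[OF fm A] by simp
      have PQ: "Pair a -` (?f -` A) = (\<lambda>x. a \<bullet> x) -` A" for a by auto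
      have emU: "emeasure ?U (Pair a -` (?f -` A)) = ennreal (m a)" for a
        by (simp add: PQ m_def U.emeasure_eq_measure)
      have "sets ((borel :: (real^'n) measure) \<Otimes>\<^sub>M ?U) = sets borel"
        using sets_pair_measure_cong[OF refl finite_borelD(2)[OF fbU], of "borel :: (real^'n) measure"]
        by (simp only: borel_prod)
      then have "(\<lambda>a. emeasure ?U (Pair a -` (?f -` A))) \<in> borel_measurable borel"
        using Q by (intro U.measurable_emeasure_Pair) (simp only:)
      from borel_measurable_enn2real[OF this[unfolded emU]]
      have mm: "m \<in> borel_measurable borel" by (simp add: m_def[abs_def])
      note mH = borel_measurable_HT[OF mm]
      have int: "integrable H\<^sub>\<Theta> (\<lambda>a. indicator (B n) a *\<^sub>R m a)"
      proof (rule HT.integrable_const_bound)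
        show "AE a in H\<^sub>\<Theta>. norm (indicator (B n) a *\<^sub>R m a) \<le> measure ?U (space ?U)"
          using m0 U.bounded_measure by (intro AE_I2) (simp add: indicator_def m_def)
        show "(\<lambda>a. indicator (B n) a *\<^sub>R m a) \<in> borel_measurable H\<^sub>\<Theta>"
          using mH BH[of n] by measurable
      qed
      have "emeasure (distr (H n \<Otimes>\<^sub>M ?U) borel ?f) A = emeasure (H n \<Otimes>\<^sub>M ?U) (?f -` A)"
        using A fm finite_borelD[OF fbHU] by (simp add: emeasure_distr finite_borel_measurable[OF fbHU])
      also have "\<dots> = (\<integral>\<^sup>+a. ennreal (m a) \<partial>H n)"
        using Q finite_borelD(2)[OF fbHU] by (subst U.emeasure_pair_measure_alt) (auto simp: emU)
      also have "\<dots> = (\<integral>\<^sup>+a. ennreal (m a) \<partial>uniform_measure H\<^sub>\<Theta> (B n))"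
        unfolding H_def using mm idm by (intro nn_integral_distr) auto
      also have "\<dots> = (\<integral>\<^sup>+a. ennreal (m a) * indicator (B n) a \<partial>H\<^sub>\<Theta>) / emeasure H\<^sub>\<Theta> (B n)"
        using mH BH by (intro nn_integral_uniform_measure) auto
      also have "(\<integral>\<^sup>+a. ennreal (m a) * indicator (B n) a \<partial>H\<^sub>\<Theta>) =
          (\<integral>\<^sup>+a. ennreal (indicator (B n) a *\<^sub>R m a) \<partial>H\<^sub>\<Theta>)"
        by (intro nn_integral_cong) (auto simp: indicator_def)
      also have "\<dots> = ennreal (LINT a:B n|H\<^sub>\<Theta>. m a)"
        unfolding set_lebesgue_integral_def
        by (intro nn_integral_eq_integral int) (auto simp: m0)
      also have "ennreal (LINT a:B n|H\<^sub>\<Theta>. m a) / emeasure H\<^sub>\<Theta> (B n) = ennreal ((LINT a:B n|H\<^sub>\<Theta>. m a) / h n)"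
        using h[of n] unfolding emB set_lebesgue_integral_def
        by (intro divide_ennreal) (auto simp: m0 intro!: integral_nonneg)
      finally have "measure (distr (H n \<Otimes>\<^sub>M ?U) borel ?f) A = (LINT a:B n|H\<^sub>\<Theta>. m a) / h n"
        using h[of n] unfolding set_lebesgue_integral_def
        by (simp add: measure_def m0 integral_nonneg)
      moreover have "measure (distr (\<nu> n) borel (mv t)) A = (LINT a:B n|H\<^sub>\<Theta>. m a) / h n"
      proof -
        have mvA: "mv t -` A \<in> sets borel" using measurable_sets[OF measurable_mv A] by simp
        note fbs = slice(1)[OF rp B, of n]
        have "measure (distr (\<nu> n) borel (mv t)) A = 1 / h n * measure (slice \<gamma> (B n)) (mv t -` A)"
          using A m\<nu>[OF mvA] by (simp add: measure_distr finite_borel_measurable[OF fb] finite_borelD[OF fb])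
        also have "measure (slice \<gamma> (B n)) (mv t -` A) = measure (distr (slice \<gamma> (B n)) borel (mv t)) A"
          using A by (simp add: measure_distr finite_borel_measurable[OF fbs] finite_borelD[OF fbs])
        also have "\<dots> = (LINT a:B n|H\<^sub>\<Theta>. m a)"
          unfolding m_def by (rule slice_move[OF u \<gamma> t B A])
        finally show ?thesis by simp
      qed
      ultimately show "measure (distr (\<nu> n) borel (mv t)) A =
          measure (distr (H n \<Otimes>\<^sub>M ?U) borel ?f) A" by simp
    qed
    have "(\<integral>z. \<phi> (mv t z) \<partial>\<nu> n) = (\<integral>a. \<integral>x. \<phi> (a \<bullet> x) \<partial>?U \<partial>H n)" for n
    proof -
      have "(\<integral>z. \<phi> (mv t z) \<partial>\<nu> n) = (\<integral>y. \<phi> y \<partial>distr (\<nu> n) borel (mv t))"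
        by (rule integral_distr_borel[symmetric, OF fb measurable_mv \<phi>m])
      also have "\<dots> = (\<integral>z. \<phi> (?f z) \<partial>(H n \<Otimes>\<^sub>M ?U))"
        unfolding eq by (rule integral_distr_borel[OF finite_borel_pair[OF fbH fbU] fm \<phi>m])
      also have "\<dots> = (\<integral>a. \<integral>x. \<phi> (?f (a, x)) \<partial>?U \<partial>H n)"
        by (rule integral_pair_bounded_continuous[OF fbH fbU bounded_continuous_compose[OF \<phi> f]])
      finally show ?thesis by simp
    qed
    then show ?thesis
      using weakly_concentrating[OF fbH probH concH bounded_continuous_Rd[OF u t \<phi>]] by simp
  qed
  have "measure (\<nu> n) (-\<Gamma>) = 0" for n
    using m\<nu>[of "-\<Gamma>" n] slice(3)[OF rp B] by simp
  \<comment> \<open>The factor \<open>h n\<close> from \<open>feasible_P_mass\<close> cancels, so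
    the masses are constant, as weak compactness requires.\<close>
  moreover have "measure (\<nu> n) UNIV = u t0 \<Omega>" for n
    using m\<nu>[of UNIV n] slice(2)[OF rp B, of UNIV n] feasible_P_mass[OF u \<gamma> t0 B, of n] h[of n]
    by (simp add: h_def)
  ultimately show ?thesis
    using projects_limit[OF u fb _ _ lim] by metis
qed

text \<open>The measures are chosen independently in each direction; measurability of the family
  comes afterwards from uniqueness and weak continuity. Its product with
  \<open>H\<^sub>\<Theta>\<close> is feasible for the same \<open>u\<close>, hence equal to
  \<gamma>.\<close>

lemma feasible_P_decomposition:
  assumes u: "u \<in> S \<rightarrow> radon_plus \<Omega>" and \<gamma>: "feasible_P u \<gamma>"
  obtains g where "g \<in> \<Theta> \<rightarrow>\<^sub>E radon_plus \<Gamma>" "feasible_Pi u g" "\<gamma> = base_prod H\<^sub>\<Theta> \<Gamma> g"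
proof -
  obtain M where M: "\<And>\<theta>. \<theta> \<in> \<Theta> \<Longrightarrow> projects u \<theta> (M \<theta>)"
    using feasible_P_projects[OF u \<gamma>] by metis
  define g where "g = restrict (\<lambda>\<theta>. trace_on \<Gamma> (M \<theta>)) \<Theta>"
  have rp: "trace_on \<Gamma> (M \<theta>) \<in> radon_plus \<Gamma>" if "\<theta> \<in> \<Theta>" for \<theta>
    using M[OF that] by (simp add: projects_def trace_on_radon_plus)
  moreover have "borel_ext \<Gamma> (trace_on \<Gamma> (M \<theta>)) = M \<theta>" if "\<theta> \<in> \<Theta>" for \<theta>
    using M[OF that] rp[OF that] by (simp add: projects_def borel_ext_trace_on)
  ultimately have g: "feasible_Pi u g"
    using M feasible_Pi_projects[OF u] by (simp add: g_def)
  have "\<gamma> = base_prod H\<^sub>\<Theta> \<Gamma> g"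
    by (rule feasible_P_unique[OF u \<gamma> feasible_P_base_prod[OF u g]])
  moreover have "g \<in> \<Theta> \<rightarrow>\<^sub>E radon_plus \<Gamma>" using rp by (auto simp: g_def)
  ultimately show ?thesis using g that by blast
qed

end

section \<open>Continuous decompositions\<close>

context dynamic_setting
begin

text \<open>The integral over times becomes a single image measure, that of the product of
  position-velocity and time under the map taking (z, t) to (mv t z, t). \<open>H\<^sub>S\<close> is
  first transported to the whole line so that the product is a Borel measure.\<close>

lemma
  assumes \<nu>: "\<nu> \<in> radon_plus \<Gamma>"
  shows Mv_radon_plus: "Mv H\<^sub>S \<Gamma> \<Xi> \<nu> \<in> radon_plus (\<Xi> \<times> S)"
    and borel_ext_Mv: "borel_ext (\<Xi> \<times> S) (Mv H\<^sub>S \<Gamma> \<Xi> \<nu>) =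
      distr (borel_ext \<Gamma> \<nu> \<Otimes>\<^sub>M distr H\<^sub>S borel (\<lambda>x. x)) borel (\<lambda>z. (mv (snd z) (fst z), snd z))"
proof -
  let ?M = "borel_ext \<Gamma> \<nu>" and ?H = "distr H\<^sub>S borel (\<lambda>x. x)"
  let ?k = "\<lambda>z :: (real \<times> real) \<times> real. (mv (snd z) (fst z), snd z)"
  let ?D = "distr (?M \<Otimes>\<^sub>M ?H) borel ?k"
  interpret HS: prob_space H\<^sub>S by (rule prob_HS)
  note fbM = finite_borel_borel_ext[OF \<nu>]
  have idm: "(\<lambda>x. x) \<in> borel_measurable H\<^sub>S" by (rule borel_measurable_HS) simp
  have fbH: "finite_borel ?H"
    using idm by (simp add: finite_borel_def HS.finite_measure_distr)
  interpret M: finite_measure ?M by (rule finite_borelD(1)[OF fbM])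
  interpret H: finite_measure ?H by (rule finite_borelD(1)[OF fbH])
  interpret pair_sigma_finite ?M ?H ..
  note fbP = finite_borel_pair[OF fbM fbH]
  have km: "?k \<in> borel_measurable borel"
    unfolding mv_def case_prod_beta by (intro borel_measurable_continuous_onI continuous_intros)
  note fbD = finite_borel_distr[OF fbP km]
  have mD: "measure ?D C = (\<integral>t. measure ?M {z. (mv t z, t) \<in> C} \<partial>H\<^sub>S)" if C: "C \<in> sets borel" for C
  proof -
    define m where "m t = measure ?M {z. (mv t z, t) \<in> C}" for t
    have kC: "?k -` C \<in> sets (?M \<Otimes>\<^sub>M ?H)"
      using measurable_sets[OF km C] finite_borelD[OF fbP] by simp
    have sec: "(\<lambda>x. (x, t)) -` (?k -` C) = {z. (mv t z, t) \<in> C}" for t by auto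
    have emM: "emeasure ?M ((\<lambda>x. (x, t)) -` (?k -` C)) = ennreal (m t)" for t
      by (simp only: sec m_def M.emeasure_eq_measure)
    have "(\<lambda>t. ennreal (m t)) \<in> borel_measurable ?H"
      unfolding emM[symmetric] by (rule measurable_emeasure_Pair2[OF kC])
    from borel_measurable_enn2real[OF this]
    have mm: "m \<in> borel_measurable borel" by (simp add: m_def[abs_def])
    have "emeasure ?D C = emeasure (?M \<Otimes>\<^sub>M ?H) (?k -` C)"
      using C km finite_borelD[OF fbP] by (simp add: emeasure_distr finite_borel_measurable[OF fbP])
    also have "\<dots> = (\<integral>\<^sup>+t. ennreal (m t) \<partial>?H)"
      by (simp only: emeasure_pair_measure_alt2[OF kC] emM)
    also have "\<dots> = (\<integral>\<^sup>+t. ennreal (m t) \<partial>H\<^sub>S)"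
      using mm idm by (intro nn_integral_distr) auto
    finally have "measure ?D C = enn2real (\<integral>\<^sup>+t. ennreal (m t) \<partial>H\<^sub>S)" by (simp add: measure_def)
    also have "\<dots> = (\<integral>t. m t \<partial>H\<^sub>S)"
      by (intro integral_eq_nn_integral[symmetric] borel_measurable_HS[OF mm]) (simp add: m_def)
    finally show ?thesis by (simp add: m_def)
  qed
  have Mv: "Mv H\<^sub>S \<Gamma> \<Xi> \<nu> = trace_on (\<Xi> \<times> S) ?D"
  proof (rule ext)
    fix C
    show "Mv H\<^sub>S \<Gamma> \<Xi> \<nu> C = trace_on (\<Xi> \<times> S) ?D C"
    proof (cases "C \<in> borel_on (\<Xi> \<times> S)")
      case False
      then show ?thesis by (simp add: Mv_def prod_base_def trace_on_def space_HS)
    next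
      case True
      then have C: "C \<in> sets borel" "C \<subseteq> \<Xi> \<times> S" by (auto simp: borel_on_iff)
      have "Mv_at \<Gamma> \<Xi> t \<nu> {x. (x, t) \<in> C} = measure ?M {z. (mv t z, t) \<in> C}" if "t \<in> S" for t
      proof -
        have "(\<lambda>x. (x, t)) -` C \<in> sets borel"
          using C(1) borel_prod by (metis sets_Pair2)
        then have s: "{x. (x, t) \<in> C} \<in> sets borel" by (simp add: vimage_def)
        then have "{x. (x, t) \<in> C} \<in> borel_on \<Xi>" using C(2) by (auto simp: borel_on_iff)
        moreover have "mv t -` {x. (x, t) \<in> C} \<in> sets borel"
          using measurable_sets[OF measurable_mv s] by simp
        moreover have "mv t -` {x. (x, t) \<in> C} = {z. (mv t z, t) \<in> C}" by auto
        ultimately show ?thesis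
          by (simp add: Mv_at_def' pushforward_def measure_borel_ext[OF \<nu>])
      qed
      then have "(\<integral>t. Mv_at \<Gamma> \<Xi> t \<nu> {x. (x, t) \<in> C} \<partial>H\<^sub>S) = measure ?D C"
        unfolding mD[OF C(1)] by (intro Bochner_Integration.integral_cong refl) (simp add: space_HS)
      then show ?thesis
        using True by (simp add: Mv_def prod_base_def trace_on_def space_HS)
    qed
  qed
  show rp: "Mv H\<^sub>S \<Gamma> \<Xi> \<nu> \<in> radon_plus (\<Xi> \<times> S)"
    unfolding Mv by (rule trace_on_radon_plus[OF fbD]) simp
  have "measure ?D (-(\<Xi> \<times> S)) = (\<integral>t. measure ?M {z. (mv t z, t) \<in> -(\<Xi> \<times> S)} \<partial>H\<^sub>S)"
    by (rule mD) simp
  also have "\<dots> = (\<integral>t. 0 \<partial>H\<^sub>S)"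
  proof (intro Bochner_Integration.integral_cong refl)
    fix t assume "t \<in> space H\<^sub>S"
    then have "{z. (mv t z, t) \<in> -(\<Xi> \<times> S)} \<subseteq> -\<Gamma>" using mv_in_\<Xi> by (auto simp: space_HS)
    then have "measure ?M {z. (mv t z, t) \<in> -(\<Xi> \<times> S)} \<le> measure ?M (-\<Gamma>)"
      using finite_borelD[OF fbM] by (intro M.finite_measure_mono) auto
    then show "measure ?M {z. (mv t z, t) \<in> -(\<Xi> \<times> S)} = 0"
      using measure_borel_ext_Compl[OF \<nu>] measure_nonneg[of ?M] by (simp add: order_antisym)
  qed
  finally show "borel_ext (\<Xi> \<times> S) (Mv H\<^sub>S \<Gamma> \<Xi> \<nu>) = ?D"
    unfolding Mv using rp[unfolded Mv] by (intro borel_ext_trace_on fbD) auto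
qed

text \<open>One \<open>\<psi>\<close> serves all \<open>\<nu>\<close>: extend \<open>\<phi>\<close>
  from the compact set by Tietze with the same bound and integrate out the time. Continuity tested
  through \<open>Mv\<close> thus follows from weak continuity on \<Gamma>.\<close>

lemma signed_integral_Mv:
  assumes \<phi>: "continuous_on (\<Xi> \<times> S) \<phi>"
  obtains \<psi> where "bounded_continuous \<psi>"
    "\<And>\<nu>. \<nu> \<in> radon_plus \<Gamma> \<Longrightarrow>
      signed_integral (\<Xi> \<times> S) (Mv H\<^sub>S \<Gamma> \<Xi> \<nu>) \<phi> = (\<integral>z. \<psi> z \<partial>borel_ext \<Gamma> \<nu>)"
proof -
  let ?H = "distr H\<^sub>S borel (\<lambda>x. x)"
  let ?k = "\<lambda>z :: (real \<times> real) \<times> real. (mv (snd z) (fst z), snd z)"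
  interpret HS: prob_space H\<^sub>S by (rule prob_HS)
  have idm: "(\<lambda>x. x) \<in> borel_measurable H\<^sub>S" by (rule borel_measurable_HS) simp
  have fbH: "finite_borel ?H"
    using idm by (simp add: finite_borel_def HS.finite_measure_distr)
  have k: "continuous_on UNIV ?k"
    unfolding mv_def case_prod_beta by (intro continuous_intros)
  have cpt: "compact (\<Xi> \<times> S)" by (intro compact_Times compact_\<Xi> compact_S)
  have "bounded (\<phi> ` (\<Xi> \<times> S))" by (intro compact_imp_bounded compact_continuous_image \<phi> cpt)
  then obtain K where K: "K > 0" "\<And>x. x \<in> \<Xi> \<times> S \<Longrightarrow> norm (\<phi> x) \<le> K"
    unfolding bounded_pos by blast
  obtain \<phi>' where \<phi>': "continuous_on UNIV \<phi>'" "\<And>x. x \<in> \<Xi> \<times> S \<Longrightarrow> \<phi>' x = \<phi> x" "\<And>x. norm (\<phi>' x) \<le> K"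
    using Tietze[of "\<Xi> \<times> S" \<phi> UNIV K] \<phi> compact_imp_closed[OF cpt] K by auto
  have bc: "bounded_continuous \<phi>'" using \<phi>' by (intro bounded_continuousI[of _ K]) auto
  note bck = bounded_continuous_compose[OF bc k]
  show ?thesis
  proof (rule that)
    show "bounded_continuous (\<lambda>z. \<integral>t. \<phi>' (?k (z, t)) \<partial>?H)"
      by (rule bounded_continuous_integral[OF fbH bck])
    fix \<nu> assume \<nu>: "\<nu> \<in> radon_plus \<Gamma>"
    note fbM = finite_borel_borel_ext[OF \<nu>]
    have "signed_integral (\<Xi> \<times> S) (Mv H\<^sub>S \<Gamma> \<Xi> \<nu>) \<phi> = (\<integral>x. \<phi>' x \<partial>borel_ext (\<Xi> \<times> S) (Mv H\<^sub>S \<Gamma> \<Xi> \<nu>))"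
      using \<phi>' bounded_continuous_measurable[OF bc]
      by (intro signed_integral_radon_plus Mv_radon_plus \<nu>) auto
    also have "\<dots> = (\<integral>z. \<phi>' (?k z) \<partial>(borel_ext \<Gamma> \<nu> \<Otimes>\<^sub>M ?H))"
      unfolding borel_ext_Mv[OF \<nu>]
      by (intro integral_distr_borel finite_borel_pair fbM fbH bounded_continuous_measurable[OF bc]
          borel_measurable_continuous_onI k)
    also have "\<dots> = (\<integral>z. \<integral>t. \<phi>' (?k (z, t)) \<partial>?H \<partial>borel_ext \<Gamma> \<nu>)"
      by (rule integral_pair_bounded_continuous[OF fbM fbH bck])
    finally show "signed_integral (\<Xi> \<times> S) (Mv H\<^sub>S \<Gamma> \<Xi> \<nu>) \<phi> =
        (\<integral>z. \<integral>t. \<phi>' (?k (z, t)) \<partial>?H \<partial>borel_ext \<Gamma> \<nu>)" .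
  qed
qed

text \<open>With the constant 1 as test function, the continuity required of a decomposition becomes
  continuity of its total mass, hence boundedness on the compact \<Theta>.\<close>

lemma signed_integral_Mv_1:
  assumes \<nu>: "\<nu> \<in> radon_plus \<Gamma>"
  shows "signed_integral (\<Xi> \<times> S) (Mv H\<^sub>S \<Gamma> \<Xi> \<nu>) (\<lambda>_. 1) = \<nu> \<Gamma>"
proof -
  interpret HS: prob_space H\<^sub>S by (rule prob_HS)
  have rp: "Mv H\<^sub>S \<Gamma> \<Xi> \<nu> \<in> radon_plus (\<Xi> \<times> S)" by (rule Mv_radon_plus[OF \<nu>])
  have "signed_integral (\<Xi> \<times> S) (Mv H\<^sub>S \<Gamma> \<Xi> \<nu>) (\<lambda>_. 1) = (\<integral>x. 1 \<partial>borel_ext (\<Xi> \<times> S) (Mv H\<^sub>S \<Gamma> \<Xi> \<nu>))"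
    by (intro signed_integral_radon_plus rp) auto
  also have "\<dots> = Mv H\<^sub>S \<Gamma> \<Xi> \<nu> (\<Xi> \<times> S)"
    using measure_borel_ext[OF rp, of UNIV] finite_borelD[OF finite_borel_borel_ext[OF rp]] by simp
  also have "\<dots> = (\<integral>t. Mv_at \<Gamma> \<Xi> t \<nu> {x. (x, t) \<in> \<Xi> \<times> S} \<partial>H\<^sub>S)"
    by (simp add: Mv_def prod_base_def space_HS borel_on_iff)
  also have "\<dots> = (\<integral>t. \<nu> \<Gamma> \<partial>H\<^sub>S)"
  proof (intro Bochner_Integration.integral_cong refl)
    fix t assume "t \<in> space H\<^sub>S"
    then have t: "t \<in> S" by (simp add: space_HS)
    then have "mv t -` \<Xi> \<inter> \<Gamma> = \<Gamma>" using mv_in_\<Xi> by blast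
    then show "Mv_at \<Gamma> \<Xi> t \<nu> {x. (x, t) \<in> \<Xi> \<times> S} = \<nu> \<Gamma>"
      using t by (simp add: Mv_at_def' pushforward_def borel_on_iff)
  qed
  also have "\<dots> = \<nu> \<Gamma>" by (simp add: HS.prob_space)
  finally show ?thesis .
qed

lemma continuous_decomposition_feasible_Pi:
  assumes u: "u \<in> S \<rightarrow> radon_plus \<Omega>" and g: "feasible_Pi u g" "g \<in> \<Theta> \<rightarrow>\<^sub>E radon_plus \<Gamma>"
  shows "continuous_decomposition S \<Theta> \<Gamma> \<Xi> H\<^sub>S H\<^sub>\<Theta> (base_prod H\<^sub>\<Theta> \<Gamma> g) g"
  unfolding continuous_decomposition_def
proof (intro conjI allI impI)
  show "measurable_family H\<^sub>\<Theta> \<Gamma> g" by (rule measurable_family_feasible_Pi[OF u g(1)])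
  fix \<phi> :: "real \<times> real \<Rightarrow> real" assume "continuous_on (\<Xi> \<times> S) \<phi>"
  then obtain \<psi> where \<psi>: "bounded_continuous \<psi>"
    "\<And>\<nu>. \<nu> \<in> radon_plus \<Gamma> \<Longrightarrow>
      signed_integral (\<Xi> \<times> S) (Mv H\<^sub>S \<Gamma> \<Xi> \<nu>) \<phi> = (\<integral>z. \<psi> z \<partial>borel_ext \<Gamma> \<nu>)"
    by (rule signed_integral_Mv) blast
  have "continuous_on \<Theta> (\<lambda>\<theta>. \<integral>z. \<psi> z \<partial>borel_ext \<Gamma> (g \<theta>))"
    using g(1) feasible_Pi_projects[OF u] by (intro projects_weakly_continuous[OF u _ \<psi>(1)]) auto
  then show "continuous_on \<Theta> (\<lambda>\<theta>. signed_integral (\<Xi> \<times> S) (Mv H\<^sub>S \<Gamma> \<Xi> (g \<theta>)) \<phi>)"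
    using g(2) by (subst continuous_on_cong[OF refl \<psi>(2)]) auto
qed (use g in auto)

text \<open>The set where the two differ is relatively open in \<Theta>; if it were nonempty, full
  support would give it positive measure.\<close>

lemma continuous_AE_eq:
  fixes f h :: "real^'n \<Rightarrow> real"
  assumes f: "continuous_on \<Theta> f" and h: "continuous_on \<Theta> h" and eq: "AE \<theta> in H\<^sub>\<Theta>. f \<theta> = h \<theta>"
    and \<theta>: "\<theta> \<in> \<Theta>"
  shows "f \<theta> = h \<theta>"
proof (rule ccontr)
  assume neq: "f \<theta> \<noteq> h \<theta>"
  have "continuous_on \<Theta> (\<lambda>\<theta>. f \<theta> - h \<theta>)" using f h by (intro continuous_intros)
  moreover have "open (-{0::real})" by auto
  ultimately obtain U where U: "open U" "U \<inter> \<Theta> = (\<lambda>\<theta>. f \<theta> - h \<theta>) -` (-{0}) \<inter> \<Theta>"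
    unfolding continuous_on_open_invariant by blast
  have "\<theta> \<in> U" using U(2) neq \<theta> by auto
  then have pos: "0 < emeasure H\<^sub>\<Theta> (U \<inter> space H\<^sub>\<Theta>)"
    using \<theta> support_HT U(1) unfolding measure_support_def by blast
  have "U \<inter> \<Theta> \<in> sets H\<^sub>\<Theta>" using U(1) borel_on_Int[of U \<Theta>] by (simp add: sets_HT)
  moreover have "AE \<theta> in H\<^sub>\<Theta>. \<theta> \<notin> U \<inter> \<Theta>"
    using eq by eventually_elim (simp add: U(2))
  ultimately have "U \<inter> \<Theta> \<in> null_sets H\<^sub>\<Theta>" using AE_iff_null_sets by blast
  then show False using pos by (simp add: space_HT null_sets_def)
qed

text \<open>Only the image under \<open>Mv\<close> is assumed continuous. The families agree almost
  everywhere on each fixed set, hence after integrating a test function; continuity and full support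
  extend this to every \<theta>, and injectivity removes \<open>Mv\<close>.\<close>

lemma continuous_decomposition_unique:
  assumes 1: "continuous_decomposition S \<Theta> \<Gamma> \<Xi> H\<^sub>S H\<^sub>\<Theta> \<gamma> g1"
    and 2: "continuous_decomposition S \<Theta> \<Gamma> \<Xi> H\<^sub>S H\<^sub>\<Theta> \<gamma> g2"
  shows "g1 = g2"
proof -
  interpret HT: prob_space H\<^sub>\<Theta> by (rule prob_HT)
  let ?CD = "continuous_decomposition S \<Theta> \<Gamma> \<Xi> H\<^sub>S H\<^sub>\<Theta> \<gamma>"
  have rp: "g \<theta> \<in> radon_plus \<Gamma>" if "?CD g" "\<theta> \<in> \<Theta>" for g \<theta>
    using that by (auto simp: continuous_decomposition_def)
  have cont: "continuous_on \<Theta> (\<lambda>\<theta>. signed_integral (\<Xi> \<times> S) (Mv H\<^sub>S \<Gamma> \<Xi> (g \<theta>)) \<phi>)"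
    if "?CD g" "continuous_on (\<Xi> \<times> S) \<phi>" for g \<phi>
    using that by (auto simp: continuous_decomposition_def)
  have nn: "(\<lambda>\<theta>. ennreal (g \<theta> A)) \<in> borel_measurable H\<^sub>\<Theta>"
    "(\<integral>\<^sup>+\<theta>. ennreal (g \<theta> A) * indicator B \<theta> \<partial>H\<^sub>\<Theta>) = ennreal (\<gamma> (B \<times> A))"
    if g: "?CD g" and A: "A \<in> borel_on \<Gamma>" and B: "B \<in> sets H\<^sub>\<Theta>" for g A B
  proof -
    \<comment> \<open>The bound on the masses makes the Bochner integral in \<open>base_prod\<close>
      a true integral and not the default 0.\<close>
    have "continuous_on \<Theta> (\<lambda>\<theta>. g \<theta> \<Gamma>)"
      using cont[OF g continuous_on_const[of _ 1]] rp[OF g]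
      by (subst (asm) continuous_on_cong[OF refl signed_integral_Mv_1]) auto
    then have "bounded ((\<lambda>\<theta>. g \<theta> \<Gamma>) ` \<Theta>)"
      by (intro compact_imp_bounded compact_continuous_image compact_\<Theta>)
    then obtain c where c: "\<And>\<theta>. \<theta> \<in> \<Theta> \<Longrightarrow> \<bar>g \<theta> \<Gamma>\<bar> \<le> c"
      unfolding bounded_iff by auto
    have le: "\<bar>g \<theta> A\<bar> \<le> c" if \<theta>: "\<theta> \<in> \<Theta>" for \<theta>
    proof -
      note r = rp[OF g \<theta>]
      interpret finite_measure "borel_ext \<Gamma> (g \<theta>)"
        by (rule finite_borelD(1)[OF finite_borel_borel_ext[OF r]])
      have A': "A \<in> sets borel" "A \<inter> \<Gamma> = A" using A by (auto simp: borel_on_iff)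
      have "g \<theta> A \<le> g \<theta> \<Gamma>"
        using finite_measure_mono[of A UNIV] measure_borel_ext[OF r, of UNIV] measure_borel_ext[OF r A'(1)]
          finite_borelD[OF finite_borel_borel_ext[OF r]] A' by simp
      then show ?thesis using c[OF \<theta>] radon_plusD(1)[OF r] by (simp add: abs_of_nonneg)
    qed
    have meas: "(\<lambda>\<theta>. g \<theta> A) \<in> borel_measurable H\<^sub>\<Theta>"
      using g A by (auto simp: continuous_decomposition_def measurable_family_def)
    then show "(\<lambda>\<theta>. ennreal (g \<theta> A)) \<in> borel_measurable H\<^sub>\<Theta>" by simp
    have int: "integrable H\<^sub>\<Theta> (\<lambda>\<theta>. indicator B \<theta> *\<^sub>R g \<theta> A)"
    proof (intro HT.integrable_const_bound[of _ c])
      have "0 \<le> c" using c \<Theta>_ne abs_ge_zero order_trans by blast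
      then show "AE \<theta> in H\<^sub>\<Theta>. norm (indicator B \<theta> *\<^sub>R g \<theta> A) \<le> c"
        using le by (intro AE_I2) (simp add: space_HT indicator_def)
    qed (use meas B in auto)
    have "(\<integral>\<^sup>+\<theta>. ennreal (g \<theta> A) * indicator B \<theta> \<partial>H\<^sub>\<Theta>) = (\<integral>\<^sup>+\<theta>. ennreal (indicator B \<theta> *\<^sub>R g \<theta> A) \<partial>H\<^sub>\<Theta>)"
      by (intro nn_integral_cong) (auto simp: indicator_def)
    also have "\<dots> = ennreal (LINT \<theta>:B|H\<^sub>\<Theta>. g \<theta> A)"
      unfolding set_lebesgue_integral_def using radon_plusD(1)[OF rp[OF g]]
      by (intro nn_integral_eq_integral int AE_I2) (auto simp: space_HT)
    also have "(LINT \<theta>:B|H\<^sub>\<Theta>. g \<theta> A) = base_prod H\<^sub>\<Theta> \<Gamma> g (B \<times> A)"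
      using rp[OF g] radon_plusD(3) A B
      by (intro base_prod_times[symmetric]) (auto simp: space_HT sets_HT)
    finally show "(\<integral>\<^sup>+\<theta>. ennreal (g \<theta> A) * indicator B \<theta> \<partial>H\<^sub>\<Theta>) = ennreal (\<gamma> (B \<times> A))"
      using g by (simp add: continuous_decomposition_def)
  qed
  have AE: "AE \<theta> in H\<^sub>\<Theta>. measure (borel_ext \<Gamma> (g1 \<theta>)) A = measure (borel_ext \<Gamma> (g2 \<theta>)) A"
    if A: "A \<in> sets borel" for A
  proof -
    note A' = borel_on_Int[OF A, of \<Gamma>]
    \<comment> \<open>Both sides are densities of the finite measure with value \<gamma> (B \<times>
      (A \<inter> \<Gamma>)) on \<open>B\<close>, and densities are unique almost
      everywhere.\<close>
    have "AE \<theta> in H\<^sub>\<Theta>. ennreal (g1 \<theta> (A \<inter> \<Gamma>)) = ennreal (g2 \<theta> (A \<inter> \<Gamma>))"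
      by (rule HT.density_unique_finite_measure)
        (use nn[OF 1 A'] nn[OF 2 A'] in auto)
    then show ?thesis
      using AE_space
    proof eventually_elim
      case (elim \<theta>)
      then have r: "g1 \<theta> \<in> radon_plus \<Gamma>" "g2 \<theta> \<in> radon_plus \<Gamma>"
        using rp[OF 1] rp[OF 2] by (auto simp: space_HT)
      then show ?case
        using elim(1) radon_plusD(1)[OF r(1)] radon_plusD(1)[OF r(2)] by (simp add: measure_borel_ext A)
    qed
  qed
  have eq: "signed_integral (\<Xi> \<times> S) (Mv H\<^sub>S \<Gamma> \<Xi> (g1 \<theta>)) \<phi> = signed_integral (\<Xi> \<times> S) (Mv H\<^sub>S \<Gamma> \<Xi> (g2 \<theta>)) \<phi>"
    if \<phi>: "continuous_on (\<Xi> \<times> S) \<phi>" and \<theta>: "\<theta> \<in> \<Theta>" for \<phi> \<theta>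
  proof (rule continuous_AE_eq[OF cont[OF 1 \<phi>] cont[OF 2 \<phi>] _ \<theta>])
    obtain \<psi> where \<psi>: "bounded_continuous \<psi>"
      "\<And>\<nu>. \<nu> \<in> radon_plus \<Gamma> \<Longrightarrow>
        signed_integral (\<Xi> \<times> S) (Mv H\<^sub>S \<Gamma> \<Xi> \<nu>) \<phi> = (\<integral>z. \<psi> z \<partial>borel_ext \<Gamma> \<nu>)"
      by (rule signed_integral_Mv[OF \<phi>]) blast
    have "AE \<theta> in H\<^sub>\<Theta>. (\<integral>z. \<psi> z \<partial>borel_ext \<Gamma> (g1 \<theta>)) = (\<integral>z. \<psi> z \<partial>borel_ext \<Gamma> (g2 \<theta>))"
      by (rule AE_eq_integral[OF _ _ AE \<psi>(1)])
        (use rp[OF 1] rp[OF 2] in \<open>auto simp: space_HT finite_borel_borel_ext\<close>)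
    then show "AE \<theta> in H\<^sub>\<Theta>. signed_integral (\<Xi> \<times> S) (Mv H\<^sub>S \<Gamma> \<Xi> (g1 \<theta>)) \<phi> =
        signed_integral (\<Xi> \<times> S) (Mv H\<^sub>S \<Gamma> \<Xi> (g2 \<theta>)) \<phi>"
      using AE_space
      by eventually_elim (use rp[OF 1] rp[OF 2] in \<open>simp add: space_HT \<psi>(2)\<close>)
  qed
  have "g1 \<theta> = g2 \<theta>" if \<theta>: "\<theta> \<in> \<Theta>" for \<theta>
  proof -
    note r = rp[OF 1 \<theta>] rp[OF 2 \<theta>]
    note R = Mv_radon_plus[OF r(1)] Mv_radon_plus[OF r(2)]
    have "borel_ext (\<Xi> \<times> S) (Mv H\<^sub>S \<Gamma> \<Xi> (g1 \<theta>)) = borel_ext (\<Xi> \<times> S) (Mv H\<^sub>S \<Gamma> \<Xi> (g2 \<theta>))"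
    proof (rule bounded_continuous_eqI)
      fix \<phi> :: "real \<times> real \<Rightarrow> real" assume \<phi>: "bounded_continuous \<phi>"
      then have "continuous_on (\<Xi> \<times> S) \<phi>"
        using continuous_on_subset by (auto simp: bounded_continuous_def)
      from eq[OF this \<theta>] show "(\<integral>x. \<phi> x \<partial>borel_ext (\<Xi> \<times> S) (Mv H\<^sub>S \<Gamma> \<Xi> (g1 \<theta>))) =
          (\<integral>x. \<phi> x \<partial>borel_ext (\<Xi> \<times> S) (Mv H\<^sub>S \<Gamma> \<Xi> (g2 \<theta>)))"
        using signed_integral_radon_plus[OF R(1) _ bounded_continuous_measurable[OF \<phi>], of \<phi>]
          signed_integral_radon_plus[OF R(2) _ bounded_continuous_measurable[OF \<phi>], of \<phi>] by simp
    qed (intro finite_borel_borel_ext R)+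
    then have "Mv H\<^sub>S \<Gamma> \<Xi> (g1 \<theta>) = Mv H\<^sub>S \<Gamma> \<Xi> (g2 \<theta>)"
      using trace_on_borel_ext[OF R(1) borel_sets(8)] trace_on_borel_ext[OF R(2) borel_sets(8)]
      by metis
    then show ?thesis
      by (rule inj_onD[OF inj_Mv]) (auto intro: radon_plusD(3) r)
  qed
  \<comment> \<open>Families take the value \<open>undefined\<close> off \<Theta>, so equality on
    \<Theta> is equality of functions.\<close>
  moreover have "g1 \<in> extensional \<Theta>" "g2 \<in> extensional \<Theta>"
    using 1 2 by (auto simp: continuous_decomposition_def PiE_def)
  ultimately show ?thesis using extensionalityI[of g1 \<Theta> g2] by blast
qed


end

section \<open>Equivalence of the minimization problems\<close>

context dynamic_setting
begin

lemma tv_norm_feasible_P: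
  assumes u: "u \<in> S \<rightarrow> radon_plus \<Omega>" and \<gamma>: "feasible_P u \<gamma>" and t: "t \<in> S"
  shows "tv_norm (\<Theta> \<times> \<Gamma>) \<gamma> = u t \<Omega>"
proof -
  interpret HT: prob_space H\<^sub>\<Theta> by (rule prob_HT)
  have "\<gamma> \<in> radon_plus (\<Theta> \<times> \<Gamma>)" using \<gamma> by (simp add: feasible_P_def)
  then have "tv_norm (\<Theta> \<times> \<Gamma>) \<gamma> = \<gamma> (\<Theta> \<times> \<Gamma>)" by (rule tv_norm_radon_plus) simp
  also have "\<dots> = u t \<Omega>"
    using feasible_P_mass[OF u \<gamma> t, of \<Theta>] HT.prob_space by (simp add: borel_on_iff space_HT)
  finally show ?thesis .
qed

lemma tv_norm_feasible_Pi:
  assumes u: "u \<in> S \<rightarrow> radon_plus \<Omega>" and g: "feasible_Pi u g" and t: "t \<in> S" and \<theta>: "\<theta> \<in> \<Theta>"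
  shows "tv_norm \<Gamma> (g \<theta>) = u t \<Omega>"
proof -
  have "g \<theta> \<in> radon_plus \<Gamma>" using g \<theta> by (simp add: feasible_Pi_def)
  then have "tv_norm \<Gamma> (g \<theta>) = g \<theta> \<Gamma>" by (rule tv_norm_radon_plus) simp
  then show ?thesis using feasible_Pi_mass[OF u g t \<theta>] by simp
qed

text \<open>Minimality speaks about all competitors, so the mass formula is applied to each of them,
  always at the one time \<open>t\<close>. The objective then depends on \<open>u\<close>
  alone.\<close>

lemma solves_P_iff:
  assumes t: "t \<in> S"
  shows "solves_P \<Omega> S \<Theta> \<Gamma> \<Xi> H\<^sub>\<Theta> T Ob \<alpha> f u \<gamma> \<longleftrightarrow>
    u \<in> S \<rightarrow>\<^sub>E radon_plus \<Omega> \<and> feasible_P u \<gamma> \<and> data_constraint T Ob \<alpha> f u \<and>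
    (\<forall>u' \<gamma>'. u' \<in> S \<rightarrow>\<^sub>E radon_plus \<Omega> \<longrightarrow> feasible_P u' \<gamma>' \<longrightarrow> data_constraint T Ob \<alpha> f u' \<longrightarrow>
      u t \<Omega> + data_term T Ob \<alpha> f u \<le> u' t \<Omega> + data_term T Ob \<alpha> f u')"
proof -
  have "tv_norm (\<Theta> \<times> \<Gamma>) \<gamma>' = u' t \<Omega>" if "u' \<in> S \<rightarrow>\<^sub>E radon_plus \<Omega>" "feasible_P u' \<gamma>'" for u' \<gamma>'
    using that PiE_iff t by (intro tv_norm_feasible_P) auto
  then show ?thesis
    unfolding solves_P_def is_arg_min_def feasible_P_def not_ex split_paired_All prod.case
    by (smt (verit, ccfv_threshold))
qed

lemma solves_Pi_P_iff:
  assumes t: "t \<in> S" and \<theta>: "\<theta>\<^sub>0 \<in> \<Theta>"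
  shows "solves_Pi_P \<Omega> S \<Theta> \<Gamma> \<Xi> \<theta>\<^sub>0 T Ob \<alpha> f u g \<longleftrightarrow>
    u \<in> S \<rightarrow>\<^sub>E radon_plus \<Omega> \<and> g \<in> \<Theta> \<rightarrow>\<^sub>E radon_plus \<Gamma> \<and> feasible_Pi u g \<and> data_constraint T Ob \<alpha> f u \<and>
    (\<forall>u' g'. u' \<in> S \<rightarrow>\<^sub>E radon_plus \<Omega> \<longrightarrow> g' \<in> \<Theta> \<rightarrow>\<^sub>E radon_plus \<Gamma> \<longrightarrow> feasible_Pi u' g' \<longrightarrow>
      data_constraint T Ob \<alpha> f u' \<longrightarrow>
      u t \<Omega> + data_term T Ob \<alpha> f u \<le> u' t \<Omega> + data_term T Ob \<alpha> f u')"
proof -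
  have Pi: "feasible_Pi u' g' \<longleftrightarrow> (\<forall>t\<in>S. \<forall>\<theta>\<in>\<Theta>. Mv_at \<Gamma> \<Xi> t (g' \<theta>) = Rd_at \<Omega> \<Xi> \<theta> (u' t))"
    if "g' \<in> \<Theta> \<rightarrow>\<^sub>E radon_plus \<Gamma>" for u' g'
    using PiE_mem[OF that] by (simp add: feasible_Pi_def)
  have "tv_norm \<Gamma> (g' \<theta>\<^sub>0) = u' t \<Omega>" if "u' \<in> S \<rightarrow>\<^sub>E radon_plus \<Omega>" "feasible_Pi u' g'" for u' g'
    using that t \<theta> by (intro tv_norm_feasible_Pi) auto
  then show ?thesis
    unfolding solves_Pi_P_def is_arg_min_def not_ex split_paired_All prod.case
    using Pi by (smt (verit, ccfv_threshold))
qed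

lemma solves_P_imp_solves_Pi_P:
  assumes \<theta>: "\<theta>\<^sub>0 \<in> \<Theta>" and P: "solves_P \<Omega> S \<Theta> \<Gamma> \<Xi> H\<^sub>\<Theta> T Ob \<alpha> f u \<gamma>"
  obtains g where "continuous_decomposition S \<Theta> \<Gamma> \<Xi> H\<^sub>S H\<^sub>\<Theta> \<gamma> g"
    "solves_Pi_P \<Omega> S \<Theta> \<Gamma> \<Xi> \<theta>\<^sub>0 T Ob \<alpha> f u g"
proof -
  obtain t where t: "t \<in> S" using S_ne by auto
  note P' = P[unfolded solves_P_iff[OF t]]
  have u: "u' \<in> S \<rightarrow> radon_plus \<Omega>" if "u' \<in> S \<rightarrow>\<^sub>E radon_plus \<Omega>" for u' using that by auto
  from P' have u': "u \<in> S \<rightarrow> radon_plus \<Omega>" and \<gamma>: "feasible_P u \<gamma>" using u by auto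
  obtain g where g: "g \<in> \<Theta> \<rightarrow>\<^sub>E radon_plus \<Gamma>" "feasible_Pi u g" "\<gamma> = base_prod H\<^sub>\<Theta> \<Gamma> g"
    by (rule feasible_P_decomposition[OF u' \<gamma>])
  have "solves_Pi_P \<Omega> S \<Theta> \<Gamma> \<Xi> \<theta>\<^sub>0 T Ob \<alpha> f u g"
    unfolding solves_Pi_P_iff[OF t \<theta>]
  proof (intro conjI allI impI)
    fix u' g' assume *: "u' \<in> S \<rightarrow>\<^sub>E radon_plus \<Omega>" "feasible_Pi u' g'" "data_constraint T Ob \<alpha> f u'"
    show "u t \<Omega> + data_term T Ob \<alpha> f u \<le> u' t \<Omega> + data_term T Ob \<alpha> f u'"
      \<comment> \<open>A competitor of the second problem becomes one of the first with the same
        \<open>u'\<close>, where the minimality of \<open>u\<close> applies.\<close>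
      using P' * feasible_P_base_prod[OF u[OF *(1)] *(2)] by blast
  qed (use P' g in auto)
  then show ?thesis
    using that[of g] continuous_decomposition_feasible_Pi[OF u' g(2,1)] g(3) by simp
qed

lemma solves_Pi_P_imp_solves_P:
  assumes \<theta>: "\<theta>\<^sub>0 \<in> \<Theta>" and Pi: "solves_Pi_P \<Omega> S \<Theta> \<Gamma> \<Xi> \<theta>\<^sub>0 T Ob \<alpha> f u g"
  shows "measurable_family H\<^sub>\<Theta> \<Gamma> g" "solves_P \<Omega> S \<Theta> \<Gamma> \<Xi> H\<^sub>\<Theta> T Ob \<alpha> f u (base_prod H\<^sub>\<Theta> \<Gamma> g)"
proof -
  obtain t where t: "t \<in> S" using S_ne by auto
  note Pi' = Pi[unfolded solves_Pi_P_iff[OF t \<theta>]]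
  have u: "u' \<in> S \<rightarrow> radon_plus \<Omega>" if "u' \<in> S \<rightarrow>\<^sub>E radon_plus \<Omega>" for u' using that by auto
  from Pi' have u': "u \<in> S \<rightarrow> radon_plus \<Omega>" and g: "feasible_Pi u g" using u by auto
  show "measurable_family H\<^sub>\<Theta> \<Gamma> g" by (rule measurable_family_feasible_Pi[OF u' g])
  show "solves_P \<Omega> S \<Theta> \<Gamma> \<Xi> H\<^sub>\<Theta> T Ob \<alpha> f u (base_prod H\<^sub>\<Theta> \<Gamma> g)"
    unfolding solves_P_iff[OF t]
    \<comment> \<open>Conversely, a competitor of the first problem is decomposed into one of the
      second with the same \<open>u\<close>.\<close>
    using Pi' feasible_P_base_prod[OF u' g] feasible_P_decomposition u by metis
qed

end

theorem proposition88:
  fixes \<Omega> \<Theta> :: "(real^'n) set" and S T \<Xi> :: "real set" and \<Gamma> :: "(real \<times> real) set"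
    and H\<^sub>S :: "real measure" and H\<^sub>\<Theta> :: "(real^'n) measure"
    and Ob :: "real \<Rightarrow> ((real^'n) set \<Rightarrow> real) \<Rightarrow> 'h::{real_inner, complete_space}"
    and Ob_pre :: "real \<Rightarrow> 'h \<Rightarrow> (real^'n) \<Rightarrow> real"
    and f :: "real \<Rightarrow> 'h" and \<alpha> :: real and \<theta>\<^sub>0 :: "(real^'n)"
  assumes "compact \<Omega>" and "compact S" and "compact \<Theta>" and "\<Theta> \<subseteq> sphere 0 1"
    and "finite T" and "T \<noteq> {}" and "T \<subseteq> S"
    and "sets H\<^sub>S = borel_on S" and "prob_space H\<^sub>S"
    and "sets H\<^sub>\<Theta> = borel_on \<Theta>" and "prob_space H\<^sub>\<Theta>" and "measure_support H\<^sub>\<Theta> = \<Theta>"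
    and "\<Gamma> = Gamma_set \<Omega> S \<Theta>" and "\<Xi> = Xi_set \<Omega> \<Theta>"
    and "\<forall>t\<in>T. bounded_linear_to_C \<Omega> (Ob_pre t)"
    and "\<forall>t\<in>T. is_dual_of \<Omega> (Ob t) (Ob_pre t)"
    and "inj_on (Mv H\<^sub>S \<Gamma> \<Xi>) (radon \<Gamma>)"
    and "0 \<le> \<alpha>" and "\<theta>\<^sub>0 \<in> \<Theta>"
  shows "(\<forall>u \<gamma>. solves_P \<Omega> S \<Theta> \<Gamma> \<Xi> H\<^sub>\<Theta> T Ob \<alpha> f u \<gamma> \<longrightarrow>
            (\<exists>!g. continuous_decomposition S \<Theta> \<Gamma> \<Xi> H\<^sub>S H\<^sub>\<Theta> \<gamma> g) \<and>
            (\<forall>g. continuous_decomposition S \<Theta> \<Gamma> \<Xi> H\<^sub>S H\<^sub>\<Theta> \<gamma> g \<longrightarrow>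
                 solves_Pi_P \<Omega> S \<Theta> \<Gamma> \<Xi> \<theta>\<^sub>0 T Ob \<alpha> f u g)) \<and>
         (\<forall>u g. solves_Pi_P \<Omega> S \<Theta> \<Gamma> \<Xi> \<theta>\<^sub>0 T Ob \<alpha> f u g \<longrightarrow>
            measurable_family H\<^sub>\<Theta> \<Gamma> g \<and>
            solves_P \<Omega> S \<Theta> \<Gamma> \<Xi> H\<^sub>\<Theta> T Ob \<alpha> f u (base_prod H\<^sub>\<Theta> \<Gamma> g))"
proof -
  have "S \<noteq> {}" "\<Theta> \<noteq> {}"
    using \<open>T \<noteq> {}\<close> \<open>T \<subseteq> S\<close> \<open>\<theta>\<^sub>0 \<in> \<Theta>\<close> by auto
  interpret dynamic_setting \<Omega> \<Theta> S \<Xi> \<Gamma> H\<^sub>S H\<^sub>\<Theta>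
    by (intro dynamic_setting.intro) fact+
  show ?thesis
    \<comment> \<open>By uniqueness any given decomposition is the one that was constructed, so the
      claim for every \<open>g\<close> follows from the existence of a single solution.\<close>
    using solves_P_imp_solves_Pi_P[OF \<open>\<theta>\<^sub>0 \<in> \<Theta>\<close>] continuous_decomposition_unique
      solves_Pi_P_imp_solves_P[OF \<open>\<theta>\<^sub>0 \<in> \<Theta>\<close>] by metis
qed

end
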